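(* Let $\beta_1=\beta_2=\beta>1$, and let $\zeta(t)=(\zeta_1(t),\zeta_2(t))$ be the balls-in-bins model with reflection in the domain $Q_{\varphi,\psi}$, where $\varphi(x)=x^{\alpha}$ and $\psi(x)=x^{\gamma}$ for some $\alpha,\gamma$ with $0<\alpha<1<\gamma$. Then for any initial state $\zeta(0)=\zeta\in Q_{\varphi,\psi}$ (from which the chain is well defined) there exist integers $k_1=k_1(\alpha,\beta)$ and $k_2=k_2(\gamma,\beta)$ such that $$\mathsf{P}_{\zeta}\left(A_{\alpha,k_1}\right)+\mathsf{P}_{\zeta}\left(\widetilde{A}_{\gamma,k_2}\right)=1,$$ where $k_1$ and $k_2$ are the integer solutions of the inequalities $$\frac{\alpha}{(\beta-1)(1-\alpha)}<k_1\leq 1+\frac{\alpha}{(\beta-1)(1-\alpha)}$$ and $$\frac{1}{(\beta-1)(\gamma-1)}<k_2\leq 1+\frac{1}{(\beta-1)(\gamma-1)}.$$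
   Context: $\mathbb{N}=\{1,2,\dots\}$. For increasing functions $\varphi,\psi$, $Q_{\varphi,\psi}=\{(x,y)\in\mathbb{N}^2:\varphi(x)\leq y\leq\psi(x)\}$. The balls-in-bins model with reflection in $Q_{\varphi,\psi}$ with parameters $\beta_1,\beta_2>0$ is the discrete time Markov chain $\zeta(t)=(\zeta_1(t),\zeta_2(t))\in Q_{\varphi,\psi}$, $t\in\{0,1,2,\dots\}$, with the following transitions from a state $(x,y)$: (i) if $\varphi(x+1)\leq y\leq\psi(x)-1$, it moves to $(x+1,y)$ with probability $\frac{x^{\beta_1}}{x^{\beta_1}+y^{\beta_2}}$ and to $(x,y+1)$ with probability $\frac{y^{\beta_2}}{x^{\beta_1}+y^{\beta_2}}$; (ii) if $\varphi(x)\leq y<\varphi(x+1)$, it moves to $(x,y+1)$ with probability 1 (reflection by the lower boundary); (iii) if $\psi(x)-1<y\leq\psi(x)$, it moves to $(x+1,y)$ with probability 1 (reflection by the upper boundary). The chain is well defined from an initial state if no state satisfying the conditions of both (ii) and (iii) is reachable from it (the initial state itself included). $\mathsf{P}_\zeta$ is the distribution of the chain started at $\zeta$. Events: for $\alpha\in(0,1)$, $k\in\mathbb{N}$, $$A_{\alpha,k}=\Big\{\limsup_{t\to\infty}(\zeta_2(t)-\zeta_1^{\alpha}(t))=k\Big\}\cap\Big\{\liminf_{t\to\infty}(\zeta_2(t)-\zeta_1^{\alpha}(t))=0\Big\};$$ for $\gamma\geq1$, $k\in\mathbb{N}$, $$\widetilde A_{\gamma,k}=\Big\{\limsup_{t\to\infty}(\zeta_1(t)-\zeta_2^{1/\gamma}(t))=k\Big\}\cap\Big\{\liminf_{t\to\infty}(\zeta_1(t)-\zeta_2^{1/\gamma}(t))=0\Big\}.$$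 *)

theory Defs
  imports "HOL-Probability.Probability"
begin

text \<open>
  \<open>markov_chain_from M X K s\<close>: on the probability space \<open>M\<close>, the process \<open>X\<close> is a
  time-homogeneous discrete-time Markov chain started at \<open>s\<close> whose transition probabilities from a
  state \<open>u\<close> are given by \<open>K u\<close>. Conditioning is on the whole history up to time \<open>n\<close>, along a path
  \<open>u 0, \<dots>, u n\<close> of positive probability; for a countable state space (the only use below) this
  determines the law of \<open>X\<close> on path space uniquely.
\<close>

definition markov_chain_from ::
    "'a measure \<Rightarrow> (nat \<Rightarrow> 'a \<Rightarrow> 's) \<Rightarrow> ('s \<Rightarrow> 's pmf) \<Rightarrow> 's::countable \<Rightarrow> bool" where
  "markov_chain_from M X K s \<longleftrightarrow>
     prob_space M \<and>
     (\<forall>t. X t \<in> measurable M (count_space UNIV)) \<and>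
     (AE \<omega> in M. X 0 \<omega> = s) \<and>
     (\<forall>n u v. measure M {\<omega> \<in> space M. \<forall>i\<le>n. X i \<omega> = u i} > 0 \<longrightarrow>
        cond_prob M (\<lambda>\<omega>. X (Suc n) \<omega> = v) (\<lambda>\<omega>. \<forall>i\<le>n. X i \<omega> = u i) = pmf (K (u n)) v)"

text \<open>States are pairs of natural numbers; positivity of both coordinates is part of the domain.\<close>

definition Q_domain :: "(real \<Rightarrow> real) \<Rightarrow> (real \<Rightarrow> real) \<Rightarrow> (nat \<times> nat) set" where
  "Q_domain \<phi> \<psi> = {(x, y). x \<ge> 1 \<and> y \<ge> 1 \<and> \<phi> (real x) \<le> real y \<and> real y \<le> \<psi> (real x)}"

definition interior_state :: "(real \<Rightarrow> real) \<Rightarrow> (real \<Rightarrow> real) \<Rightarrow> nat \<times> nat \<Rightarrow> bool" where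
  "interior_state \<phi> \<psi> = (\<lambda>(x, y). \<phi> (real x + 1) \<le> real y \<and> real y \<le> \<psi> (real x) - 1)"

definition lower_reflecting :: "(real \<Rightarrow> real) \<Rightarrow> nat \<times> nat \<Rightarrow> bool" where
  "lower_reflecting \<phi> = (\<lambda>(x, y). \<phi> (real x) \<le> real y \<and> real y < \<phi> (real x + 1))"

definition upper_reflecting :: "(real \<Rightarrow> real) \<Rightarrow> nat \<times> nat \<Rightarrow> bool" where
  "upper_reflecting \<psi> = (\<lambda>(x, y). \<psi> (real x) - 1 < real y \<and> real y \<le> \<psi> (real x))"

text \<open>
  Transition kernel. In the domain the three conditions are exhaustive and only the last two can
  overlap; the value at such an overlap, and outside the domain (last branch), is an arbitrary
  convention that never matters for a chain satisfying \<open>well_defined_from\<close> below.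
\<close>

definition bins_step ::
    "(real \<Rightarrow> real) \<Rightarrow> (real \<Rightarrow> real) \<Rightarrow> real \<Rightarrow> real \<Rightarrow> nat \<times> nat \<Rightarrow> (nat \<times> nat) pmf" where
  "bins_step \<phi> \<psi> \<beta>1 \<beta>2 = (\<lambda>(x, y).
     if interior_state \<phi> \<psi> (x, y) then
       map_pmf (\<lambda>b. if b then (x + 1, y) else (x, y + 1))
         (bernoulli_pmf (real x powr \<beta>1 / (real x powr \<beta>1 + real y powr \<beta>2)))
     else if lower_reflecting \<phi> (x, y) then return_pmf (x, y + 1)
     else if upper_reflecting \<psi> (x, y) then return_pmf (x + 1, y)
     else return_pmf (x, y))"

text \<open>
  Reachability means reachability by finitely many (possibly zero) transitions of positive
  probability. The convention at overlap states does not affect this notion: the first overlap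
  state on a path is reached through transitions from non-overlap states only.
\<close>

definition well_defined_from ::
    "(real \<Rightarrow> real) \<Rightarrow> (real \<Rightarrow> real) \<Rightarrow> real \<Rightarrow> real \<Rightarrow> nat \<times> nat \<Rightarrow> bool" where
  "well_defined_from \<phi> \<psi> \<beta>1 \<beta>2 s \<longleftrightarrow>
     (\<forall>r. (\<lambda>u v. v \<in> set_pmf (bins_step \<phi> \<psi> \<beta>1 \<beta>2 u))\<^sup>*\<^sup>* s r \<longrightarrow>
        \<not> (lower_reflecting \<phi> r \<and> upper_reflecting \<psi> r))"

definition balls_in_bins ::
    "'a measure \<Rightarrow> (nat \<Rightarrow> 'a \<Rightarrow> nat \<times> nat) \<Rightarrow> (real \<Rightarrow> real) \<Rightarrow> (real \<Rightarrow> real) \<Rightarrow>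
     real \<Rightarrow> real \<Rightarrow> nat \<times> nat \<Rightarrow> bool" where
  "balls_in_bins M \<zeta> \<phi> \<psi> \<beta>1 \<beta>2 s \<longleftrightarrow>
     s \<in> Q_domain \<phi> \<psi> \<and> well_defined_from \<phi> \<psi> \<beta>1 \<beta>2 s \<and>
     markov_chain_from M \<zeta> (bins_step \<phi> \<psi> \<beta>1 \<beta>2) s"

text \<open>
  The two events, as sets of paths. Limits superior and inferior are taken in the extended reals,
  so that infinite values are not excluded a priori.
\<close>

definition event_A :: "real \<Rightarrow> int \<Rightarrow> (nat \<Rightarrow> nat \<times> nat) set" where
  "event_A \<alpha> k = {z.
     limsup (\<lambda>t. ereal (real (snd (z t)) - real (fst (z t)) powr \<alpha>)) = ereal (real_of_int k) \<and>
     liminf (\<lambda>t. ereal (real (snd (z t)) - real (fst (z t)) powr \<alpha>)) = 0}"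

definition event_A_tilde :: "real \<Rightarrow> int \<Rightarrow> (nat \<Rightarrow> nat \<times> nat) set" where
  "event_A_tilde \<gamma> k = {z.
     limsup (\<lambda>t. ereal (real (fst (z t)) - real (snd (z t)) powr (1 / \<gamma>))) = ereal (real_of_int k) \<and>
     liminf (\<lambda>t. ereal (real (fst (z t)) - real (snd (z t)) powr (1 / \<gamma>))) = 0}"

end

theory Submission
  imports Defs "HOL-Real_Asymp.Real_Asymp"
begin

text \<open>
  With \<open>a = \<alpha>\<close> and \<open>b = 1 / \<gamma>\<close> the domain is \<open>x\<^sup>a \<le> y\<close>, \<open>y\<^sup>b \<le> x\<close>, and exchanging the coordinates
  exchanges \<open>a\<close> and \<open>b\<close> and turns reflection by the upper boundary into reflection by the lower one.
  So only the lower boundary has to be studied; the statement for the upper one is obtained from the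
  swapped chain. The proof consists of three almost sure statements.

  The chain does not stay in the interior for ever (\<open>AE_not_interior_forever\<close>), so it
  is reflected infinitely often by at least one of the two boundaries. In the interior the process
  \<open>N = (\<Sum>j<x. j\<^sup>-\<^sup>\<beta>) - (\<Sum>j<y. j\<^sup>-\<^sup>\<beta>)\<close> is a martingale, and it would have to converge to \<open>0\<close> on a path
  that stays in the interior, since both coordinates then tend to infinity and the series converges
  because \<open>\<beta> > 1\<close>. Comparing \<open>N\<^sup>2\<close> with the variance that \<open>N\<close> can still accumulate bounds the
  probability of this away from \<open>1\<close> as soon as \<open>(x - y)\<^sup>2\<close> is at least of the order \<open>x + y\<close>. On the
  other hand \<open>(x - y)\<^sup>2 - (x + y)\<close> is a submartingale, so that such an imbalance is created with a
  probability that is bounded below. Hence the probability of staying for ever is at most \<open>1 - c\<close>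
  for all states with large coordinate sum, and a bounded harmonic function of this kind vanishes.

  Near the lower boundary, call \<open>level x\<close> the largest \<open>y\<close> at which the chain is reflected in column
  \<open>x\<close>, and \<open>y - level x\<close> the height of \<open>(x, y)\<close>. Reflection lifts the chain to height \<open>1\<close>, and the
  height drops by \<open>1\<close> after a number of steps to the right of order \<open>x\<^sup>1\<^sup>-\<^sup>a\<close>, namely when
  \<open>level x\<close> grows from \<open>w\<close> to \<open>w + 1\<close>. As a step up has probability of order \<open>x\<^sup>-\<^sup>(\<^sup>1\<^sup>-\<^sup>a\<^sup>)\<^sup>\<beta>\<close>, a given number \<open>m\<close> of
  additional steps up at level \<open>w\<close> has probability of order \<open>w\<^sup>-\<^sup>m\<^sup>\<kappa>\<close> with
  \<open>\<kappa> = (\<beta> - 1) (1 - a) / a\<close>. The integer \<open>k\<close> of the theorem is the one with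
  \<open>k - 1 \<le> 1 / \<kappa> < k\<close>. So \<open>\<Sum>w. w\<^sup>-\<^sup>k\<^sup>\<kappa>\<close> converges, and a chain that is reflected infinitely often
  by the lower boundary exceeds height \<open>k\<close> only finitely often (\<open>AE_height_bounded\<close>). The series
  \<open>\<Sum>w. w\<^sup>-\<^sup>(\<^sup>k\<^sup>-\<^sup>1\<^sup>)\<^sup>\<kappa>\<close> diverges, and \<open>y \<ge> x\<^sup>a + k - \<epsilon>\<close> holds infinitely often for every \<open>\<epsilon> > 0\<close>
  (\<open>AE_high_infinitely_often\<close>). Together these give the two limits in \<open>event_A\<close>, the lower limit \<open>0\<close>
  coming from the times of reflection.

  The probabilities in all three steps are estimated by the maximum principle, with explicit super-
  and subsolutions of the one-step mean value operator.
\<close>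

section \<open>The chain and its stopped values\<close>

text \<open>
  For \<open>b = 1 / \<gamma>\<close>, the condition \<open>x\<^sup>\<gamma> - 1 < y\<close> of \<open>upper_reflecting\<close> reads \<open>x < (y + 1)\<^sup>b\<close>. This is the
  condition at the lower boundary with the coordinates exchanged, and \<open>at_upper\<close> is defined by it.
\<close>

definition at_lower :: "real \<Rightarrow> nat \<times> nat \<Rightarrow> bool" where
  "at_lower a = (\<lambda>(x, y). real y < (real x + 1) powr a)"

definition at_upper :: "real \<Rightarrow> nat \<times> nat \<Rightarrow> bool" where
  "at_upper b u = at_lower b (prod.swap u)"

definition up_prob :: "real \<Rightarrow> nat \<Rightarrow> nat \<Rightarrow> real" where
  "up_prob \<beta> x y = real y powr \<beta> / (real x powr \<beta> + real y powr \<beta>)"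

text \<open>
  The expectation of \<open>f\<close> after one transition, as an explicit combination of two values. It is
  defined on all pairs of naturals, so that inequalities for it need no reachability hypotheses.
\<close>

definition mean_step :: "real \<Rightarrow> real \<Rightarrow> real \<Rightarrow> (nat \<times> nat \<Rightarrow> real) \<Rightarrow> nat \<times> nat \<Rightarrow> real" where
  "mean_step a b \<beta> f = (\<lambda>(x, y).
     if at_lower a (x, y) then f (x, y + 1)
     else if at_upper b (x, y) then f (x + 1, y)
     else (1 - up_prob \<beta> x y) * f (x + 1, y) + up_prob \<beta> x y * f (x, y + 1))"

lemma up_prob_nonneg: "0 \<le> up_prob \<beta> x y"
  by (simp add: up_prob_def)

lemma up_prob_le_1: "up_prob \<beta> x y \<le> 1"
proof -
  have "0 \<le> real x powr \<beta>" "0 \<le> real y powr \<beta>" by simp_all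
  then show ?thesis unfolding up_prob_def by (auto simp: divide_le_eq_1 simp del: powr_ge_zero)
qed

lemma mean_step_mono:
  assumes "\<not> at_lower a (x, y) \<Longrightarrow> f (x + 1, y) \<le> g (x + 1, y)"
    and "at_lower a (x, y) \<or> \<not> at_upper b (x, y) \<Longrightarrow> f (x, y + 1) \<le> g (x, y + 1)"
  shows "mean_step a b \<beta> f (x, y) \<le> mean_step a b \<beta> g (x, y)"
  using assms up_prob_nonneg[of \<beta> x y] up_prob_le_1[of \<beta> x y]
  by (auto simp: mean_step_def intro!: add_mono mult_left_mono)

text \<open>
  The probability that the chain started at \<open>u\<close>, observed when it first leaves \<open>S\<close> but at time \<open>N\<close>
  at the latest, is then in \<open>R\<close>. The predicate \<open>stops_in\<close> below is the corresponding event for a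
  path. Hitting probabilities, probabilities of hitting one set before another, and
  probabilities of staying in a set are all of this form.
\<close>

primrec stop_prob :: "real \<Rightarrow> real \<Rightarrow> real \<Rightarrow> (nat \<times> nat) set \<Rightarrow> (nat \<times> nat) set \<Rightarrow> nat \<Rightarrow> nat \<times> nat \<Rightarrow> real"
  where
    "stop_prob a b \<beta> S R 0 u = indicator R u"
  | "stop_prob a b \<beta> S R (Suc N) u =
       (if u \<in> S then mean_step a b \<beta> (stop_prob a b \<beta> S R N) u else indicator R u)"

primrec stops_in :: "'s set \<Rightarrow> 's set \<Rightarrow> nat \<Rightarrow> (nat \<Rightarrow> 's) \<Rightarrow> bool" where
    "stops_in S R 0 z \<longleftrightarrow> z 0 \<in> R"
  | "stops_in S R (Suc N) z \<longleftrightarrow>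
       (if z 0 \<in> S then stops_in S R N (\<lambda>i. z (Suc i)) else z 0 \<in> R)"

lemma stops_in_Suc: "S \<inter> R = {} \<Longrightarrow> stops_in S R N z \<Longrightarrow> stops_in S R (Suc N) z"
proof (induction N arbitrary: z)
  case (Suc N)
  show ?case
  proof (cases "z 0 \<in> S")
    case True
    with Suc.prems have "stops_in S R N (\<lambda>i. z (Suc i))" by simp
    from Suc.IH[OF Suc.prems(1) this] True show ?thesis by (subst stops_in.simps(2)) simp
  qed (use Suc.prems in auto)
qed auto

lemma stops_inI: "\<lbrakk>z m \<notin> S; \<forall>i\<le>m. z i \<in> S \<union> R\<rbrakk> \<Longrightarrow> \<exists>N. stops_in S R N z"
proof (induction m arbitrary: z)
  case 0
  then show ?case by (intro exI[of _ 0]) auto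
next
  case (Suc m)
  show ?case
  proof (cases "z 0 \<in> S")
    case True
    have "\<exists>N. stops_in S R N (\<lambda>i. z (Suc i))"
      using Suc.prems by (intro Suc.IH) auto
    then obtain N where "stops_in S R N (\<lambda>i. z (Suc i))" by blast
    with True show ?thesis by (intro exI[of _ "Suc N"]) auto
  next
    case False
    with Suc.prems(2) have "z 0 \<in> R" by auto
    then show ?thesis by (intro exI[of _ 0]) auto
  qed
qed

lemma stops_in_stay: "\<forall>i. z i \<in> R \<Longrightarrow> stops_in S R N z"
  by (induction N arbitrary: z) auto

text \<open>
  The maximum principle: a supersolution on \<open>S\<close> that dominates the boundary values dominates the
  stopped probability. The set \<open>I\<close> carries the invariants under which the inequalities are available;
  it only has to be closed under those moves that the chain can make from \<open>S\<close>.
\<close>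

lemma stop_prob_le:
  assumes R: "\<And>u. u \<in> I \<Longrightarrow> indicator R u \<le> g u"
    and S: "\<And>x y. (x, y) \<in> I \<Longrightarrow> (x, y) \<in> S \<Longrightarrow>
        (\<not> at_lower a (x, y) \<longrightarrow> (x + 1, y) \<in> I) \<and>
        (at_lower a (x, y) \<or> \<not> at_upper b (x, y) \<longrightarrow> (x, y + 1) \<in> I) \<and>
        mean_step a b \<beta> g (x, y) \<le> g (x, y)"
    and u: "u \<in> I"
  shows "stop_prob a b \<beta> S R N u \<le> g u"
  using u
proof (induction N arbitrary: u)
  case 0
  then show ?case using R by simp
next
  case (Suc N)
  obtain x y where xy: "u = (x, y)" by (cases u)
  show ?case
  proof (cases "u \<in> S")
    case True
    have "mean_step a b \<beta> (stop_prob a b \<beta> S R N) (x, y) \<le> mean_step a b \<beta> g (x, y)"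
      using S[of x y] Suc True xy by (intro mean_step_mono Suc.IH) auto
    also have "\<dots> \<le> g (x, y)" using S[of x y] Suc.prems True xy by auto
    finally show ?thesis using True xy by simp
  next
    case False
    then show ?thesis using R Suc.prems by simp
  qed
qed

text \<open>
  The domain in a form that is symmetric in the coordinates, the upper bound \<open>y \<le> x\<^sup>\<gamma>\<close> becoming
  \<open>y\<^sup>b \<le> x\<close>, without the states of both boundary types, which a well-defined chain does not reach.
\<close>

definition Q_sym :: "real \<Rightarrow> real \<Rightarrow> (nat \<times> nat) set" where
  "Q_sym a b = {(x, y). 1 \<le> x \<and> 1 \<le> y \<and> real x powr a \<le> real y \<and> real y powr b \<le> real x \<and>
                        \<not> (at_lower a (x, y) \<and> at_upper b (x, y))}"

definition follows :: "(nat \<Rightarrow> 'a \<Rightarrow> 's) \<Rightarrow> 's list \<Rightarrow> 'a \<Rightarrow> bool" where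
  "follows X l \<omega> \<longleftrightarrow> (\<forall>i<length l. X i \<omega> = l ! i)"

lemma follows_snoc: "follows X (l @ [v]) \<omega> \<longleftrightarrow> follows X l \<omega> \<and> X (length l) \<omega> = v"
  by (auto simp: follows_def nth_append less_Suc_eq)

text \<open>
  The hypothesis on the transitions describes the probability of a finite path, given as a list of
  states, in terms of that of its beginning. No initial state is fixed: every estimate
  below is made after a given finite path, and exchanging the coordinates preserves all
  hypotheses (\<open>reflected_bins_swap\<close>).
\<close>

locale reflected_bins = prob_space M
  for M :: "'a measure" +
  fixes X :: "nat \<Rightarrow> 'a \<Rightarrow> nat \<times> nat" and a b \<beta> :: real
  assumes a: "0 < a" "a < 1" and b: "0 < b" "b < 1" and \<beta>: "1 < \<beta>"
    and X_measurable [measurable]: "\<And>t. X t \<in> measurable M (count_space UNIV)"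
    and AE_domain: "AE \<omega> in M. \<forall>t. X t \<omega> \<in> Q_sym a b"
    and AE_moves: "AE \<omega> in M. \<forall>t. X (Suc t) \<omega> = (fst (X t \<omega>) + 1, snd (X t \<omega>)) \<or>
                                  X (Suc t) \<omega> = (fst (X t \<omega>), snd (X t \<omega>) + 1)"
    and prob_snoc: "\<And>l v. l \<noteq> [] \<Longrightarrow>
      prob {\<omega> \<in> space M. follows X (l @ [v]) \<omega>} =
      prob {\<omega> \<in> space M. follows X l \<omega>} * mean_step a b \<beta> (indicator {v}) (last l)"
begin

lemma follows_measurable [measurable]: "Measurable.pred M (follows X l)"
  unfolding follows_def by measurable

lemma stops_in_measurable [measurable]: "Measurable.pred M (\<lambda>\<omega>. stops_in S R N (\<lambda>i. X (n + i) \<omega>))"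
proof (induction N arbitrary: n)
  case 0
  then show ?case by simp
next
  case (Suc N)
  have [measurable]: "Measurable.pred M (\<lambda>\<omega>. stops_in S R N (\<lambda>i. X (Suc (n + i)) \<omega>))"
    using Suc[of "Suc n"] by simp
  show ?case by simp
qed

lemma mean_step_split:
  "mean_step a b \<beta> f (x, y) =
     mean_step a b \<beta> (indicator {(x + 1, y)}) (x, y) * f (x + 1, y) +
     mean_step a b \<beta> (indicator {(x, y + 1)}) (x, y) * f (x, y + 1)"
  by (auto simp: mean_step_def)

text \<open>
  The Markov property in the form in which it is used: after any finite path the stopped event has at
  most the probability that the recursion computes from the last state. From there
  only two states are possible, so each step of the induction splits the event into two.
\<close>

lemma prob_stops_in_le:
  assumes "l \<noteq> []"
  shows "prob {\<omega> \<in> space M. follows X l \<omega> \<and> stops_in S R N (\<lambda>i. X (length l - 1 + i) \<omega>)}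
         \<le> prob {\<omega> \<in> space M. follows X l \<omega>} * stop_prob a b \<beta> S R N (last l)"
  using assms
proof (induction N arbitrary: l)
  have last: "X (length l - 1) \<omega> = last l" if "l \<noteq> []" "follows X l \<omega>" for l \<omega>
    using that by (simp add: follows_def last_conv_nth)
  {
    case 0
    then show ?case using last[of l]
      by (cases "last l \<in> R") (auto intro!: finite_measure_mono cong: conj_cong)
  next
    case (Suc N)
    obtain x y where xy: "last l = (x, y)" by (cases "last l")
    let ?E = "\<lambda>l. {\<omega> \<in> space M. follows X l \<omega> \<and> stops_in S R N (\<lambda>i. X (length l - 1 + i) \<omega>)}"
    show ?case
    proof (cases "last l \<in> S")
      case False
      have eq: "{\<omega> \<in> space M. follows X l \<omega> \<and> stops_in S R (Suc N) (\<lambda>i. X (length l - 1 + i) \<omega>)}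
            = {\<omega> \<in> space M. follows X l \<omega> \<and> last l \<in> R}"
        using last[OF Suc.prems] False by auto
      show ?thesis unfolding eq using False by (cases "last l \<in> R") auto
    next
      case True
      have "prob {\<omega> \<in> space M. follows X l \<omega> \<and> stops_in S R (Suc N) (\<lambda>i. X (length l - 1 + i) \<omega>)}
            \<le> prob (?E (l @ [(x + 1, y)]) \<union> ?E (l @ [(x, y + 1)]))"
      proof (rule finite_measure_mono_AE)
        show "AE \<omega> in M. \<omega> \<in> {\<omega> \<in> space M. follows X l \<omega> \<and> stops_in S R (Suc N) (\<lambda>i. X (length l - 1 + i) \<omega>)}
           \<longrightarrow> \<omega> \<in> ?E (l @ [(x + 1, y)]) \<union> ?E (l @ [(x, y + 1)])"
          using AE_moves
        proof eventually_elim
          case (elim \<omega>)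
          have len: "Suc (length l - 1) = length l" using Suc.prems by simp
          have len': "Suc (length l - Suc 0 + i) = length l + i" for i using len by linarith
          show ?case
          proof
            assume A: "\<omega> \<in> {\<omega> \<in> space M. follows X l \<omega> \<and> stops_in S R (Suc N) (\<lambda>i. X (length l - 1 + i) \<omega>)}"
            then have f: "follows X l \<omega>" by simp
            have "X (length l - 1) \<omega> = (x, y)" using last[OF Suc.prems f] xy by simp
            with elim[rule_format, of "length l - 1"]
            have "X (length l) \<omega> = (x + 1, y) \<or> X (length l) \<omega> = (x, y + 1)"
              unfolding len by simp
            moreover have "stops_in S R N (\<lambda>i. X (length l + i) \<omega>)"
              using A True last[OF Suc.prems f] by (simp add: len')
            ultimately show "\<omega> \<in> ?E (l @ [(x + 1, y)]) \<union> ?E (l @ [(x, y + 1)])"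
              using A f by (auto simp: follows_snoc)
          qed
        qed
      qed measurable
      also have "\<dots> \<le> prob (?E (l @ [(x + 1, y)])) + prob (?E (l @ [(x, y + 1)]))"
        by (rule measure_Un_le) measurable
      also have "\<dots> \<le> prob {\<omega> \<in> space M. follows X (l @ [(x + 1, y)]) \<omega>} * stop_prob a b \<beta> S R N (x + 1, y)
           + prob {\<omega> \<in> space M. follows X (l @ [(x, y + 1)]) \<omega>} * stop_prob a b \<beta> S R N (x, y + 1)"
        using Suc.IH[of "l @ [(x + 1, y)]"] Suc.IH[of "l @ [(x, y + 1)]"] by (intro add_mono) simp_all
      also have "\<dots> = prob {\<omega> \<in> space M. follows X l \<omega>} * mean_step a b \<beta> (stop_prob a b \<beta> S R N) (x, y)"
        unfolding prob_snoc[OF Suc.prems] xy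
        by (subst (3) mean_step_split) (simp add: algebra_simps)
      finally show ?thesis using True xy by simp
    qed
  }
qed

lemma prob_ever_stops_in_le:
  assumes "l \<noteq> []" "S \<inter> R = {}" and e: "\<And>N. stop_prob a b \<beta> S R N (last l) \<le> e"
  shows "prob {\<omega> \<in> space M. follows X l \<omega> \<and> (\<exists>N. stops_in S R N (\<lambda>i. X (length l - 1 + i) \<omega>))}
         \<le> prob {\<omega> \<in> space M. follows X l \<omega>} * e"
proof -
  let ?A = "\<lambda>N. {\<omega> \<in> space M. follows X l \<omega> \<and> stops_in S R N (\<lambda>i. X (length l - 1 + i) \<omega>)}"
  have "(\<lambda>N. prob (?A N)) \<longlonglongrightarrow> prob (\<Union>N. ?A N)"
    using stops_in_Suc[OF assms(2)]
    by (intro finite_Lim_measure_incseq incseq_SucI) (auto simp del: stops_in.simps)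
  moreover have "(\<Union>N. ?A N) = {\<omega> \<in> space M. follows X l \<omega> \<and> (\<exists>N. stops_in S R N (\<lambda>i. X (length l - 1 + i) \<omega>))}"
    by auto
  moreover have "prob (?A N) \<le> prob {\<omega> \<in> space M. follows X l \<omega>} * e" for N
    using prob_stops_in_le[OF assms(1), of S R N] mult_left_mono[OF e[of N] measure_nonneg] by (rule order_trans)
  ultimately show ?thesis
    using LIMSEQ_le_const2 by (metis (no_types, lifting))
qed

end

section \<open>A martingale in the interior\<close>

definition interior_set :: "real \<Rightarrow> real \<Rightarrow> (nat \<times> nat) set" where
  "interior_set a b = {u. \<not> at_lower a u \<and> \<not> at_upper b u}"

lemma mean_step_interior:
  "(x, y) \<in> interior_set a b \<Longrightarrow>
    mean_step a b \<beta> f (x, y) = (1 - up_prob \<beta> x y) * f (x + 1, y) + up_prob \<beta> x y * f (x, y + 1)"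
  by (simp add: mean_step_def interior_set_def)

lemma interior_set_iff:
  "(x, y) \<in> interior_set a b \<longleftrightarrow> (real x + 1) powr a \<le> real y \<and> (real y + 1) powr b \<le> real x"
  by (auto simp: interior_set_def at_lower_def at_upper_def)

lemma interior_set_pos:
  assumes "0 < a" "0 < b" "(x, y) \<in> interior_set a b"
  shows "1 \<le> x" "1 \<le> y"
proof -
  have "1 \<le> (real x + 1) powr a" "1 \<le> (real y + 1) powr b"
    using assms(1,2) by (auto intro: ge_one_powr_ge_zero)
  then have "1 \<le> real x" "1 \<le> real y" using assms(3) unfolding interior_set_iff by linarith+
  then show "1 \<le> x" "1 \<le> y" by simp_all
qed

definition psum :: "real \<Rightarrow> nat \<Rightarrow> real" where
  "psum \<beta> n = (\<Sum>j<n. real j powr (- \<beta>))"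

definition imbalance :: "real \<Rightarrow> nat \<times> nat \<Rightarrow> real" where
  "imbalance \<beta> u = psum \<beta> (fst u) - psum \<beta> (snd u)"

text \<open>
  An explicit quantity that decreases by at least \<open>x\<^sup>-\<^sup>\<beta> y\<^sup>-\<^sup>\<beta>\<close>, the conditional variance of a step of
  \<open>imbalance\<close>, at every step (\<open>var_bound_right\<close>, \<open>var_bound_up\<close>). It therefore bounds the variance
  that \<open>imbalance\<close> accumulates along any path from \<open>u\<close>.
\<close>

definition var_bound :: "real \<Rightarrow> nat \<times> nat \<Rightarrow> real" where
  "var_bound \<beta> = (\<lambda>(x, y). 2 powr \<beta> / (\<beta> - 1) *
     (real x powr (1 - \<beta>) * real y powr (- \<beta>) + real x powr (- \<beta>) * real y powr (1 - \<beta>)))"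

lemma var_bound_nonneg: "1 < \<beta> \<Longrightarrow> 0 \<le> var_bound \<beta> u"
  by (auto simp: var_bound_def split: prod.split intro!: mult_nonneg_nonneg add_nonneg_nonneg)

lemma powr_neg_le_diff:
  fixes n :: nat and \<beta> :: real
  assumes "1 \<le> n" "1 < \<beta>"
  shows "real n powr (- \<beta>) \<le> 2 powr \<beta> / (\<beta> - 1) * (real n powr (1 - \<beta>) - (real n + 1) powr (1 - \<beta>))"
proof -
  have "\<exists>z. real n < z \<and> z < real n + 1 \<and>
    (real n + 1) powr (1 - \<beta>) - real n powr (1 - \<beta>) = (real n + 1 - real n) * ((1 - \<beta>) * z powr (- \<beta>))"
  proof (rule MVT2)
    fix z assume "real n \<le> z" "z \<le> real n + 1"
    then have "0 < z" using assms by linarith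
    then show "((\<lambda>z. z powr (1 - \<beta>)) has_real_derivative (1 - \<beta>) * z powr (- \<beta>)) (at z)"
      by (auto intro!: derivative_eq_intros)
  qed simp
  then obtain z where z: "real n < z" "z < real n + 1"
    and eq: "(real n + 1) powr (1 - \<beta>) - real n powr (1 - \<beta>) = (1 - \<beta>) * z powr (- \<beta>)" by auto
  have "(2 * real n) powr (- \<beta>) \<le> z powr (- \<beta>)"
    using z assms by (intro powr_mono2') auto
  then have "2 powr (- \<beta>) * real n powr (- \<beta>) \<le> z powr (- \<beta>)" by (simp add: powr_mult)
  then have "(\<beta> - 1) * (2 powr (- \<beta>) * real n powr (- \<beta>)) \<le> (\<beta> - 1) * z powr (- \<beta>)"
    using assms by (intro mult_left_mono) auto
  also have "\<dots> = real n powr (1 - \<beta>) - (real n + 1) powr (1 - \<beta>)" using eq by (simp add: algebra_simps)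
  finally have "2 powr \<beta> / (\<beta> - 1) * ((\<beta> - 1) * (2 powr (- \<beta>) * real n powr (- \<beta>)))
      \<le> 2 powr \<beta> / (\<beta> - 1) * (real n powr (1 - \<beta>) - (real n + 1) powr (1 - \<beta>))"
    using assms by (intro mult_left_mono) auto
  moreover have "2 powr \<beta> / (\<beta> - 1) * ((\<beta> - 1) * (2 powr (- \<beta>) * real n powr (- \<beta>))) = real n powr (- \<beta>)"
    using assms by (simp add: powr_minus field_simps)
  ultimately show ?thesis by simp
qed

lemma up_prob_alt:
  assumes "1 \<le> x" "1 \<le> y"
  shows "up_prob \<beta> x y = real x powr (- \<beta>) / (real x powr (- \<beta>) + real y powr (- \<beta>))"
proof -
  have "0 < real x powr \<beta>" "0 < real y powr \<beta>" using assms by auto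
  then show ?thesis by (simp add: up_prob_def powr_minus field_simps)
qed

lemma var_bound_right:
  assumes "1 \<le> x" "1 \<le> y" "1 < \<beta>"
  shows "var_bound \<beta> (x + 1, y) \<le> var_bound \<beta> (x, y) - real x powr (- \<beta>) * real y powr (- \<beta>)"
proof -
  let ?K = "2 powr \<beta> / (\<beta> - 1)"
  have "real x powr (- \<beta>) * real y powr (- \<beta>)
      \<le> ?K * (real x powr (1 - \<beta>) - (real x + 1) powr (1 - \<beta>)) * real y powr (- \<beta>)"
    using powr_neg_le_diff[of x \<beta>] assms by (intro mult_right_mono) auto
  moreover have "?K * ((real x + 1) powr (- \<beta>) * real y powr (1 - \<beta>)) \<le> ?K * (real x powr (- \<beta>) * real y powr (1 - \<beta>))"
    using assms by (intro mult_left_mono mult_right_mono powr_mono2') auto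
  ultimately show ?thesis by (simp add: var_bound_def algebra_simps)
qed

lemma var_bound_swap: "var_bound \<beta> (y, x) = var_bound \<beta> (x, y)"
  by (simp add: var_bound_def algebra_simps)

lemma var_bound_up:
  assumes "1 \<le> x" "1 \<le> y" "1 < \<beta>"
  shows "var_bound \<beta> (x, y + 1) \<le> var_bound \<beta> (x, y) - real x powr (- \<beta>) * real y powr (- \<beta>)"
  using var_bound_right[of y x \<beta>] assms var_bound_swap[of \<beta> y x] var_bound_swap[of \<beta> "y + 1" x]
  by (simp add: mult.commute)

lemma imbalance_right: "imbalance \<beta> (x + 1, y) = imbalance \<beta> (x, y) + real x powr (- \<beta>)"
  and imbalance_up: "imbalance \<beta> (x, y + 1) = imbalance \<beta> (x, y) - real y powr (- \<beta>)"
  by (simp_all add: imbalance_def psum_def)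

text \<open>
  A step to the right has probability \<open>Y / (X + Y)\<close> and changes \<open>imbalance\<close> by \<open>X\<close>; a step up has
  probability \<open>X / (X + Y)\<close> and changes it by \<open>-Y\<close>, where \<open>X = x\<^sup>-\<^sup>\<beta>\<close> and \<open>Y = y\<^sup>-\<^sup>\<beta>\<close>. So \<open>imbalance\<close> is a
  martingale with conditional variance \<open>X Y\<close>, and its square plus \<open>var_bound\<close> is a supermartingale.
  The combination \<open>W\<close> is made for a second moment argument: \<open>2 l n - l\<^sup>2 n\<^sup>2 \<le> 1\<close> for all real
  \<open>n\<close>, with value \<open>0\<close> at \<open>n = 0\<close>.
\<close>

lemma quadratic_submartingale:
  assumes ab: "0 < a" "0 < b" and int: "(x, y) \<in> interior_set a b" and \<beta>: "1 < \<beta>"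
  defines "W \<equiv> \<lambda>l u. 2 * l * imbalance \<beta> u - l^2 * ((imbalance \<beta> u)^2 + var_bound \<beta> u)"
  shows "W l (x, y) \<le> mean_step a b \<beta> (W l) (x, y)"
proof -
  have pos: "1 \<le> x" "1 \<le> y" using interior_set_pos[OF ab int] by auto
  define X Y where "X = real x powr (- \<beta>)" and "Y = real y powr (- \<beta>)"
  have XY: "0 < X" "0 < Y" using pos by (auto simp: X_def Y_def)
  define p where "p = X / (X + Y)"
  have p: "up_prob \<beta> x y = p" using up_prob_alt[OF pos] by (simp add: p_def X_def Y_def)
  have p01: "0 \<le> p" "p \<le> 1" using XY by (auto simp: p_def)
  have q: "1 - p = Y / (X + Y)" using XY by (simp add: p_def field_simps)
  define n v where "n = imbalance \<beta> (x, y)" and "v = var_bound \<beta> (x, y)"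
  have 1: "2 * l * (n + X) - l^2 * ((n + X)^2 + (v - X * Y)) \<le> W l (x + 1, y)"
    using var_bound_right[OF pos \<beta>] unfolding W_def imbalance_right n_def v_def X_def Y_def
    by (intro diff_mono order_refl mult_left_mono add_mono) auto
  have 2: "2 * l * (n - Y) - l^2 * ((n - Y)^2 + (v - X * Y)) \<le> W l (x, y + 1)"
    using var_bound_up[OF pos \<beta>] unfolding W_def imbalance_up n_def v_def X_def Y_def
    by (intro diff_mono order_refl mult_left_mono add_mono) auto
  have key: "(1 - p) * X = p * Y" by (subst q) (simp add: p_def)
  have "(1 - p) * (2 * l * (n + X) - l^2 * ((n + X)^2 + (v - X * Y))) +
        p * (2 * l * (n - Y) - l^2 * ((n - Y)^2 + (v - X * Y)))
      = 2 * l * n - l^2 * (n^2 + v) + (2 * l - l^2 * (2 * n)) * ((1 - p) * X - p * Y)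
        - l^2 * ((1 - p) * X * X + p * Y * Y - X * Y)"
    by (simp add: algebra_simps power2_eq_square)
  also have "(1 - p) * X * X + p * Y * Y - X * Y = p * Y * X + (1 - p) * X * Y - X * Y"
    using key by simp
  also have "\<dots> = 0" by (simp add: algebra_simps)
  also have "(1 - p) * X - p * Y = 0" using key by simp
  finally have "W l (x, y) = (1 - p) * (2 * l * (n + X) - l^2 * ((n + X)^2 + (v - X * Y))) +
        p * (2 * l * (n - Y) - l^2 * ((n - Y)^2 + (v - X * Y)))"
    by (simp add: W_def n_def v_def)
  also have "\<dots> \<le> (1 - p) * W l (x + 1, y) + p * W l (x, y + 1)"
    using p01 1 2 by (intro add_mono mult_left_mono) auto
  also have "\<dots> = mean_step a b \<beta> (W l) (x, y)"
    by (simp add: mean_step_interior[OF int] p)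
  finally show ?thesis .
qed

abbreviation "stay a b \<beta> \<equiv> stop_prob a b \<beta> (interior_set a b) (interior_set a b)"

lemma stay_nonneg: "0 \<le> stay a b \<beta> N u"
proof (induction N arbitrary: u)
  case (Suc N)
  obtain x y where [simp]: "u = (x, y)" by (cases u)
  show ?case using Suc up_prob_nonneg[of \<beta> x y] up_prob_le_1[of \<beta> x y]
    by (auto simp: mean_step_interior simp del: One_nat_def intro!: add_nonneg_nonneg mult_nonneg_nonneg)
qed auto

lemma stay_le_1: "stay a b \<beta> N u \<le> 1"
proof (induction N arbitrary: u)
  case (Suc N)
  obtain x y where [simp]: "u = (x, y)" by (cases u)
  show ?case using Suc up_prob_nonneg[of \<beta> x y] up_prob_le_1[of \<beta> x y]
    by (auto simp: mean_step_interior simp del: One_nat_def intro!: convex_bound_le)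
qed (auto simp: indicator_def)

lemma stay_outside: "u \<notin> interior_set a b \<Longrightarrow> stay a b \<beta> N u = 0"
  by (cases N) auto

lemma stay_Suc_le: "stay a b \<beta> (Suc N) u \<le> stay a b \<beta> N u"
proof (induction N arbitrary: u)
  case 0
  show ?case using stay_le_1[of a b \<beta> "Suc 0" u] stay_outside[of u a b \<beta> "Suc 0"]
    by (auto simp: indicator_def)
next
  case (Suc N)
  obtain x y where [simp]: "u = (x, y)" by (cases u)
  show ?case using Suc.IH[of "(x+1,y)"] Suc.IH[of "(x,y+1)"]
    by (cases "u \<in> interior_set a b") (auto simp del: stop_prob.simps simp: stop_prob.simps(2)[of _ _ _ _ _ N]
        stop_prob.simps(2)[of _ _ _ _ _ "Suc N"] intro!: mean_step_mono)
qed

text \<open>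
  The probabilities of staying for \<open>N\<close> steps decrease in \<open>N\<close>, so the infimum is their limit, the
  probability of staying in the interior for ever.
\<close>

definition stay_forever :: "real \<Rightarrow> real \<Rightarrow> real \<Rightarrow> nat \<times> nat \<Rightarrow> real" where
  "stay_forever a b \<beta> u = (INF N. stay a b \<beta> N u)"

lemma stay_tendsto: "(\<lambda>N. stay a b \<beta> N u) \<longlonglongrightarrow> stay_forever a b \<beta> u"
  unfolding stay_forever_def
  by (intro LIMSEQ_decseq_INF decseq_SucI stay_Suc_le bdd_belowI2[where m = 0] stay_nonneg)

lemma stay_forever_bounds: "0 \<le> stay_forever a b \<beta> u" "stay_forever a b \<beta> u \<le> 1"
  and stay_forever_le: "stay_forever a b \<beta> u \<le> stay a b \<beta> N u"
proof -
  show "0 \<le> stay_forever a b \<beta> u"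
    by (rule LIMSEQ_le_const[OF stay_tendsto]) (auto intro: stay_nonneg)
  show "stay_forever a b \<beta> u \<le> 1"
    by (rule LIMSEQ_le_const2[OF stay_tendsto]) (auto intro: stay_le_1)
  show "stay_forever a b \<beta> u \<le> stay a b \<beta> N u"
    by (rule decseq_ge[OF _ stay_tendsto]) (intro decseq_SucI stay_Suc_le)
qed

lemma stay_forever_outside: "u \<notin> interior_set a b \<Longrightarrow> stay_forever a b \<beta> u = 0"
  using stay_forever_le[of a b \<beta> u 0] stay_forever_bounds(1)[of a b \<beta> u] by simp

lemma stay_forever_harmonic:
  assumes "u \<in> interior_set a b"
  shows "stay_forever a b \<beta> u = mean_step a b \<beta> (stay_forever a b \<beta>) u"
proof -
  obtain x y where [simp]: "u = (x, y)" by (cases u)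
  have "(\<lambda>N. stay a b \<beta> (Suc N) u) \<longlonglongrightarrow> mean_step a b \<beta> (stay_forever a b \<beta>) u"
    using assms by (auto simp: mean_step_interior simp del: One_nat_def intro!: tendsto_intros stay_tendsto)
  moreover have "(\<lambda>N. stay a b \<beta> (Suc N) u) \<longlonglongrightarrow> stay_forever a b \<beta> u"
    by (rule LIMSEQ_Suc[OF stay_tendsto])
  ultimately show ?thesis using LIMSEQ_unique by blast
qed

text \<open>
  In the interior each coordinate is bounded below by a power of the other one, so both are large if
  their sum is.
\<close>

lemma interior_set_large:
  assumes "0 < a" "0 < b"
  shows "\<exists>n0. \<forall>x y. (x, y) \<in> interior_set a b \<longrightarrow> n0 \<le> x + y \<longrightarrow> m \<le> x \<and> m \<le> y"
proof -
  obtain n0 :: nat where n0: "real n0 \<ge> real m + real m powr (1 / a) + real m powr (1 / b)"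
    using real_arch_simple by blast
  show ?thesis
  proof (intro exI allI impI)
    fix x y assume int: "(x, y) \<in> interior_set a b" and n: "n0 \<le> x + y"
    have n': "real n0 \<le> real x + real y" using n by linarith
    have "m \<le> x"
    proof (rule ccontr)
      assume "\<not> m \<le> x"
      then have x: "real x < real m" by simp
      have "((real y + 1) powr b) powr (1 / b) \<le> real m powr (1 / b)"
        using int x assms unfolding interior_set_iff by (intro powr_mono2) auto
      then have "real y + 1 \<le> real m powr (1 / b)" using assms by (simp add: powr_powr)
      moreover have "0 \<le> real m powr (1 / a)" by simp
      ultimately show False using n0 n' x by linarith
    qed
    moreover have "m \<le> y"
    proof (rule ccontr)
      assume "\<not> m \<le> y"
      then have x: "real y < real m" by simp
      have "((real x + 1) powr a) powr (1 / a) \<le> real m powr (1 / a)"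
        using int x assms unfolding interior_set_iff by (intro powr_mono2) auto
      then have "real x + 1 \<le> real m powr (1 / a)" using assms by (simp add: powr_powr)
      moreover have "0 \<le> real m powr (1 / b)" by simp
      ultimately show False using n0 n' x by linarith
    qed
    ultimately show "m \<le> x \<and> m \<le> y" by simp
  qed
qed

lemma imbalance_small:
  assumes "0 < a" "0 < b" "1 < \<beta>" "0 < e"
  shows "\<exists>n0. \<forall>u \<in> interior_set a b. n0 \<le> fst u + snd u \<longrightarrow> \<bar>imbalance \<beta> u\<bar> < e"
proof -
  have "summable (\<lambda>j. real j powr (- \<beta>))"
    using assms(3) summable_real_powr_iff[of "- \<beta>"] by auto
  then have "Cauchy (psum \<beta>)"
    unfolding psum_def by (intro convergent_Cauchy) (simp add: summable_iff_convergent)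
  then obtain m where m: "\<And>i j. m \<le> i \<Longrightarrow> m \<le> j \<Longrightarrow> norm (psum \<beta> i - psum \<beta> j) < e"
    using CauchyD[OF _ assms(4)] by blast
  obtain n0 where "\<forall>x y. (x, y) \<in> interior_set a b \<longrightarrow> n0 \<le> x + y \<longrightarrow> m \<le> x \<and> m \<le> y"
    using interior_set_large[OF assms(1,2)] by blast
  then show ?thesis using m by (intro exI[of _ n0]) (auto simp: imbalance_def)
qed

text \<open>
  The submartingale \<open>W\<close> is at most \<open>1\<close> when the chain has left the interior, and at most \<open>e\<close> if it is
  still there when the sum of the coordinates has reached \<open>m\<close>, because \<open>imbalance\<close> is small by then.
  So the probability of having left is at least \<open>W u - e\<close>.
\<close>

lemma stay_le_quadratic:
  assumes ab: "0 < a" "0 < b" and \<beta>: "1 < \<beta>"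
    and small: "\<And>v. v \<in> interior_set a b \<Longrightarrow> m \<le> fst v + snd v \<Longrightarrow> 2 * l * imbalance \<beta> v \<le> e"
    and e: "0 \<le> e"
  shows "m \<le> fst u + snd u + N \<Longrightarrow>
    stay a b \<beta> N u \<le> 1 + e - (2 * l * imbalance \<beta> u - l^2 * ((imbalance \<beta> u)^2 + var_bound \<beta> u))"
proof (induction N arbitrary: u)
  define W where "W = (\<lambda>u. 2 * l * imbalance \<beta> u - l^2 * ((imbalance \<beta> u)^2 + var_bound \<beta> u))"
  have W1: "W u \<le> 1" for u
  proof -
    have "2 * l * imbalance \<beta> u - l^2 * (imbalance \<beta> u)^2 = 1 - (1 - l * imbalance \<beta> u)^2"
      by (simp add: power2_eq_square algebra_simps)
    moreover have "0 \<le> l^2 * var_bound \<beta> u" using var_bound_nonneg[OF \<beta>] by simp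
    ultimately show ?thesis using zero_le_power2[of "1 - l * imbalance \<beta> u"]
      unfolding W_def distrib_left by linarith
  qed
  {
    case 0
    show ?case
    proof (cases "u \<in> interior_set a b")
      case True
      have "0 \<le> l^2 * ((imbalance \<beta> u)^2 + var_bound \<beta> u)" using var_bound_nonneg[OF \<beta>] by simp
      with small[OF True] 0 True show ?thesis by simp
    next
      case False
      then show ?thesis using W1[of u] e by (simp add: W_def)
    qed
  next
    case (Suc N)
    obtain x y where u: "u = (x, y)" by (cases u)
    show ?case
    proof (cases "u \<in> interior_set a b")
      case True
      have "stay a b \<beta> (Suc N) u = mean_step a b \<beta> (stay a b \<beta> N) (x, y)" using True u by simp
      also have "\<dots> \<le> mean_step a b \<beta> (\<lambda>u. 1 + e - W u) (x, y)"
        using Suc u unfolding W_def by (intro mean_step_mono Suc.IH) auto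
      also have "\<dots> = 1 + e - mean_step a b \<beta> W (x, y)"
        using True u by (simp add: mean_step_interior algebra_simps)
      also have "\<dots> \<le> 1 + e - W (x, y)"
        using quadratic_submartingale[OF ab _ \<beta>, of x y l] True u unfolding W_def by simp
      finally show ?thesis using u by (simp add: W_def)
    next
      case False
      then show ?thesis using W1[of u] e by (simp add: W_def)
    qed
  }
qed

text \<open>
  The choice \<open>l = N / (N\<^sup>2 + V)\<close> maximises \<open>2 l N - l\<^sup>2 (N\<^sup>2 + V)\<close>, with the maximum \<open>N\<^sup>2 / (N\<^sup>2 + V)\<close>.
  This is the Paley-Zygmund bound for the probability that the limit of \<open>imbalance\<close> is not \<open>0\<close>.
\<close>

lemma stay_forever_le_second_moment:
  assumes ab: "0 < a" "0 < b" and \<beta>: "1 < \<beta>" and c: "0 < c"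
    and large: "c * ((imbalance \<beta> u)^2 + var_bound \<beta> u) \<le> (imbalance \<beta> u)^2" and nz: "imbalance \<beta> u \<noteq> 0"
  shows "stay_forever a b \<beta> u \<le> 1 - c"
proof (rule field_le_epsilon)
  fix e :: real assume e: "0 < e"
  define n where "n = imbalance \<beta> u"
  define s where "s = n^2 + var_bound \<beta> u"
  define l where "l = n / s"
  have s: "0 < s" using nz var_bound_nonneg[OF \<beta>, of u] by (simp add: s_def n_def add_pos_nonneg)
  have l: "0 < \<bar>l\<bar>" using s nz by (simp add: l_def n_def)
  obtain n0 where n0: "\<And>v. v \<in> interior_set a b \<Longrightarrow> n0 \<le> fst v + snd v \<Longrightarrow> \<bar>imbalance \<beta> v\<bar> < e / (2 * \<bar>l\<bar>)"
    using imbalance_small[OF ab \<beta>, of "e / (2 * \<bar>l\<bar>)"] e l by auto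
  have small: "2 * l * imbalance \<beta> v \<le> e" if "v \<in> interior_set a b" "n0 \<le> fst v + snd v" for v
  proof -
    have "2 * l * imbalance \<beta> v \<le> 2 * \<bar>l\<bar> * \<bar>imbalance \<beta> v\<bar>"
      by (metis abs_ge_self abs_mult abs_numeral)
    also have "\<dots> \<le> e" using n0[OF that] l by (simp add: field_simps)
    finally show ?thesis .
  qed
  have "stay_forever a b \<beta> u \<le> stay a b \<beta> n0 u" by (rule stay_forever_le)
  also have "\<dots> \<le> 1 + e - (2 * l * n - l^2 * s)"
    using stay_le_quadratic[OF ab \<beta> small less_imp_le[OF e], where u = u and N = n0] by (simp add: n_def s_def)
  also have "2 * l * n - l^2 * s = n^2 / s" using s by (simp add: l_def power2_eq_square field_simps)
  also have "1 + e - n^2 / s \<le> 1 - c + e"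
    using large s by (simp add: n_def[symmetric] s_def[symmetric] pos_le_divide_eq)
  finally show "stay_forever a b \<beta> u \<le> 1 - c + e" .
qed

section \<open>No path stays in the interior for ever\<close>

text \<open>
  If \<open>x\<close> is larger than \<open>2 y\<close>, only the terms with index up to \<open>2 y\<close> are kept, because they are all
  comparable to \<open>y\<^sup>-\<^sup>\<beta>\<close>.
\<close>

lemma psum_diff_ge:
  assumes "y \<le> x" "1 \<le> y" "1 < \<beta>"
  shows "real (min (x - y) y) * (2 * real y) powr (- \<beta>) \<le> psum \<beta> x - psum \<beta> y"
proof -
  let ?q = "min (x - y) y"
  have "real ?q * (2 * real y) powr (- \<beta>) = (\<Sum>j\<in>{y..<y + ?q}. (2 * real y) powr (- \<beta>))" by simp
  also have "\<dots> \<le> (\<Sum>j\<in>{y..<y + ?q}. real j powr (- \<beta>))"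
    using assms by (intro sum_mono powr_mono2') auto
  also have "\<dots> \<le> (\<Sum>j\<in>{y..<x}. real j powr (- \<beta>))"
    using assms by (intro sum_mono2) auto
  also have "\<dots> = psum \<beta> x - psum \<beta> y"
    using sum_diff_nat_ivl[of 0 y x "\<lambda>j. real j powr (- \<beta>)"] assms(1)
    by (simp add: psum_def atLeast0LessThan)
  finally show ?thesis .
qed

lemma imbalance_ge_of_le:
  assumes "y \<le> x" "1 \<le> y" "1 < \<beta>" "0 < k" "k \<le> 1" and d: "k * real y \<le> (real x - real y)^2"
  shows "k * 2 powr (- 2 * \<beta>) * real y powr (1 - 2 * \<beta>) \<le> (psum \<beta> x - psum \<beta> y)^2"
proof -
  define q where "q = real (min (x - y) y)"
  have q: "k * real y \<le> q^2"
  proof (cases "x - y \<le> y")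
    case True
    then show ?thesis using d assms(1) by (simp add: q_def of_nat_diff)
  next
    case False
    have "k * real y \<le> 1 * real y" using assms by (intro mult_right_mono) auto
    also have "\<dots> \<le> (real y)^2" using assms by (simp add: power2_eq_square)
    finally show ?thesis using False by (simp add: q_def min_def)
  qed
  have "k * 2 powr (- 2 * \<beta>) * real y powr (1 - 2 * \<beta>) = (k * real y) * (2 powr (- 2 * \<beta>) * real y powr (- 2 * \<beta>))"
    using assms(2) powr_add[of "real y" 1 "- 2 * \<beta>"] by simp
  also have "\<dots> \<le> q^2 * (2 powr (- 2 * \<beta>) * real y powr (- 2 * \<beta>))"
    using q by (intro mult_right_mono) auto
  also have "2 powr (- 2 * \<beta>) * real y powr (- 2 * \<beta>) = ((2 * real y) powr (- \<beta>))^2"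
    by (simp add: powr_mult power2_eq_square flip: powr_add) (simp add: algebra_simps flip: powr_add)
  also have "q^2 * ((2 * real y) powr (- \<beta>))^2 = (q * (2 * real y) powr (- \<beta>))^2"
    by (simp add: power_mult_distrib)
  also have "\<dots> \<le> (psum \<beta> x - psum \<beta> y)^2"
    using psum_diff_ge[OF assms(1-3)] by (intro power_mono) (auto simp: q_def)
  finally show ?thesis .
qed

lemma var_bound_le:
  assumes "y \<le> x" "1 \<le> y" "1 < \<beta>"
  shows "var_bound \<beta> (x, y) \<le> 2 * (2 powr \<beta> / (\<beta> - 1)) * real y powr (1 - 2 * \<beta>)"
proof -
  have "real x powr (1 - \<beta>) * real y powr (- \<beta>) \<le> real y powr (1 - \<beta>) * real y powr (- \<beta>)"
    using assms by (intro mult_right_mono powr_mono2') auto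
  moreover have "real x powr (- \<beta>) * real y powr (1 - \<beta>) \<le> real y powr (- \<beta>) * real y powr (1 - \<beta>)"
    using assms by (intro mult_right_mono powr_mono2') auto
  ultimately have "real x powr (1 - \<beta>) * real y powr (- \<beta>) + real x powr (- \<beta>) * real y powr (1 - \<beta>)
      \<le> 2 * real y powr (1 - 2 * \<beta>)"
    by (simp flip: powr_add)
  then have "2 powr \<beta> / (\<beta> - 1) * (real x powr (1 - \<beta>) * real y powr (- \<beta>) + real x powr (- \<beta>) * real y powr (1 - \<beta>))
      \<le> 2 powr \<beta> / (\<beta> - 1) * (2 * real y powr (1 - 2 * \<beta>))"
    using assms(3) by (intro mult_left_mono) auto
  then show ?thesis unfolding var_bound_def by (simp only: prod.case mult.assoc mult.left_commute)
qed

text \<open>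
  For \<open>m = min x y\<close>, both the square of \<open>imbalance\<close> (from below) and \<open>var_bound\<close> (from above) are of
  order \<open>m\<close> to the power \<open>1 - 2 \<beta>\<close> once \<open>(x - y)\<^sup>2\<close> is at least of order \<open>m\<close>.
\<close>

lemma unbalanced_second_moment:
  assumes "1 < \<beta>" "0 < k" "k \<le> 1"
  shows "\<exists>c>0. \<forall>x y. 1 \<le> x \<longrightarrow> 1 \<le> y \<longrightarrow> k * real (min x y) \<le> (real x - real y)^2 \<longrightarrow>
    imbalance \<beta> (x, y) \<noteq> 0 \<and>
    c * ((imbalance \<beta> (x, y))^2 + var_bound \<beta> (x, y)) \<le> (imbalance \<beta> (x, y))^2"
proof -
  define A where "A = k * 2 powr (- 2 * \<beta>)"
  define B where "B = 2 * (2 powr \<beta> / (\<beta> - 1))"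
  have A: "0 < A" and B: "0 < B" using assms by (auto simp: A_def B_def)
  define c where "c = A / (A + B)"
  have c: "0 < c" using A B by (simp add: c_def)
  have le: "imbalance \<beta> (x, y) \<noteq> 0 \<and>
    c * ((imbalance \<beta> (x, y))^2 + var_bound \<beta> (x, y)) \<le> (imbalance \<beta> (x, y))^2"
    if "1 \<le> y" "y \<le> x" "k * real y \<le> (real x - real y)^2" for x y
  proof -
    define n where "n = (imbalance \<beta> (x, y))^2"
    define r where "r = real y powr (1 - 2 * \<beta>)"
    have r: "0 < r" using that(1) by (auto simp: r_def)
    have n: "A * r \<le> n" using imbalance_ge_of_le[OF that(2,1) assms that(3)]
      by (simp add: A_def r_def n_def imbalance_def)
    have v: "var_bound \<beta> (x, y) \<le> B * r" using var_bound_le[OF that(2,1) assms(1)]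
      by (simp add: B_def r_def)
    have "A * var_bound \<beta> (x, y) \<le> A * (B * r)" using v A by (intro mult_left_mono) auto
    also have "\<dots> = B * (A * r)" by simp
    also have "\<dots> \<le> B * n" using n B by (intro mult_left_mono) auto
    finally have "c * (n + var_bound \<beta> (x, y)) \<le> n" using A B by (simp add: c_def field_simps)
    moreover have "0 < n" using n mult_pos_pos[OF A r] by linarith
    ultimately show ?thesis by (auto simp: n_def)
  qed
  show ?thesis
  proof (rule exI[of _ c], rule conjI[OF c], intro allI impI)
    fix x y :: nat
    assume xy: "1 \<le> x" "1 \<le> y" "k * real (min x y) \<le> (real x - real y)^2"
    have sw: "imbalance \<beta> (x, y) = - imbalance \<beta> (y, x)" by (simp add: imbalance_def)
    show "imbalance \<beta> (x, y) \<noteq> 0 \<and>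
      c * ((imbalance \<beta> (x, y))^2 + var_bound \<beta> (x, y)) \<le> (imbalance \<beta> (x, y))^2"
    proof (cases "y \<le> x")
      case True
      then show ?thesis using le[of y x] xy by (simp add: min.absorb2[OF True])
    next
      case False
      then show ?thesis using le[of x y] xy unfolding sw var_bound_swap[of \<beta> x y]
        by (simp add: min_def power2_commute)
    qed
  qed
qed

text \<open>
  The larger coordinate is the more likely one to grow, which gives the nonnegative term in addition to
  the \<open>1\<close> that a fair coin would give.
\<close>

lemma mean_diff_square:
  assumes "(x, y) \<in> interior_set a b" "1 \<le> x" "1 \<le> y" "1 < \<beta>"
  shows "(real x - real y)^2 + 1 \<le> mean_step a b \<beta> (\<lambda>u. (real (fst u) - real (snd u))^2) (x, y)"
proof -
  define p where "p = up_prob \<beta> x y"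
  have pos: "0 < real x powr \<beta>" "0 < real y powr \<beta>" using assms by auto
  have eq: "1 - 2 * p = (real x powr \<beta> - real y powr \<beta>) / (real x powr \<beta> + real y powr \<beta>)"
    using add_pos_pos[OF pos] by (simp add: p_def up_prob_def divide_simps)
  have "0 \<le> (real x - real y) * (1 - 2 * p)"
  proof (cases "y \<le> x")
    case True
    then have "real y powr \<beta> \<le> real x powr \<beta>" using assms by (intro powr_mono2) auto
    then show ?thesis using True pos unfolding eq by (intro mult_nonneg_nonneg divide_nonneg_pos add_pos_pos) auto
  next
    case False
    then have "real x powr \<beta> \<le> real y powr \<beta>" using assms by (intro powr_mono2) auto
    then show ?thesis using False pos unfolding eq by (intro mult_nonpos_nonpos divide_nonpos_pos add_pos_pos) auto
  qed
  moreover have "mean_step a b \<beta> (\<lambda>u. (real (fst u) - real (snd u))^2) (x, y) =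
      (real x - real y)^2 + 1 + 2 * ((real x - real y) * (1 - 2 * p))"
    using assms(1) by (simp add: mean_step_interior p_def[symmetric] power2_eq_square algebra_simps)
  ultimately show ?thesis by simp
qed

text \<open>
  In states with \<open>(x - y)\<^sup>2 \<ge> (x + y) / 16\<close> the second moment bound applies directly. From a start with
  \<open>(x - y)\<^sup>2 < n / 8\<close>, where \<open>n \<ge> 8\<close> is the coordinate sum at the start, wait until the chain leaves the
  interior, or \<open>(x - y)\<^sup>2 \<ge> n / 8\<close>, or the sum has doubled. In the second case the first bound applies,
  since the sum is at most \<open>2 n\<close>. The third case has probability at most one half, as
  \<open>(x + y) - (x - y)\<^sup>2\<close> is a supermartingale. This is expressed by the function \<open>\<phi>\<close>: it is a
  supermartingale, is nonnegative throughout, is at least \<open>1\<close> if the sum has doubled without the other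
  events, and starts at a value of at most \<open>1/2\<close>.
\<close>

lemma stay_forever_le_uniform:
  assumes ab: "0 < a" "0 < b" and \<beta>: "1 < \<beta>"
  shows "\<exists>c>0. \<forall>u. 8 \<le> fst u + snd u \<longrightarrow> stay_forever a b \<beta> u \<le> 1 - c"
proof -
  obtain c where c: "0 < c" and unbal: "\<And>x y. \<lbrakk>1 \<le> x; 1 \<le> y; 1/16 * real (min x y) \<le> (real x - real y)^2\<rbrakk> \<Longrightarrow>
    imbalance \<beta> (x, y) \<noteq> 0 \<and>
    c * ((imbalance \<beta> (x, y))^2 + var_bound \<beta> (x, y)) \<le> (imbalance \<beta> (x, y))^2"
    using unbalanced_second_moment[OF \<beta>, of "1/16"] by auto
  have far: "stay_forever a b \<beta> (x, y) \<le> 1 - c"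
    if "(x, y) \<in> interior_set a b" "1/16 * (real x + real y) \<le> (real x - real y)^2" for x y
  proof -
    have "1/16 * real (min x y) \<le> 1/16 * (real x + real y)" by (intro mult_left_mono) simp_all
    also note that(2)
    finally have "1/16 * real (min x y) \<le> (real x - real y)^2" .
    with unbal[OF interior_set_pos[OF ab that(1)]] show ?thesis
      using stay_forever_le_second_moment[OF ab \<beta> c] by blast
  qed
  (* The state (2, 1) serves only to read off c \<le> 1 from the inequality at a nonzero imbalance. *)
  have c1: "c \<le> 1"
  proof -
    have "c * (imbalance \<beta> (2, 1))^2 \<le> c * ((imbalance \<beta> (2, 1))^2 + var_bound \<beta> (2, 1))"
      using c var_bound_nonneg[OF \<beta>, of "(2,1)"] by (intro mult_left_mono) auto
    also have "\<dots> \<le> 1 * (imbalance \<beta> (2, 1))^2" using unbal[of 2 1] by simp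
    finally show ?thesis using unbal[of 2 1] by simp
  qed
  have near: "stay_forever a b \<beta> (x0, y0) \<le> 1 - c / 2" if n0: "8 \<le> x0 + y0" for x0 y0
  proof (cases "(x0, y0) \<in> interior_set a b \<and> (real x0 - real y0)^2 < 1/8 * real (x0 + y0)")
    case False
    show ?thesis
    proof (cases "(x0, y0) \<in> interior_set a b")
      case True
      with False have "1/16 * (real x0 + real y0) \<le> (real x0 - real y0)^2" by simp
      from far[OF True this] c show ?thesis by simp
    qed (use c c1 stay_forever_outside in simp)
  next
    case True
    define n where "n = real (x0 + y0)"
    have n8: "8 \<le> n" using n0 by (simp add: n_def)
    (* The largest value of (x - y)^2 when the waiting ends: the step before, (x - y)^2 was below n / 8,
       and (d + 1)^2 + (d - 1)^2 = 2 d^2 + 2. *)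
    define C where "C = n / 4 + 2"
    define \<phi> where "\<phi> = (\<lambda>u. (real (fst u) + real (snd u) - n + C - (real (fst u) - real (snd u))^2) / n)"
    have main: "stay_forever a b \<beta> u \<le> (1 - c) + c * \<phi> u"
      if "real (fst u + snd u + i) = 2 * n" "n \<le> real (fst u + snd u)"
        "(real (fst u) - real (snd u))^2 \<le> C" for u i
      using that
    proof (induction i arbitrary: u)
      {
        fix u :: "nat \<times> nat"
        assume n: "n \<le> real (fst u + snd u)" "(real (fst u) - real (snd u))^2 \<le> C"
          "real (fst u + snd u) \<le> 2 * n"
        have \<phi>0: "0 \<le> \<phi> u" using n n8 by (simp add: \<phi>_def)
        have "stay_forever a b \<beta> u \<le> (1 - c) + c * \<phi> u"
          if "u \<notin> interior_set a b \<or> n / 8 \<le> (real (fst u) - real (snd u))^2"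
        proof (cases "u \<in> interior_set a b")
          case True
          obtain x y where u: "u = (x, y)" by (cases u)
          have "1/16 * (real x + real y) \<le> (real x - real y)^2" using that True n(3) u by simp
          with far[of x y] True u have "stay_forever a b \<beta> u \<le> 1 - c" by simp
          moreover have "0 \<le> c * \<phi> u" using c \<phi>0 by simp
          ultimately show ?thesis by linarith
        next
          case False
          then show ?thesis using stay_forever_outside[OF False] \<phi>0 c c1 by simp
        qed
      } note exited = this
      {
        case 0
        show ?case
        proof (cases "u \<notin> interior_set a b \<or> n / 8 \<le> (real (fst u) - real (snd u))^2")
          case True
          then show ?thesis using exited[of u] 0 by simp
        next
          case False
          then have "1 \<le> \<phi> u" using 0 n8 by (simp add: \<phi>_def C_def field_simps)
          then have "c * 1 \<le> c * \<phi> u" using c by (intro mult_left_mono) auto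
          then show ?thesis using stay_forever_bounds(2)[of a b \<beta> u] by simp
        qed
      next
        case (Suc i)
        show ?case
        proof (cases "u \<notin> interior_set a b \<or> n / 8 \<le> (real (fst u) - real (snd u))^2")
          case True
          then show ?thesis using exited[of u] Suc.prems by simp
        next
          case False
          obtain x y where u: "u = (x, y)" by (cases u)
          have int: "(x, y) \<in> interior_set a b" using False u by simp
          define d where "d = real x - real y"
          have d: "d^2 < n / 8" using False u by (simp add: d_def)
          have "0 \<le> (d - 1)^2" "0 \<le> (d + 1)^2" by simp_all
          then have d1: "(d + 1)^2 \<le> C" "(d - 1)^2 \<le> C" using d unfolding C_def
            by (simp_all add: power2_eq_square algebra_simps)
          have "stay_forever a b \<beta> u = mean_step a b \<beta> (stay_forever a b \<beta>) (x, y)"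
            using stay_forever_harmonic[OF int] u by simp
          also have "\<dots> \<le> mean_step a b \<beta> (\<lambda>u. (1 - c) + c * \<phi> u) (x, y)"
          proof (rule mean_step_mono)
            show "stay_forever a b \<beta> (x + 1, y) \<le> (1 - c) + c * \<phi> (x + 1, y)"
              using Suc.prems u d1(1) by (intro Suc.IH) (simp_all add: d_def algebra_simps)
            show "stay_forever a b \<beta> (x, y + 1) \<le> (1 - c) + c * \<phi> (x, y + 1)"
              using Suc.prems u d1(2) by (intro Suc.IH) (simp_all add: d_def algebra_simps)
          qed
          also have "\<dots> = (1 - c) + c * mean_step a b \<beta> \<phi> (x, y)"
            using int by (simp add: mean_step_interior algebra_simps)
          also have "mean_step a b \<beta> \<phi> (x, y) =
             (real x + real y + 1 - n + C - mean_step a b \<beta> (\<lambda>u. (real (fst u) - real (snd u))^2) (x, y)) / n"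
            using int n8 by (simp add: mean_step_interior \<phi>_def field_simps)
          also have "\<dots> \<le> \<phi> (x, y)"
            using mean_diff_square[OF int interior_set_pos[OF ab int] \<beta>] n8
            unfolding \<phi>_def by (intro divide_right_mono) auto
          finally show ?thesis using c u by simp
        qed
      }
    qed
    have "(real x0 - real y0)^2 < n / 8" using True by (simp add: n_def)
    with n8 have "(real x0 - real y0)^2 \<le> C" unfolding C_def by linarith
    then have "stay_forever a b \<beta> (x0, y0) \<le> (1 - c) + c * \<phi> (x0, y0)"
      by (intro main[of "(x0, y0)" "x0 + y0"]) (auto simp: n_def)
    also have "\<phi> (x0, y0) \<le> C / n" using n8 unfolding \<phi>_def by (intro divide_right_mono) (auto simp: n_def)
    also have "C / n \<le> 1 / 2" using n8 by (simp add: C_def field_simps)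
    finally show ?thesis using c by simp
  qed
  show ?thesis by (intro exI[of _ "c / 2"]) (use c near in auto)
qed

lemma stay_forever_le_iterate:
  assumes \<sigma>: "\<And>u. m \<le> fst u + snd u \<Longrightarrow> stay_forever a b \<beta> u \<le> \<sigma>"
  shows "m \<le> fst u + snd u \<Longrightarrow> stay_forever a b \<beta> u \<le> \<sigma> * stay a b \<beta> N u"
proof (induction N arbitrary: u)
  case 0
  then show ?case using \<sigma>[of u] stay_forever_outside[of u a b \<beta>] by (cases "u \<in> interior_set a b") auto
next
  case (Suc N)
  obtain x y where u: "u = (x, y)" by (cases u)
  show ?case
  proof (cases "u \<in> interior_set a b")
    case True
    have "stay_forever a b \<beta> u = mean_step a b \<beta> (stay_forever a b \<beta>) (x, y)"
      using stay_forever_harmonic[OF True] u by simp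
    also have "\<dots> \<le> mean_step a b \<beta> (\<lambda>u. \<sigma> * stay a b \<beta> N u) (x, y)"
      using Suc u by (intro mean_step_mono Suc.IH) auto
    also have "\<dots> = \<sigma> * stay a b \<beta> (Suc N) u"
      using True u by (simp add: mean_step_interior algebra_simps)
    finally show ?thesis .
  qed (use stay_forever_outside in simp)
qed

text \<open>
  Let \<open>\<sigma>\<close> be the supremum. Staying for ever means staying for \<open>N\<close> steps and then for ever, so the
  probability is at most \<open>\<sigma>\<close> times that of staying for \<open>N\<close> steps. With \<open>N \<rightarrow> \<infinity>\<close> this gives
  \<open>\<sigma> \<le> \<sigma> (1 - c)\<close>.
\<close>

lemma stay_forever_eq_0:
  assumes ab: "0 < a" "0 < b" and \<beta>: "1 < \<beta>" and u: "8 \<le> fst u + snd u"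
  shows "stay_forever a b \<beta> u = 0"
proof -
  obtain c where c: "0 < c" and le: "\<And>u. 8 \<le> fst u + snd u \<Longrightarrow> stay_forever a b \<beta> u \<le> 1 - c"
    using stay_forever_le_uniform[OF ab \<beta>] by auto
  define \<sigma> where "\<sigma> = (SUP u\<in>{u. 8 \<le> fst u + snd u}. stay_forever a b \<beta> u)"
  have bdd: "bdd_above (stay_forever a b \<beta> ` {u. 8 \<le> fst u + snd u})"
    by (rule bdd_aboveI2[where M = 1]) (rule stay_forever_bounds)
  have up: "stay_forever a b \<beta> v \<le> \<sigma>" if "8 \<le> fst v + snd v" for v
    unfolding \<sigma>_def using that by (intro cSUP_upper bdd) auto
  have \<sigma>0: "0 \<le> \<sigma>" using up[OF u] stay_forever_bounds(1)[of a b \<beta> u] by linarith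
  have "\<sigma> \<le> \<sigma> * (1 - c)" unfolding \<sigma>_def
  proof (rule cSUP_least)
    fix v :: "nat \<times> nat" assume v: "v \<in> {u. 8 \<le> fst u + snd u}"
    have "stay_forever a b \<beta> v \<le> \<sigma> * stay_forever a b \<beta> v"
    proof (rule LIMSEQ_le_const)
      show "(\<lambda>N. \<sigma> * stay a b \<beta> N v) \<longlonglongrightarrow> \<sigma> * stay_forever a b \<beta> v"
        by (intro tendsto_intros stay_tendsto)
      show "\<exists>N. \<forall>n\<ge>N. stay_forever a b \<beta> v \<le> \<sigma> * stay a b \<beta> n v"
        using stay_forever_le_iterate[OF up] v by auto
    qed
    also have "\<dots> \<le> \<sigma> * (1 - c)" using le[of v] v \<sigma>0 by (intro mult_left_mono) auto
    finally show "stay_forever a b \<beta> v \<le> (SUP u\<in>{u. 8 \<le> fst u + snd u}. stay_forever a b \<beta> u) * (1 - c)"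
      unfolding \<sigma>_def .
  qed (use u in auto)
  then have "\<sigma> * c \<le> 0" by (simp add: algebra_simps)
  with c have "\<sigma> \<le> 0" by (simp add: mult_le_0_iff)
  with up[OF u] stay_forever_bounds(1)[of a b \<beta> u] show ?thesis by linarith
qed

section \<open>The lower boundary: excursions are not too high\<close>

lemma powr_increment:
  fixes t a :: real
  assumes "1 \<le> t" "0 < a" "a < 1"
  shows "(t + 1) powr a - t powr a \<le> t powr (a - 1)"
    and "a * (t + 1) powr (a - 1) \<le> (t + 1) powr a - t powr a"
    and "(t + 1) powr a - t powr a \<le> 1"
proof -
  have "\<exists>z. t < z \<and> z < t + 1 \<and> (t + 1) powr a - t powr a = (t + 1 - t) * (a * z powr (a - 1))"
    by (rule MVT2) (use assms in \<open>auto intro!: derivative_eq_intros\<close>)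
  then obtain z where z: "t < z" "z < t + 1" and eq: "(t + 1) powr a - t powr a = a * z powr (a - 1)" by auto
  have "a * z powr (a - 1) \<le> 1 * t powr (a - 1)" using assms z by (intro mult_mono powr_mono2') auto
  then show 1: "(t + 1) powr a - t powr a \<le> t powr (a - 1)" using eq by simp
  show "a * (t + 1) powr (a - 1) \<le> (t + 1) powr a - t powr a"
    unfolding eq using assms z by (intro mult_left_mono powr_mono2') auto
  have "t powr (a - 1) \<le> 1 powr (a - 1)" using assms by (intro powr_mono2') auto
  with 1 show "(t + 1) powr a - t powr a \<le> 1" by simp
qed

text \<open>
  The largest \<open>y\<close> with \<open>y < (x + 1)\<^sup>a\<close>, that is, the row in which column \<open>x\<close> is reflected. The number
  \<open>y - level a x\<close> is the height of the state \<open>(x, y)\<close>: in the domain it is \<open>0\<close> exactly at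
  the reflecting states, a step up increases it by \<open>1\<close>, and a step to the right keeps it or decreases it by \<open>1\<close> (\<open>level_Suc\<close>). Using
  this integer rather than \<open>y - x\<^sup>a\<close> makes the counting of steps exact.
\<close>

definition level :: "real \<Rightarrow> nat \<Rightarrow> nat" where
  "level a x = nat (\<lceil>(real x + 1) powr a\<rceil> - 1)"

lemma level_bounds:
  assumes "0 < a"
  shows "real (level a x) < (real x + 1) powr a" "(real x + 1) powr a \<le> real (level a x) + 1"
proof -
  have "1 \<le> (real x + 1) powr a" using assms by (intro ge_one_powr_ge_zero) auto
  then have "1 \<le> \<lceil>(real x + 1) powr a\<rceil>" by linarith
  then have "real (level a x) = of_int \<lceil>(real x + 1) powr a\<rceil> - 1" by (simp add: level_def)
  then show "real (level a x) < (real x + 1) powr a" "(real x + 1) powr a \<le> real (level a x) + 1"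
    by linarith+
qed

lemma at_lower_iff_level: "0 < a \<Longrightarrow> at_lower a (x, y) \<longleftrightarrow> y \<le> level a x"
  using level_bounds[of a x] by (auto simp: at_lower_def)

lemma level_Suc:
  assumes "0 < a" "a < 1"
  shows "level a (x + 1) = level a x \<or> level a (x + 1) = level a x + 1"
proof -
  have "(real x + 1) powr a \<le> (real x + 2) powr a" using assms by (intro powr_mono2) auto
  moreover have "(real x + 2) powr a \<le> (real x + 1) powr a + 1"
    using powr_increment(3)[of "real x + 1" a] assms by (simp add: add.assoc)
  ultimately have "real (level a x) < real (level a (x + 1)) + 1" "real (level a (x + 1)) < real (level a x) + 2"
    using level_bounds[OF assms(1), of x] level_bounds[OF assms(1), of "x + 1"] by (simp_all add: add.commute)
  then show ?thesis by linarith
qed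

lemma level_pos: "0 < a \<Longrightarrow> 1 \<le> x \<Longrightarrow> 1 \<le> level a x"
proof -
  assume a: "0 < a" and x: "1 \<le> x"
  have "1 powr a < (real x + 1) powr a" using a x by (intro powr_less_mono2) auto
  with level_bounds(2)[OF a, of x] show ?thesis by simp
qed

lemma level_filterlim:
  assumes "0 < a"
  shows "filterlim (level a) at_top at_top"
proof -
  have "filterlim (\<lambda>x. (real x + 1) powr a - 1) at_top at_top" using assms by real_asymp
  then have "filterlim (\<lambda>x. real (level a x)) at_top at_top"
    by (rule filterlim_at_top_mono) (use level_bounds(2)[OF assms] in \<open>auto simp: algebra_simps intro!: always_eventually\<close>)
  then show ?thesis by (simp add: filterlim_sequentially_iff_filterlim_real)
qed

lemma eventually_not_at_upper:
  assumes "0 < a" "a < 1" "0 < b" "b < 1"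
  shows "eventually (\<lambda>x. \<forall>y \<le> level a x + k. \<not> at_upper b (x, y)) sequentially"
proof -
  have "eventually (\<lambda>x::nat. (real x + 1) powr a + real k + 1 \<le> real x) sequentially"
    using assms by real_asymp
  then show ?thesis
  proof eventually_elim
    case (elim x)
    show ?case
    proof (intro allI impI)
      fix y assume "y \<le> level a x + k"
      then have "real y + 1 \<le> (real x + 1) powr a + real k + 1"
        using level_bounds(1)[OF assms(1), of x] by linarith
      moreover have "(real y + 1) powr b \<le> (real y + 1) powr 1" using assms by (intro powr_mono) auto
      ultimately show "\<not> at_upper b (x, y)" using elim by (simp add: at_upper_def at_lower_def)
    qed
  qed
qed

text \<open>
  The probability of an additional step up during the passage through level \<open>w\<close> is of order
  \<open>w\<^sup>-\<^sup>\<kappa>\<close>.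
\<close>

definition \<kappa> :: "real \<Rightarrow> real \<Rightarrow> real" where
  "\<kappa> a \<beta> = (\<beta> - 1) * (1 - a) / a"

definition jump_const :: "real \<Rightarrow> real \<Rightarrow> nat \<Rightarrow> real" where
  "jump_const a \<beta> k = 4 * (2 * (real k + 1)) powr \<beta> / (a * 2 powr (a - 1))"

text \<open>
  In terms of the column \<open>x\<close>: up to a constant, the probability of a step up divided by
  the amount \<open>(x + 2)\<^sup>a - (x + 1)\<^sup>a\<close> by which a step to the right lowers the position relative to the
  boundary (\<open>up_prob_upper_bound\<close>).
\<close>

definition jump_odds :: "real \<Rightarrow> real \<Rightarrow> nat \<Rightarrow> nat \<Rightarrow> real" where
  "jump_odds a \<beta> k x = jump_const a \<beta> k * (real x + 1) powr (- (\<kappa> a \<beta> * a))"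

lemma jump_const_pos: "0 < a \<Longrightarrow> 0 < jump_const a \<beta> k"
  by (simp add: jump_const_def)

lemma up_prob_upper_bound:
  assumes a: "0 < a" "a < 1" and \<beta>: "1 < \<beta>" and x: "1 \<le> x" and y: "1 \<le> y" "y \<le> level a x + k"
  shows "4 * up_prob \<beta> x y \<le> jump_odds a \<beta> k x * ((real x + 2) powr a - (real x + 1) powr a)"
proof -
  define v where "v = real x + 1"
  have v: "2 \<le> v" using x by (simp add: v_def)
  have va: "1 \<le> v powr a" using v a by (intro ge_one_powr_ge_zero) auto
  have "real y \<le> v powr a + real k" using y(2) level_bounds(1)[OF a(1), of x] by (simp add: v_def)
  also have "\<dots> \<le> (real k + 1) * v powr a"
    using va mult_left_mono[OF va, of "real k"] by (simp add: algebra_simps)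
  finally have y': "real y \<le> (real k + 1) * v powr a" .
  have "up_prob \<beta> x y \<le> real y powr \<beta> / real x powr \<beta>"
    unfolding up_prob_def using x by (intro divide_left_mono mult_pos_pos add_pos_nonneg) auto
  also have "\<dots> \<le> ((real k + 1) * v powr a) powr \<beta> / (v / 2) powr \<beta>"
    using y' x \<beta> v by (intro frac_le powr_mono2) (auto simp: v_def)
  also have "\<dots> = (2 * (real k + 1)) powr \<beta> * v powr (a * \<beta> - \<beta>)"
    using v by (simp add: powr_mult powr_divide powr_powr powr_diff del: distrib_left_numeral)
  finally have "4 * up_prob \<beta> x y \<le> 4 * (2 * (real k + 1)) powr \<beta> * v powr (a * \<beta> - \<beta>)" by simp
  also have "\<dots> = jump_const a \<beta> k * (a * 2 powr (a - 1)) * v powr (a * \<beta> - \<beta>)"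
    using a by (simp add: jump_const_def)
  also have "a * \<beta> - \<beta> = - (\<kappa> a \<beta> * a) + (a - 1)"
    using a by (simp add: \<kappa>_def field_simps)
  also have "jump_const a \<beta> k * (a * 2 powr (a - 1)) * v powr (- (\<kappa> a \<beta> * a) + (a - 1))
       = jump_odds a \<beta> k x * (a * (2 * v) powr (a - 1))"
    unfolding jump_odds_def v_def[symmetric] powr_add by (simp add: powr_mult)
  also have "\<dots> \<le> jump_odds a \<beta> k x * (a * (v + 1) powr (a - 1))"
    using jump_const_pos[OF a(1), of \<beta> k] a v unfolding jump_odds_def
    by (intro mult_left_mono powr_mono2') auto
  also have "\<dots> \<le> jump_odds a \<beta> k x * ((v + 1) powr a - v powr a)"
    using jump_const_pos[OF a(1), of \<beta> k] powr_increment(2)[of v a] a v unfolding jump_odds_def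
    by (intro mult_left_mono) auto
  finally show ?thesis by (simp add: v_def add.assoc)
qed

lemma jump_odds_antimono:
  assumes "0 < a" "a < 1" "1 < \<beta>"
  shows "jump_odds a \<beta> k (x + 1) \<le> jump_odds a \<beta> k x"
  unfolding jump_odds_def using assms jump_const_pos[OF assms(1), of \<beta> k]
  by (intro mult_left_mono powr_mono2') (auto simp: \<kappa>_def)

lemma jump_odds_pos: "0 < a \<Longrightarrow> 0 < jump_odds a \<beta> k x"
  using jump_const_pos[of a \<beta> k] by (simp add: jump_odds_def)

lemma jump_odds_le_level:
  assumes "0 < a" "a < 1" "1 < \<beta>" "1 \<le> x"
  shows "jump_odds a \<beta> k x \<le> jump_const a \<beta> k * real (level a x) powr (- \<kappa> a \<beta>)"
proof -
  have "((real x + 1) powr a) powr (- \<kappa> a \<beta>) \<le> real (level a x) powr (- \<kappa> a \<beta>)"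
    using assms level_bounds(1)[OF assms(1), of x] level_pos[OF assms(1,4)]
    by (intro powr_mono2') (auto simp: \<kappa>_def)
  then show ?thesis using jump_const_pos[OF assms(1), of \<beta> k]
    by (simp add: jump_odds_def powr_powr mult.commute)
qed

text \<open>
  A bound for the probability that any of the excursions starting at level \<open>w\<close> or later has \<open>k\<close>
  additional steps up; the summand is twice the \<open>k\<close>-th power of the bound for \<open>jump_odds\<close> at its level.
\<close>

definition future :: "real \<Rightarrow> real \<Rightarrow> nat \<Rightarrow> nat \<Rightarrow> real" where
  "future a \<beta> k w = (\<Sum>i. 2 * (jump_const a \<beta> k * real (i + w) powr (- \<kappa> a \<beta>)) ^ k)"

lemma future_props:
  assumes "0 < a" "a < 1" "1 < \<beta>" and k: "1 < \<kappa> a \<beta> * real k"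
  shows "0 \<le> future a \<beta> k w"
    and "future a \<beta> k w = 2 * (jump_const a \<beta> k * real w powr (- \<kappa> a \<beta>)) ^ k + future a \<beta> k (w + 1)"
    and "future a \<beta> k \<longlonglongrightarrow> 0"
proof -
  let ?h = "\<lambda>i. 2 * (jump_const a \<beta> k * real i powr (- \<kappa> a \<beta>)) ^ k"
  have k1: "k \<noteq> 0" using k by (intro notI) simp
  have "?h i = 2 * jump_const a \<beta> k ^ k * real i powr (- (\<kappa> a \<beta> * real k))" for i
    using k1 by (cases "i = 0") (simp_all add: power_mult_distrib powr_power mult.commute)
  then have "?h = (\<lambda>i. 2 * jump_const a \<beta> k ^ k * real i powr (- (\<kappa> a \<beta> * real k)))" by blast
  moreover have "summable (\<lambda>i. real i powr (- (\<kappa> a \<beta> * real k)))"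
    using k by (subst summable_real_powr_iff) simp
  ultimately have sm: "summable ?h" by (simp add: summable_mult)
  have nn: "0 \<le> ?h i" for i using jump_const_pos[OF assms(1), of \<beta> k] by simp
  show "0 \<le> future a \<beta> k w" unfolding future_def
    by (rule suminf_nonneg[OF summable_ignore_initial_segment[OF sm, of w] nn])
  have "(\<Sum>i. ?h (i + w)) = (\<Sum>i. ?h (Suc i + w)) + ?h (0 + w)"
    using suminf_split_head[OF summable_ignore_initial_segment[OF sm, of w]] by linarith
  then show "future a \<beta> k w = ?h w + future a \<beta> k (w + 1)" unfolding future_def by simp
  have "future a \<beta> k = (\<lambda>w. suminf ?h - (\<Sum>i<w. ?h i))"
    unfolding future_def using suminf_minus_initial_segment[OF sm] by auto
  moreover have "(\<lambda>w. suminf ?h - (\<Sum>i<w. ?h i)) \<longlonglongrightarrow> suminf ?h - suminf ?h"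
    by (intro tendsto_intros summable_LIMSEQ sm)
  ultimately show "future a \<beta> k \<longlonglongrightarrow> 0" by simp
qed

text \<open>
  A bound for the probability of ever exceeding height \<open>k\<close>. From height \<open>j\<close> with \<open>1 \<le> j \<le> k\<close>, the current
  excursion needs \<open>k + 1 - j\<close> further steps up, each of which costs a factor \<open>jump_odds\<close>. The factor
  \<open>1 + z\<close> with \<open>z = level a x + 1 - (x + 1)\<^sup>a\<close>, between \<open>1\<close> and \<open>2\<close>, measures the distance to the next
  drop of the height; its decrease during steps to the right pays for the possible steps up. The truncated
  subtraction makes the exponent \<open>0\<close> for heights above \<open>k\<close>, where the bound is therefore at least \<open>1\<close>.
\<close>

definition reach_bound :: "real \<Rightarrow> real \<Rightarrow> nat \<Rightarrow> nat \<times> nat \<Rightarrow> real" where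
  "reach_bound a \<beta> k = (\<lambda>(x, y). if y \<le> level a x then future a \<beta> k (level a x)
     else jump_odds a \<beta> k x ^ (k + 1 - (y - level a x)) * (1 + (real (level a x) + 1 - (real x + 1) powr a))
          + future a \<beta> k (level a x + 1))"

text \<open>
  At a reflecting state the bound loses the summand of \<open>future\<close> that covers the new
  excursion. Otherwise, if the step to the right keeps the level, it decreases \<open>z\<close> by \<open>\<delta>\<close>,
  which outweighs the step up since \<open>4 p \<le> \<rho> \<delta>\<close>. If it increases the level, it gains a whole factor
  \<open>\<rho> \<le> 1/4\<close>.
\<close>

lemma reach_bound_supersolution:
  assumes a: "0 < a" "a < 1" and \<beta>: "1 < \<beta>" and k: "1 < \<kappa> a \<beta> * real k"
    and x: "1 \<le> x" "jump_odds a \<beta> k x \<le> 1 / 4"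
    and y: "level a x \<le> y" "y \<le> level a x + k" and up: "\<not> at_upper b (x, y)"
  shows "mean_step a b \<beta> (reach_bound a \<beta> k) (x, y) \<le> reach_bound a \<beta> k (x, y)"
proof -
  define L where "L = level a x"
  define \<rho> where "\<rho> = jump_odds a \<beta> k x"
  define z where "z = real L + 1 - (real x + 1) powr a"
  define F where "F = future a \<beta> k (L + 1)"
  have z: "0 \<le> z" "z \<le> 1" using level_bounds[OF a(1), of x] by (auto simp: z_def L_def)
  have \<rho>: "0 < \<rho>" "\<rho> \<le> 1 / 4" using x(2) jump_odds_pos[OF a(1)] by (auto simp: \<rho>_def)
  note fut = future_props[OF a \<beta> k]
  show ?thesis
  proof (cases "y \<le> L")
    case True
    then have yL: "y = L" using y by (simp add: L_def)
    have "mean_step a b \<beta> (reach_bound a \<beta> k) (x, y) = reach_bound a \<beta> k (x, y + 1)"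
      using True by (simp add: mean_step_def at_lower_iff_level[OF a(1)] L_def)
    also have "\<dots> = \<rho> ^ k * (1 + z) + F"
      by (simp add: reach_bound_def yL L_def[symmetric] \<rho>_def z_def F_def)
    also have "\<dots> \<le> \<rho> ^ k * 2 + F" using z \<rho> by (intro add_mono mult_left_mono) auto
    also have "\<rho> ^ k \<le> (jump_const a \<beta> k * real L powr (- \<kappa> a \<beta>)) ^ k"
      using jump_odds_le_level[OF a \<beta> x(1)] \<rho> by (intro power_mono) (auto simp: \<rho>_def L_def)
    finally show ?thesis using True fut(2)[of L] by (simp add: reach_bound_def L_def[symmetric] F_def)
  next
    case False
    define n where "n = k - (y - L)"
    have n: "k + 1 - (y - L) = Suc n" "k + 1 - (y + 1 - L) = n"
      using y False by (auto simp: n_def L_def)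
    define p where "p = up_prob \<beta> x y"
    define \<delta> where "\<delta> = (real x + 2) powr a - (real x + 1) powr a"
    have p0: "0 \<le> p" "p \<le> 1" using up_prob_nonneg up_prob_le_1 by (auto simp: p_def)
    have p\<delta>: "4 * p \<le> \<rho> * \<delta>"
      using up_prob_upper_bound[OF a \<beta> x(1) _ y(2)] False by (simp add: p_def \<rho>_def \<delta>_def)
    have \<delta>: "0 \<le> \<delta>" "\<delta> \<le> 1"
      using powr_increment(3)[of "real x + 1" a] a by (auto simp: \<delta>_def add.assoc intro!: powr_mono2)
    have "\<rho> * \<delta> \<le> \<rho> * 1" using \<delta> \<rho> by (intro mult_left_mono) auto
    with p\<delta> have p\<rho>: "4 * p \<le> \<rho>" by simp
    have p2: "p \<le> 1 / 2" using p\<rho> \<rho> by simp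
    have g: "reach_bound a \<beta> k (x, y) = \<rho> ^ n * (\<rho> * (1 + z)) + F"
      using False n(1) by (simp add: reach_bound_def L_def[symmetric] \<rho>_def z_def F_def)
    have g_up: "reach_bound a \<beta> k (x, y + 1) = \<rho> ^ n * (1 + z) + F"
      using False n(2) by (simp add: reach_bound_def L_def[symmetric] \<rho>_def z_def F_def)
    have "(1 - p) * reach_bound a \<beta> k (x + 1, y) + p * reach_bound a \<beta> k (x, y + 1) \<le> \<rho> ^ n * (\<rho> * (1 + z)) + F"
    proof -
      define L' where "L' = level a (x + 1)"
      define \<rho>' where "\<rho>' = jump_odds a \<beta> k (x + 1)"
      define z' where "z' = real L' + 1 - (real x + 2) powr a"
      have \<rho>': "0 < \<rho>'" "\<rho>' \<le> \<rho>"
        using jump_odds_pos[OF a(1)] jump_odds_antimono[OF a \<beta>] by (auto simp: \<rho>'_def \<rho>_def)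
      have z': "0 \<le> z'" "z' \<le> 1" using level_bounds[OF a(1), of "x + 1"] by (auto simp: z'_def L'_def add.commute)
      have g_right: "reach_bound a \<beta> k (x + 1, y) = (if y \<le> L' then future a \<beta> k L'
          else \<rho>' ^ (k + 1 - (y - L')) * (1 + z') + future a \<beta> k (L' + 1))"
        by (simp add: reach_bound_def L'_def \<rho>'_def z'_def add.commute)
      have "\<exists>B. reach_bound a \<beta> k (x + 1, y) \<le> \<rho> ^ n * B + F \<and> 0 \<le> B \<and> (1 - p) * B + p * (1 + z) \<le> \<rho> * (1 + z)"
        using level_Suc[OF a, of x]
      proof
        assume "level a (x + 1) = level a x"
        then have L': "L' = L" by (simp add: L'_def L_def)
        have zz: "z' = z - \<delta>" by (simp add: z'_def z_def \<delta>_def L')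
        have "reach_bound a \<beta> k (x + 1, y) = \<rho>' ^ Suc n * (1 + z') + F"
          unfolding g_right using False n(1) L' by (simp add: F_def)
        also have "\<dots> \<le> \<rho> ^ Suc n * (1 + z') + F"
          using \<rho>' z' by (intro add_mono mult_right_mono power_mono) auto
        finally have "reach_bound a \<beta> k (x + 1, y) \<le> \<rho> ^ n * (\<rho> * (1 + z - \<delta>)) + F" by (simp add: zz algebra_simps)
        moreover have "0 \<le> \<rho> * (1 + z - \<delta>)" using \<rho> z \<delta> by simp
        moreover have "(1 - p) * (\<rho> * (1 + z - \<delta>)) + p * (1 + z) \<le> \<rho> * (1 + z)"
        proof -
          have "p * (1 + z) \<le> p * 2" using p0 z by (intro mult_left_mono) auto
          moreover have "p * (\<rho> * \<delta>) \<le> 1 / 2 * (\<rho> * \<delta>)" using p2 \<rho> \<delta> by (intro mult_right_mono) auto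
          moreover have "0 \<le> p * (\<rho> * (1 + z))" using p0 \<rho> z by simp
          moreover have "(1 - p) * (\<rho> * (1 + z - \<delta>)) = \<rho> * (1 + z) - \<rho> * \<delta> - p * (\<rho> * (1 + z)) + p * (\<rho> * \<delta>)"
            by (simp add: algebra_simps)
          ultimately show ?thesis using p\<delta> by linarith
        qed
        ultimately show ?thesis by blast
      next
        assume "level a (x + 1) = level a x + 1"
        then have L': "L' = L + 1" by (simp add: L'_def L_def)
        have "reach_bound a \<beta> k (x + 1, y) \<le> 2 * \<rho> ^ Suc (Suc n) + F"
        proof (cases "y \<le> L'")
          case True
          then show ?thesis unfolding g_right using \<rho> by (simp add: L' F_def)
        next
          case False
          have n': "k + 1 - (y - L') = Suc (Suc n)"
            using y False n(1) by (auto simp: L' L_def)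
          have "future a \<beta> k (L' + 1) \<le> F" using fut(2)[of L'] jump_const_pos[OF a(1), of \<beta> k] by (simp add: F_def L')
          moreover have "\<rho>' ^ Suc (Suc n) * (1 + z') \<le> \<rho> ^ Suc (Suc n) * 2"
            using \<rho> \<rho>' z' by (intro mult_mono power_mono) auto
          moreover have "reach_bound a \<beta> k (x + 1, y) = \<rho>' ^ Suc (Suc n) * (1 + z') + future a \<beta> k (L' + 1)"
            unfolding g_right using False n' by simp
          ultimately show ?thesis by simp
        qed
        then have "reach_bound a \<beta> k (x + 1, y) \<le> \<rho> ^ n * (2 * \<rho>^2) + F" by (simp add: power2_eq_square algebra_simps)
        moreover have "(1 - p) * (2 * \<rho>^2) + p * (1 + z) \<le> \<rho> * (1 + z)"
        proof -
          have "(1 - p) * (2 * \<rho>^2) \<le> 1 * (2 * \<rho>^2)" using p0 by (intro mult_right_mono) auto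
          moreover have "\<rho> * \<rho> \<le> \<rho> * (1 / 4)" using \<rho> by (intro mult_left_mono) auto
          moreover have "p * (1 + z) \<le> p * 2" using p0 z by (intro mult_left_mono) auto
          moreover have "\<rho> * 1 \<le> \<rho> * (1 + z)" using \<rho> z by (intro mult_left_mono) auto
          ultimately show ?thesis using p\<rho> by (simp add: power2_eq_square)
        qed
        ultimately show ?thesis by (intro exI[of _ "2 * \<rho>^2"]) simp
      qed
      then obtain B where B: "reach_bound a \<beta> k (x + 1, y) \<le> \<rho> ^ n * B + F"
        "(1 - p) * B + p * (1 + z) \<le> \<rho> * (1 + z)" by blast
      have "(1 - p) * reach_bound a \<beta> k (x + 1, y) + p * reach_bound a \<beta> k (x, y + 1)
         \<le> (1 - p) * (\<rho> ^ n * B + F) + p * (\<rho> ^ n * (1 + z) + F)"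
        unfolding g_up using B(1) p0 \<rho> by (intro add_mono mult_left_mono) auto
      also have "\<dots> = \<rho> ^ n * ((1 - p) * B + p * (1 + z)) + F" by (simp add: algebra_simps)
      also have "\<dots> \<le> \<rho> ^ n * (\<rho> * (1 + z)) + F" using B(2) \<rho> by (intro add_mono mult_left_mono) auto
      finally show ?thesis .
    qed
    then show ?thesis using False up unfolding g
      by (simp add: mean_step_def at_lower_iff_level[OF a(1)] L_def p_def)
  qed
qed

lemma reach_height_small:
  assumes a: "0 < a" "a < 1" and b: "0 < b" "b < 1" and \<beta>: "1 < \<beta>" and k: "1 < \<kappa> a \<beta> * real k" and e: "0 < e"
  defines "S \<equiv> {(x, y). y \<le> level a x + k}"
  shows "eventually (\<lambda>x. \<forall>N. stop_prob a b \<beta> S (- S) N (x, level a x) \<le> e) sequentially"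
proof -
  have "0 < \<kappa> a \<beta> * a" using a \<beta> by (simp add: \<kappa>_def)
  then have "(\<lambda>x::nat. (real x + 1) powr (- (\<kappa> a \<beta> * a))) \<longlonglongrightarrow> 0" by real_asymp
  then have "(\<lambda>x. jump_odds a \<beta> k x) \<longlonglongrightarrow> jump_const a \<beta> k * 0"
    unfolding jump_odds_def by (intro tendsto_intros)
  then have odds: "eventually (\<lambda>x. jump_odds a \<beta> k x < 1 / 4) sequentially"
    by (intro order_tendstoD(2)) auto
  have "(\<lambda>x. future a \<beta> k (level a x)) \<longlonglongrightarrow> 0"
    using filterlim_compose[OF future_props(3)[OF a \<beta> k] level_filterlim[OF a(1)]] .
  then have fut: "eventually (\<lambda>x. future a \<beta> k (level a x) < e) sequentially"
    using e by (intro order_tendstoD(2)) auto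
  obtain x0 where x0: "\<And>x. x0 \<le> x \<Longrightarrow> jump_odds a \<beta> k x < 1 / 4 \<and> (\<forall>y \<le> level a x + k. \<not> at_upper b (x, y)) \<and> 1 \<le> x"
    using eventually_conj[OF odds eventually_conj[OF eventually_not_at_upper[OF a b, of k] eventually_ge_at_top[of 1]]]
    unfolding eventually_sequentially by blast
  define I where "I = {(x, y). x0 \<le> x \<and> level a x \<le> y}"
  have "0 \<le> 1 + (real (level a x) + 1 - (real x + 1) powr a)" for x
    using level_bounds(2)[OF a(1), of x] by linarith
  then have nn: "0 \<le> reach_bound a \<beta> k u" for u
    using future_props(1)[OF a \<beta> k] less_imp_le[OF jump_odds_pos[OF a(1)]]
    by (auto simp: reach_bound_def split: prod.split
          intro!: add_nonneg_nonneg[OF mult_nonneg_nonneg])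
  have le: "stop_prob a b \<beta> S (- S) N u \<le> reach_bound a \<beta> k u" if "u \<in> I" for u N
  proof (rule stop_prob_le[OF _ _ that])
    fix u assume "u \<in> I"
    show "indicator (- S) u \<le> reach_bound a \<beta> k u"
    proof (cases "u \<in> S")
      case False
      obtain x y where u: "u = (x, y)" by (cases u)
      have "k + 1 - (y - level a x) = 0" "\<not> y \<le> level a x" using False u by (auto simp: S_def)
      then have "1 \<le> reach_bound a \<beta> k u"
        using level_bounds(2)[OF a(1), of x] future_props(1)[OF a \<beta> k, of "level a x + 1"]
        by (simp add: u reach_bound_def)
      then show ?thesis using False by simp
    qed (use nn in auto)
  next
    fix x y assume xy: "(x, y) \<in> I" "(x, y) \<in> S"
    then have b1: "level a x \<le> y" "y \<le> level a x + k" "x0 \<le> x" by (auto simp: I_def S_def)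
    note x = x0[OF b1(3)]
    have "mean_step a b \<beta> (reach_bound a \<beta> k) (x, y) \<le> reach_bound a \<beta> k (x, y)"
      using x b1 by (intro reach_bound_supersolution a \<beta> k) auto
    then show "(\<not> at_lower a (x, y) \<longrightarrow> (x + 1, y) \<in> I) \<and>
        (at_lower a (x, y) \<or> \<not> at_upper b (x, y) \<longrightarrow> (x, y + 1) \<in> I) \<and>
        mean_step a b \<beta> (reach_bound a \<beta> k) (x, y) \<le> reach_bound a \<beta> k (x, y)"
      using b1 level_Suc[OF a, of x] by (auto simp: I_def at_lower_iff_level[OF a(1)])
  qed
  show ?thesis using eventually_conj[OF fut eventually_ge_at_top[of x0]]
  proof eventually_elim
    case (elim x)
    show ?case
    proof
      fix N
      have "stop_prob a b \<beta> S (- S) N (x, level a x) \<le> reach_bound a \<beta> k (x, level a x)"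
        using elim by (intro le) (simp add: I_def)
      then show "stop_prob a b \<beta> S (- S) N (x, level a x) \<le> e" using elim by (simp add: reach_bound_def)
    qed
  qed
qed

section \<open>The lower boundary: height k is reached again and again\<close>

text \<open>
  The set that has to be visited infinitely often for \<open>limsup (y - x\<^sup>a) \<ge> k - \<epsilon>\<close>.
\<close>

definition high :: "real \<Rightarrow> nat \<Rightarrow> real \<Rightarrow> (nat \<times> nat) set" where
  "high a k \<epsilon> = {(x, y). real x powr a + real k - \<epsilon> \<le> real y}"

text \<open>
  A lower bound, constant along a level, for the ratio of the probability of a step up to the decrease of
  \<open>-x\<^sup>a\<close> caused by a step to the right. The constant is what \<open>climb_prob_subsolution\<close> needs.
\<close>

definition jump_rate :: "real \<Rightarrow> real \<Rightarrow> nat \<Rightarrow> nat \<Rightarrow> real" where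
  "jump_rate a \<beta> k w = 1 / (2 + 2 * real k * 2 powr \<kappa> a \<beta>) * real w powr (- \<kappa> a \<beta>)"

text \<open>
  A lower bound for the probability of at least \<open>n\<close> steps up at level \<open>w\<close> before the slack \<open>t\<close>, which
  decreases with each step to the right, is used up. Without positive slack the value is \<open>0\<close> also
  for \<open>n = 0\<close>, because a state at height \<open>k\<close> is not in \<open>high\<close> if the slack is negative.
\<close>

definition climb_prob :: "real \<Rightarrow> real \<Rightarrow> nat \<Rightarrow> nat \<Rightarrow> nat \<Rightarrow> real \<Rightarrow> real" where
  "climb_prob a \<beta> k w n t = (if t \<le> 0 then 0 else (jump_rate a \<beta> k w * t) ^ n)"

text \<open>
  A bound for the probability of passing through level \<open>w\<close> without a visit to \<open>high\<close>. The passage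
  starts with slack at least \<open>\<epsilon>\<close> and, after a possible reflection, at height at least \<open>1\<close>, so that
  at most \<open>k - 1\<close> additional steps up are needed.
\<close>

definition window_fail :: "real \<Rightarrow> real \<Rightarrow> nat \<Rightarrow> real \<Rightarrow> nat \<Rightarrow> real" where
  "window_fail a \<beta> k \<epsilon> w = 1 - (jump_rate a \<beta> k w * \<epsilon>) ^ (k - 1)"

text \<open>
  The state in column \<open>x\<close> at height \<open>k\<close> belongs to \<open>high\<close> as long as this is nonnegative.
\<close>

definition slack :: "real \<Rightarrow> real \<Rightarrow> nat \<Rightarrow> real" where
  "slack a \<epsilon> x = real (level a x) + \<epsilon> - real x powr a"

text \<open>
  A bound for the probability of arriving at level \<open>W\<close> without having visited \<open>high\<close>: the attempt at the
  present level and the attempts at all levels strictly between it and \<open>W\<close> have to fail. The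
  minimum with \<open>k - 1\<close> matters only at height \<open>0\<close>, where the next step up is certain.
\<close>

definition avoid_bound :: "real \<Rightarrow> real \<Rightarrow> nat \<Rightarrow> real \<Rightarrow> nat \<Rightarrow> nat \<times> nat \<Rightarrow> real" where
  "avoid_bound a \<beta> k \<epsilon> W = (\<lambda>(x, y). if W \<le> level a x then 1 else
     (1 - climb_prob a \<beta> k (level a x) (min (k - 1) (k - (y - level a x))) (slack a \<epsilon> x)) *
     (\<Prod>w\<in>{level a x<..<W}. window_fail a \<beta> k \<epsilon> w))"

lemma \<kappa>_pos: "0 < a \<Longrightarrow> a < 1 \<Longrightarrow> 1 < \<beta> \<Longrightarrow> 0 < \<kappa> a \<beta>"
  by (simp add: \<kappa>_def)

lemma jump_rate_bounds:
  assumes "0 < a" "a < 1" "1 < \<beta>"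
  shows "0 \<le> jump_rate a \<beta> k w" "1 \<le> w \<Longrightarrow> jump_rate a \<beta> k w \<le> 1 / 2"
proof -
  show "0 \<le> jump_rate a \<beta> k w" by (simp add: jump_rate_def add_nonneg_nonneg)
  assume w: "1 \<le> w"
  have "real w powr (- \<kappa> a \<beta>) \<le> 1 powr (- \<kappa> a \<beta>)"
    using w \<kappa>_pos[OF assms] by (intro powr_mono2') auto
  moreover have "1 / (2 + 2 * real k * 2 powr \<kappa> a \<beta>) \<le> 1 / 2"
    by (intro divide_left_mono mult_pos_pos) (auto intro: add_pos_nonneg)
  ultimately have "jump_rate a \<beta> k w \<le> 1 / 2 * 1"
    unfolding jump_rate_def by (intro mult_mono) auto
  then show "jump_rate a \<beta> k w \<le> 1 / 2" by simp
qed

lemma slack_bounds: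
  assumes "0 < a" "a < 1" "0 < \<epsilon>" "\<epsilon> < 1" "1 \<le> x"
  shows "slack a \<epsilon> x \<le> 2"
  using level_bounds(1)[OF assms(1), of x] powr_increment(3)[of "real x" a] assms by (simp add: slack_def)

lemma window_fail_bounds:
  assumes "0 < a" "a < 1" "1 < \<beta>" "0 < \<epsilon>" "\<epsilon> < 1" "1 \<le> w"
  shows "0 \<le> window_fail a \<beta> k \<epsilon> w" "window_fail a \<beta> k \<epsilon> w \<le> 1"
proof -
  have "jump_rate a \<beta> k w * \<epsilon> \<le> 1 / 2 * 1"
    using jump_rate_bounds[OF assms(1-3)] assms by (intro mult_mono) auto
  moreover have "0 \<le> jump_rate a \<beta> k w * \<epsilon>" using jump_rate_bounds[OF assms(1-3)] assms by simp
  ultimately show "0 \<le> window_fail a \<beta> k \<epsilon> w" "window_fail a \<beta> k \<epsilon> w \<le> 1"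
    by (auto simp: window_fail_def power_le_one)
qed

lemma climb_prob_bounds:
  assumes "0 < a" "a < 1" "1 < \<beta>" "1 \<le> w" "t \<le> 2"
  shows "0 \<le> climb_prob a \<beta> k w n t" "climb_prob a \<beta> k w n t \<le> 1"
proof -
  have *: "0 \<le> jump_rate a \<beta> k w * t \<and> jump_rate a \<beta> k w * t \<le> 1" if "0 < t"
  proof -
    have "jump_rate a \<beta> k w * t \<le> 1 / 2 * 2"
      using jump_rate_bounds[OF assms(1-3)] assms that by (intro mult_mono) auto
    then show ?thesis using jump_rate_bounds(1)[OF assms(1-3)] that by simp
  qed
  then show "0 \<le> climb_prob a \<beta> k w n t" "climb_prob a \<beta> k w n t \<le> 1"
    by (auto simp: climb_prob_def power_le_one)
qed

lemma power_diff_le: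
  fixes u v :: real
  assumes "0 \<le> v" "v \<le> u"
  shows "u ^ Suc m - v ^ Suc m \<le> real (Suc m) * (u - v) * u ^ m"
proof (induction m)
  case (Suc m)
  have "u ^ Suc (Suc m) - v ^ Suc (Suc m) = u * (u ^ Suc m - v ^ Suc m) + (u - v) * v ^ Suc m"
    by (simp add: algebra_simps)
  also have "\<dots> \<le> u * (real (Suc m) * (u - v) * u ^ m) + (u - v) * u ^ Suc m"
    using assms Suc by (intro add_mono mult_left_mono power_mono) auto
  also have "\<dots> = real (Suc (Suc m)) * (u - v) * u ^ Suc m" by (simp add: algebra_simps)
  finally show ?case .
qed simp

text \<open>
  A step to the right lowers the position relative to the boundary by at most \<open>x\<^sup>a\<^sup>-\<^sup>1\<close>, while a step
  up has probability at least \<open>x\<^sup>(\<^sup>a\<^sup>-\<^sup>1\<^sup>)\<^sup>\<beta> / 2\<close>. The quotient of the two is at most of order \<open>x\<^sup>a\<^sup>\<kappa>\<close>, and \<open>x\<^sup>a\<close> is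
  comparable to the level.
\<close>

lemma up_prob_lower_bound:
  assumes a: "0 < a" "a < 1" and \<beta>: "1 < \<beta>" and x: "1 \<le> x" and y: "real x powr a \<le> real y"
  shows "(real x + 1) powr a - real x powr a \<le> 2 * 2 powr \<kappa> a \<beta> * real (level a x) powr \<kappa> a \<beta> * up_prob \<beta> x y"
proof -
  define p where "p = up_prob \<beta> x y"
  have x0: "0 < real x" using x by simp
  have y0: "0 < real y" using y powr_gt_zero[THEN iffD2, of "real x" a] x0 by linarith
  have "(real x powr a) powr \<beta> \<le> real y powr \<beta>" using y \<beta> by (intro powr_mono2) auto
  moreover have "(real x powr a) powr \<beta> \<le> (real x powr 1) powr \<beta>"
    using x a \<beta> by (intro powr_mono2 powr_mono) auto
  ultimately have "real x powr (a * \<beta>) * real x powr \<beta> + real x powr (a * \<beta>) * real y powr \<beta>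
      \<le> real y powr \<beta> * real x powr \<beta> + real x powr \<beta> * real y powr \<beta>"
    by (intro add_mono mult_right_mono) (auto simp: powr_powr)
  then have "real x powr (a * \<beta>) / (2 * real x powr \<beta>) \<le> p"
    using x0 y0 add_pos_pos[of "real x powr \<beta>" "real y powr \<beta>"]
    unfolding p_def up_prob_def by (simp add: field_simps)
  then have "real x powr (a * \<beta> - \<beta>) \<le> 2 * p" by (simp add: powr_diff)
  then have "real x powr (\<kappa> a \<beta> * a) * real x powr (a * \<beta> - \<beta>) \<le> real x powr (\<kappa> a \<beta> * a) * (2 * p)"
    by (intro mult_left_mono) auto
  also have "real x powr (\<kappa> a \<beta> * a) * real x powr (a * \<beta> - \<beta>) = real x powr (a - 1)"
  proof -
    have "\<kappa> a \<beta> * a + (a * \<beta> - \<beta>) = a - 1" using a by (simp add: \<kappa>_def field_simps)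
    then show ?thesis by (simp only: powr_add[symmetric])
  qed
  finally have 1: "real x powr (a - 1) \<le> (real x powr a) powr \<kappa> a \<beta> * (2 * p)"
    by (simp add: powr_powr mult.commute)
  have "real x powr a \<le> (real x + 1) powr a" using a by (intro powr_mono2) auto
  also have "\<dots> \<le> 2 * real (level a x)"
    using level_bounds(2)[OF a(1), of x] level_pos[OF a(1) x] by simp
  finally have "(real x powr a) powr \<kappa> a \<beta> \<le> (2 * real (level a x)) powr \<kappa> a \<beta>"
    using \<kappa>_pos[OF a \<beta>] by (intro powr_mono2) auto
  then have "(real x powr a) powr \<kappa> a \<beta> * (2 * p) \<le> (2 * real (level a x)) powr \<kappa> a \<beta> * (2 * p)"
    using up_prob_nonneg[of \<beta> x y] by (intro mult_right_mono) (auto simp: p_def)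
  with 1 powr_increment(1)[of "real x" a] a x show ?thesis
    by (simp add: p_def powr_mult algebra_simps)
qed

text \<open>
  With \<open>T = \<theta> t\<close> and the rate \<open>\<theta>\<close>, a step to the right decreases \<open>T\<^sup>n\<^sup>+\<^sup>1\<close> by at most
  \<open>(n + 1) \<theta> \<delta> T\<^sup>n\<close>, and a step up replaces it by \<open>T\<^sup>n\<close>. The gain \<open>p T\<^sup>n\<close> outweighs the losses because
  \<open>\<theta> (2 p + k \<delta>) \<le> p\<close>.
\<close>

lemma climb_prob_subsolution:
  assumes a: "0 < a" "a < 1" and \<beta>: "1 < \<beta>" and x: "1 \<le> x" and y: "real x powr a \<le> real y"
    and t: "0 < t" "t \<le> 2" and n: "Suc n \<le> k"
  defines "p \<equiv> up_prob \<beta> x y" and "\<delta> \<equiv> (real x + 1) powr a - real x powr a" and "w \<equiv> level a x"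
  shows "climb_prob a \<beta> k w (Suc n) t \<le>
    (1 - p) * climb_prob a \<beta> k w (Suc n) (t - \<delta>) + p * climb_prob a \<beta> k w n t"
proof -
  define \<theta> where "\<theta> = jump_rate a \<beta> k w"
  define T where "T = \<theta> * t"
  have p: "0 \<le> p" "p \<le> 1" using up_prob_nonneg up_prob_le_1 by (auto simp: p_def)
  have w: "1 \<le> w" using level_pos[OF a(1) x] by (simp add: w_def)
  have \<theta>: "0 \<le> \<theta>" using jump_rate_bounds[OF a \<beta>] by (simp add: \<theta>_def)
  have T: "0 \<le> T" using \<theta> t by (simp add: T_def)
  have \<delta>: "0 \<le> \<delta>" using a by (auto simp: \<delta>_def intro!: powr_mono2)
  have small: "\<theta> * (2 * p + real k * \<delta>) \<le> p"
  proof -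
    define D where "D = 2 + 2 * real k * 2 powr \<kappa> a \<beta>"
    have D: "0 < D" unfolding D_def by (intro add_pos_nonneg) auto
    have wk: "1 \<le> real w powr \<kappa> a \<beta>" using w \<kappa>_pos[OF a \<beta>] by (intro ge_one_powr_ge_zero) auto
    have "real k * \<delta> \<le> real k * (2 * 2 powr \<kappa> a \<beta> * real w powr \<kappa> a \<beta> * p)"
      using up_prob_lower_bound[OF a \<beta> x y] unfolding \<delta>_def w_def p_def by (intro mult_left_mono) auto
    moreover have "2 * p * 1 \<le> 2 * p * real w powr \<kappa> a \<beta>" using p wk by (intro mult_left_mono) auto
    ultimately have "2 * p + real k * \<delta> \<le> D * real w powr \<kappa> a \<beta> * p" by (simp add: D_def algebra_simps)
    then have "\<theta> * (2 * p + real k * \<delta>) \<le> \<theta> * (D * real w powr \<kappa> a \<beta> * p)" using \<theta> by (rule mult_left_mono)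
    also have "\<dots> = p" using D w by (simp add: \<theta>_def jump_rate_def D_def[symmetric] powr_minus)
    finally show ?thesis .
  qed
  have step: "T ^ Suc n - real (Suc n) * (\<theta> * \<delta>) * T ^ n \<le> climb_prob a \<beta> k w (Suc n) (t - \<delta>)"
  proof (cases "t - \<delta> \<le> 0")
    case True
    have "T * T ^ n \<le> (1 * (\<theta> * \<delta>)) * T ^ n"
      using True \<theta> T unfolding T_def by (intro mult_right_mono) (auto intro: mult_left_mono)
    also have "\<dots> \<le> (real (Suc n) * (\<theta> * \<delta>)) * T ^ n"
      using \<theta> \<delta> T by (intro mult_right_mono) auto
    finally show ?thesis using True by (simp add: climb_prob_def)
  next
    case False
    have "T ^ Suc n - (\<theta> * (t - \<delta>)) ^ Suc n \<le> real (Suc n) * (T - \<theta> * (t - \<delta>)) * T ^ n"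
      using False \<theta> \<delta> by (intro power_diff_le) (auto simp: T_def intro: mult_left_mono)
    then show ?thesis using False by (simp add: climb_prob_def \<theta>_def[symmetric] T_def algebra_simps)
  qed
  have "(1 - p) * (T ^ Suc n - real (Suc n) * (\<theta> * \<delta>) * T ^ n)
      \<le> (1 - p) * climb_prob a \<beta> k w (Suc n) (t - \<delta>)"
    using step p by (intro mult_left_mono) auto
  moreover have now: "climb_prob a \<beta> k w n t = T ^ n" "climb_prob a \<beta> k w (Suc n) t = T ^ Suc n"
    using t by (simp_all add: climb_prob_def T_def \<theta>_def)
  moreover have "T ^ Suc n \<le> (1 - p) * (T ^ Suc n - real (Suc n) * (\<theta> * \<delta>) * T ^ n) + p * T ^ n"
  proof -
    have "p * T \<le> \<theta> * (2 * p)"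
      using mult_left_mono[OF t(2), of "p * \<theta>"] p \<theta> by (simp add: T_def algebra_simps)
    moreover have "real (Suc n) * (\<theta> * \<delta>) \<le> real k * (\<theta> * \<delta>)"
      using n \<theta> \<delta> by (intro mult_right_mono) auto
    moreover have "0 \<le> p * (real (Suc n) * (\<theta> * \<delta>))" using p \<theta> \<delta> by simp
    ultimately have "0 \<le> p - p * T - real (Suc n) * (\<theta> * \<delta>) + p * (real (Suc n) * (\<theta> * \<delta>))"
      using small by (simp add: algebra_simps)
    then have "0 \<le> T ^ n * (p - p * T - real (Suc n) * (\<theta> * \<delta>) + p * (real (Suc n) * (\<theta> * \<delta>)))"
      using T by (intro mult_nonneg_nonneg) auto
    then show ?thesis by (simp add: algebra_simps)
  qed
  ultimately show ?thesis unfolding now by linarith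
qed

text \<open>
  While the slack is positive, the level cannot change at the next step if \<open>x\<close> is large, and
  \<open>climb_prob_subsolution\<close> applies. When the slack has been used up, the bound stays constant until the next
  level is reached; there a new attempt starts, which accounts for the next factor of the product.
\<close>

lemma avoid_bound_supersolution:
  assumes a: "0 < a" "a < 1" and \<beta>: "1 < \<beta>" and \<epsilon>: "0 < \<epsilon>" "\<epsilon> < 1" and k: "1 \<le> k"
    and x: "1 \<le> x" "2 * real x powr (a - 1) < 1 - \<epsilon>"
    and y: "level a x \<le> y" "(x, y) \<notin> high a k \<epsilon>" and up: "\<not> at_upper b (x, y)" and W: "level a x < W"
  shows "mean_step a b \<beta> (avoid_bound a \<beta> k \<epsilon> W) (x, y) \<le> avoid_bound a \<beta> k \<epsilon> W (x, y)"
proof -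
  define L where "L = level a x"
  define t where "t = slack a \<epsilon> x"
  define n where "n = min (k - 1) (k - (y - L))"
  define pr where "pr = (\<Prod>w\<in>{L<..<W}. window_fail a \<beta> k \<epsilon> w)"
  have L1: "1 \<le> L" using level_pos[OF a(1) x(1)] by (simp add: L_def)
  have pr0: "0 \<le> pr" unfolding pr_def using L1 by (intro prod_nonneg ballI window_fail_bounds a \<beta> \<epsilon>) auto
  have t2: "t \<le> 2" using slack_bounds[OF a \<epsilon> x(1)] by (simp add: t_def)
  have here: "avoid_bound a \<beta> k \<epsilon> W (x, y) = (1 - climb_prob a \<beta> k L n t) * pr"
    using W by (simp add: avoid_bound_def L_def n_def t_def pr_def)
  have above: "avoid_bound a \<beta> k \<epsilon> W (x, y + 1) = (1 - climb_prob a \<beta> k L (min (k - 1) (k - (y + 1 - L))) t) * pr"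
    using W by (simp add: avoid_bound_def L_def n_def t_def pr_def)
  show ?thesis
  proof (cases "y = L")
    case True
    have "min (k - 1) (k - (y + 1 - L)) = n" using True k by (simp add: n_def)
    then show ?thesis using True here above by (simp add: mean_step_def at_lower_iff_level[OF a(1)] L_def)
  next
    case False
    then have yL: "L < y" using y by (simp add: L_def)
    define p where "p = up_prob \<beta> x y"
    have p: "0 \<le> p" "p \<le> 1" using up_prob_nonneg up_prob_le_1 by (auto simp: p_def)
    have "(1 - p) * avoid_bound a \<beta> k \<epsilon> W (x + 1, y) + p * avoid_bound a \<beta> k \<epsilon> W (x, y + 1)
      \<le> (1 - climb_prob a \<beta> k L n t) * pr"
    proof (cases "t \<le> 0")
      case True
      have "avoid_bound a \<beta> k \<epsilon> W (x, y + 1) = pr" using above True by (simp add: climb_prob_def)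
      moreover have "avoid_bound a \<beta> k \<epsilon> W (x + 1, y) \<le> pr"
        using level_Suc[OF a, of x]
      proof
        assume eq: "level a (x + 1) = level a x"
        have "real x powr a \<le> real (x + 1) powr a" using a by (intro powr_mono2) auto
        then have "slack a \<epsilon> (x + 1) \<le> 0" using True unfolding slack_def t_def eq by simp
        then show ?thesis using eq W unfolding avoid_bound_def by (simp add: climb_prob_def pr_def L_def)
      next
        assume eq: "level a (x + 1) = level a x + 1"
        show ?thesis
        proof (cases "W = L + 1")
          case True
          then have "{L<..<W} = {}" by auto
          then show ?thesis using eq True unfolding avoid_bound_def by (simp add: L_def pr_def)
        next
          case False
          then have W': "L + 1 < W" using W by (simp add: L_def)
          define t' where "t' = slack a \<epsilon> (x + 1)"
          define n' where "n' = min (k - 1) (k - (y - (L + 1)))"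
          define pr' where "pr' = (\<Prod>w\<in>{L + 1<..<W}. window_fail a \<beta> k \<epsilon> w)"
          have "{L<..<W} = insert (L + 1) {L + 1<..<W}" using W' by auto
          then have pr: "pr = window_fail a \<beta> k \<epsilon> (L + 1) * pr'" by (simp add: pr_def pr'_def)
          have pr'0: "0 \<le> pr'" unfolding pr'_def by (intro prod_nonneg ballI window_fail_bounds a \<beta> \<epsilon>) auto
          have t': "\<epsilon> \<le> t'" using level_bounds(2)[OF a(1), of x] eq by (simp add: t'_def slack_def add.commute)
          have t'2: "t' \<le> 2" using slack_bounds[OF a \<epsilon>, of "x + 1"] by (simp add: t'_def)
          define r where "r = jump_rate a \<beta> k (L + 1)"
          have r: "0 \<le> r" "r \<le> 1 / 2" using jump_rate_bounds[OF a \<beta>, where k = k and w = "L + 1"] by (auto simp: r_def)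
          have "r * t' \<le> 1 / 2 * 2" using r t'2 t' \<epsilon> by (intro mult_mono) auto
          then have rt: "r * t' \<le> 1" by simp
          have "(r * \<epsilon>) ^ (k - 1) \<le> (r * t') ^ (k - 1)"
            using r \<epsilon> t' by (intro power_mono mult_left_mono) auto
          also have "\<dots> \<le> (r * t') ^ n'"
            using r t' \<epsilon> rt by (intro power_decreasing) (auto simp: n'_def)
          finally have "1 - climb_prob a \<beta> k (L + 1) n' t' \<le> window_fail a \<beta> k \<epsilon> (L + 1)"
            using t' \<epsilon> by (simp add: climb_prob_def window_fail_def r_def)
          then have "(1 - climb_prob a \<beta> k (L + 1) n' t') * pr' \<le> pr"
            unfolding pr using pr'0 by (intro mult_right_mono)
          moreover have "avoid_bound a \<beta> k \<epsilon> W (x + 1, y) = (1 - climb_prob a \<beta> k (L + 1) n' t') * pr'"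
            using eq W' by (simp add: avoid_bound_def n'_def t'_def pr'_def L_def)
          ultimately show ?thesis by simp
        qed
      qed
      ultimately have "(1 - p) * avoid_bound a \<beta> k \<epsilon> W (x + 1, y) + p * avoid_bound a \<beta> k \<epsilon> W (x, y + 1) \<le> (1 - p) * pr + p * pr"
        using p by (intro add_mono mult_left_mono) auto
      also have "\<dots> = pr" by (simp add: algebra_simps)
      finally show ?thesis using True by (simp add: climb_prob_def)
    next
      case False
      then have t: "0 < t" by simp
      define \<delta> where "\<delta> = (real x + 1) powr a - real x powr a"
      have eq: "level a (x + 1) = level a x"
      proof -
        have "(real x + 1) powr (a - 1) \<le> real x powr (a - 1)" using a x(1) by (intro powr_mono2') auto
        then have "(real x + 2) powr a - real x powr a \<le> 2 * real x powr (a - 1)"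
          using powr_increment(1)[of "real x" a] powr_increment(1)[of "real x + 1" a] a x(1) by (simp add: add.assoc)
        moreover have "real x powr a < real L + \<epsilon>" using t by (simp add: t_def slack_def L_def)
        moreover have "real (level a (x + 1)) < (real x + 2) powr a"
          using level_bounds(1)[OF a(1), of "x + 1"] by (simp add: add.commute)
        ultimately have "real (level a (x + 1)) < real L + 1" using x(2) by linarith
        then show ?thesis using level_Suc[OF a, of x] by (auto simp: L_def)
      qed
      have "real y < real L + real k" using y(2) t by (simp add: high_def t_def slack_def L_def)
      then have yk: "y < L + k" by linarith
      define m where "m = k - (y - L) - 1"
      have n: "n = Suc m" and n_up: "min (k - 1) (k - (y + 1 - L)) = m" and mk: "Suc m \<le> k"
        using yk yL k by (auto simp: n_def m_def)
      have right: "avoid_bound a \<beta> k \<epsilon> W (x + 1, y) = (1 - climb_prob a \<beta> k L n (t - \<delta>)) * pr"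
        unfolding avoid_bound_def using eq W
        by (simp add: L_def n_def t_def pr_def slack_def \<delta>_def algebra_simps)
      have "real x powr a \<le> (real x + 1) powr a" using a by (intro powr_mono2) auto
      also have "\<dots> \<le> real y" using level_bounds(2)[OF a(1), of x] yL by (simp add: L_def)
      finally have xy: "real x powr a \<le> real y" .
      have "climb_prob a \<beta> k L n t \<le> (1 - p) * climb_prob a \<beta> k L n (t - \<delta>) + p * climb_prob a \<beta> k L m t"
        using climb_prob_subsolution[OF a \<beta> x(1) xy t t2 mk] by (simp add: n p_def \<delta>_def L_def)
      then have "((1 - p) * (1 - climb_prob a \<beta> k L n (t - \<delta>)) + p * (1 - climb_prob a \<beta> k L m t)) * pr
          \<le> (1 - climb_prob a \<beta> k L n t) * pr"
        using pr0 by (intro mult_right_mono) (simp_all add: algebra_simps)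
      then show ?thesis unfolding right above n_up by (simp add: algebra_simps)
    qed
    then show ?thesis using yL up here
      by (simp add: mean_step_def at_lower_iff_level[OF a(1)] L_def p_def)
  qed
qed

text \<open>
  The success probabilities at the single levels are at least a constant times \<open>1 / w\<close>, as
  \<open>\<kappa> (k - 1) \<le> 1\<close>, and the harmonic series diverges.
\<close>

lemma window_fail_prod_small:
  assumes a: "0 < a" "a < 1" and \<beta>: "1 < \<beta>" and \<epsilon>: "0 < \<epsilon>" "\<epsilon> < 1"
    and k: "\<kappa> a \<beta> * (real k - 1) \<le> 1" "1 \<le> k" and L: "1 \<le> L" and \<eta>: "0 < \<eta>"
  shows "\<exists>W>L. (\<Prod>w\<in>{L<..<W}. window_fail a \<beta> k \<epsilon> w) \<le> \<eta>"
proof -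
  define e where "e = (\<lambda>w. (jump_rate a \<beta> k w * \<epsilon>) ^ (k - 1))"
  define C where "C = (1 / (2 + 2 * real k * 2 powr \<kappa> a \<beta>) * \<epsilon>) ^ (k - 1)"
  have "0 < 2 + 2 * real k * 2 powr \<kappa> a \<beta>" by (intro add_pos_nonneg) auto
  then have C: "0 < C" using \<epsilon> by (simp add: C_def)
  have e_ge: "C * (1 / real w) \<le> e w" if "1 \<le> w" for w
  proof -
    have "(real w powr (- \<kappa> a \<beta>)) ^ (k - 1) = real w powr (- (\<kappa> a \<beta> * (real k - 1)))"
      using that k(2) by (simp add: powr_power of_nat_diff mult.commute)
    also have "\<dots> \<ge> real w powr (- 1)" using that k by (intro powr_mono) auto
    finally have "real w powr (-1) \<le> (real w powr (- \<kappa> a \<beta>)) ^ (k - 1)" .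
    then have "C * real w powr (-1) \<le> C * (real w powr (- \<kappa> a \<beta>)) ^ (k - 1)"
      using C by (intro mult_left_mono) auto
    moreover have "e w = C * (real w powr (- \<kappa> a \<beta>)) ^ (k - 1)"
      unfolding e_def C_def jump_rate_def by (simp add: power_mult_distrib power_divide)
    moreover have "real w powr (- 1) = 1 / real w" using that by (simp add: powr_minus divide_inverse)
    ultimately show ?thesis by simp
  qed
  have e0: "0 \<le> e w" for w using jump_rate_bounds(1)[OF a \<beta>] \<epsilon> by (simp add: e_def)
  have "\<not> summable e"
  proof
    assume "summable e"
    then have "summable (\<lambda>w. C * (1 / real w))"
      by (rule summable_comparison_test_ev[rotated])
        (use e_ge C in \<open>auto simp: eventually_sequentially intro!: exI[of _ 1]\<close>)
    from summable_mult[OF this, of "1 / C"] have "summable (\<lambda>w. 1 / real w)" using C by simp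
    then show False using not_summable_harmonic[where 'a = real] by (simp add: inverse_eq_divide)
  qed
  then have "\<exists>n. \<not> sum e {..n} \<le> sum e {..L} - ln \<eta>"
    using bounded_imp_summable[of e] e0 by blast
  then obtain n where n: "sum e {..L} - ln \<eta> < sum e {..n}" by (auto simp: not_le)
  define W where "W = max (n + 1) (L + 1)"
  have "sum e {..n} \<le> sum e {..<W}" using e0 by (intro sum_mono2) (auto simp: W_def)
  also have "{..<W} = {..L} \<union> {L<..<W}" by (auto simp: W_def)
  also have "sum e ({..L} \<union> {L<..<W}) = sum e {..L} + sum e {L<..<W}"
    by (rule sum.union_disjoint) auto
  finally have s: "- ln \<eta> < sum e {L<..<W}" using n by simp
  have "(\<Prod>w\<in>{L<..<W}. window_fail a \<beta> k \<epsilon> w) \<le> (\<Prod>w\<in>{L<..<W}. exp (- e w))"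
  proof (intro prod_mono conjI)
    fix w assume "w \<in> {L<..<W}"
    then have "1 \<le> w" using L by simp
    then show "0 \<le> window_fail a \<beta> k \<epsilon> w" by (intro window_fail_bounds a \<beta> \<epsilon>)
    show "window_fail a \<beta> k \<epsilon> w \<le> exp (- e w)"
      using exp_ge_add_one_self[of "- e w"] by (simp add: window_fail_def e_def)
  qed
  also have "\<dots> = exp (- sum e {L<..<W})" by (simp add: exp_sum sum_negf[symmetric])
  also have "\<dots> \<le> exp (ln \<eta>)" using s by simp
  also have "\<dots> = \<eta>" using \<eta> by simp
  finally show ?thesis by (intro exI[of _ W]) (simp add: W_def)
qed

lemma avoid_high_small:
  assumes a: "0 < a" "a < 1" and b: "0 < b" "b < 1" and \<beta>: "1 < \<beta>" and \<epsilon>: "0 < \<epsilon>" "\<epsilon> < 1"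
    and k: "\<kappa> a \<beta> * (real k - 1) \<le> 1" "1 \<le> k"
  shows "eventually (\<lambda>x. \<forall>y\<ge>level a x. \<forall>\<eta>>0. \<exists>W. \<forall>N.
     stop_prob a b \<beta> {(x, y). (x, y) \<notin> high a k \<epsilon> \<and> level a x < W}
       {(x, y). (x, y) \<notin> high a k \<epsilon> \<and> W \<le> level a x} N (x, y) \<le> \<eta>) sequentially"
proof -
  have "(\<lambda>x::nat. 2 * real x powr (a - 1)) \<longlonglongrightarrow> 0" using a by real_asymp
  then have "eventually (\<lambda>x. 2 * real x powr (a - 1) < 1 - \<epsilon>) sequentially"
    by (rule order_tendstoD(2)) (use \<epsilon> in simp)
  then have "eventually (\<lambda>x. 2 * real x powr (a - 1) < 1 - \<epsilon> \<and>
      (\<forall>y \<le> level a x + k. \<not> at_upper b (x, y)) \<and> 1 \<le> x) sequentially"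
    by (intro eventually_conj eventually_not_at_upper[OF a b] eventually_ge_at_top)
  then obtain x0 where x0: "\<And>x. x0 \<le> x \<Longrightarrow> 2 * real x powr (a - 1) < 1 - \<epsilon> \<and>
      (\<forall>y \<le> level a x + k. \<not> at_upper b (x, y)) \<and> 1 \<le> x"
    unfolding eventually_sequentially by blast
  define I where "I = {(x, y). x0 \<le> x \<and> level a x \<le> y}"
  {
    fix W
    define S where "S = {(x, y). (x, y) \<notin> high a k \<epsilon> \<and> level a x < W}"
    define R where "R = {(x, y). (x, y) \<notin> high a k \<epsilon> \<and> W \<le> level a x}"
    have nn: "0 \<le> avoid_bound a \<beta> k \<epsilon> W (x, y)" if "x0 \<le> x" for x y
    proof -
      have x: "1 \<le> x" using x0[OF that] by simp
      then have L: "1 \<le> level a x" by (rule level_pos[OF a(1)])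
      have "0 \<le> 1 - climb_prob a \<beta> k (level a x) (min (k - 1) (k - (y - level a x))) (slack a \<epsilon> x)"
        using climb_prob_bounds(2)[OF a \<beta> L slack_bounds[OF a \<epsilon> x]] by simp
      moreover have "0 \<le> (\<Prod>w\<in>{level a x<..<W}. window_fail a \<beta> k \<epsilon> w)"
        using L by (intro prod_nonneg ballI window_fail_bounds a \<beta> \<epsilon>) auto
      ultimately show ?thesis by (simp add: avoid_bound_def)
    qed
    have "stop_prob a b \<beta> S R N u \<le> avoid_bound a \<beta> k \<epsilon> W u" if "u \<in> I" for u N
    proof (rule stop_prob_le[OF _ _ that])
      fix u assume "u \<in> I"
      then show "indicator R u \<le> avoid_bound a \<beta> k \<epsilon> W u"
        using nn by (cases "u \<in> R") (auto simp: R_def I_def avoid_bound_def)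
    next
      fix x y assume xy: "(x, y) \<in> I" "(x, y) \<in> S"
      then have b1: "level a x \<le> y" "(x, y) \<notin> high a k \<epsilon>" "x0 \<le> x" "level a x < W" by (auto simp: I_def S_def)
      note x = x0[OF b1(3)]
      have "real x powr a \<le> (real x + 1) powr a" using a by (intro powr_mono2) auto
      then have "real y < real (level a x) + 1 + real k"
        using b1(2) level_bounds(2)[OF a(1), of x] \<epsilon> by (simp add: high_def)
      then have "y \<le> level a x + k" by linarith
      then have up: "\<not> at_upper b (x, y)" using x by simp
      have "mean_step a b \<beta> (avoid_bound a \<beta> k \<epsilon> W) (x, y) \<le> avoid_bound a \<beta> k \<epsilon> W (x, y)"
        using x b1 up by (intro avoid_bound_supersolution a \<beta> k \<epsilon>) auto
      then show "(\<not> at_lower a (x, y) \<longrightarrow> (x + 1, y) \<in> I) \<and>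
          (at_lower a (x, y) \<or> \<not> at_upper b (x, y) \<longrightarrow> (x, y + 1) \<in> I) \<and>
          mean_step a b \<beta> (avoid_bound a \<beta> k \<epsilon> W) (x, y) \<le> avoid_bound a \<beta> k \<epsilon> W (x, y)"
        using b1 level_Suc[OF a, of x] by (auto simp: I_def at_lower_iff_level[OF a(1)])
    qed
    note this[unfolded S_def R_def]
  } note le = this
  show ?thesis using eventually_ge_at_top[of x0]
  proof eventually_elim
    case (elim x)
    show ?case
    proof (intro allI impI)
      fix y and \<eta> :: real assume y: "level a x \<le> y" and \<eta>: "0 < \<eta>"
      have x: "1 \<le> x" using x0[OF elim] by simp
      then have L: "1 \<le> level a x" by (rule level_pos[OF a(1)])
      obtain W where W: "level a x < W" "(\<Prod>w\<in>{level a x<..<W}. window_fail a \<beta> k \<epsilon> w) \<le> \<eta>"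
        using window_fail_prod_small[OF a \<beta> \<epsilon> k L \<eta>] by auto
      have "0 \<le> (\<Prod>w\<in>{level a x<..<W}. window_fail a \<beta> k \<epsilon> w)"
        using L by (intro prod_nonneg ballI window_fail_bounds a \<beta> \<epsilon>) auto
      then have "(1 - climb_prob a \<beta> k (level a x) (min (k - 1) (k - (y - level a x))) (slack a \<epsilon> x)) *
            (\<Prod>w\<in>{level a x<..<W}. window_fail a \<beta> k \<epsilon> w)
          \<le> 1 * (\<Prod>w\<in>{level a x<..<W}. window_fail a \<beta> k \<epsilon> w)"
        using climb_prob_bounds(1)[OF a \<beta> L slack_bounds[OF a \<epsilon> x]] by (intro mult_right_mono) auto
      then have "avoid_bound a \<beta> k \<epsilon> W (x, y) \<le> (\<Prod>w\<in>{level a x<..<W}. window_fail a \<beta> k \<epsilon> w)"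
        using W(1) unfolding avoid_bound_def by simp
      with W(2) have "avoid_bound a \<beta> k \<epsilon> W (x, y) \<le> \<eta>" by simp
      moreover have "(x, y) \<in> I" using elim y by (simp add: I_def)
      ultimately show "\<exists>W. \<forall>N. stop_prob a b \<beta> {(x, y). (x, y) \<notin> high a k \<epsilon> \<and> level a x < W}
         {(x, y). (x, y) \<notin> high a k \<epsilon> \<and> W \<le> level a x} N (x, y) \<le> \<eta>"
        using le[of "(x, y)" W] by (intro exI[of _ W]) (meson order_trans)
    qed
  qed
qed

section \<open>Almost sure behaviour of the chain\<close>

definition history :: "(nat \<Rightarrow> 'a \<Rightarrow> 's) \<Rightarrow> nat \<Rightarrow> 'a \<Rightarrow> 's list" where
  "history X n \<omega> = map (\<lambda>i. X i \<omega>) [0..<Suc n]"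

lemma history_simps:
  "history X n \<omega> \<noteq> []" "length (history X n \<omega>) = Suc n" "last (history X n \<omega>) = X n \<omega>"
  "follows X (history X n \<omega>) \<omega>" "i \<le> n \<Longrightarrow> history X n \<omega> ! i = X i \<omega>"
  by (auto simp: history_def follows_def last_map simp del: upt_Suc)

lemma follows_eq_history: "follows X l \<omega> \<Longrightarrow> l \<noteq> [] \<Longrightarrow> l = history X (length l - 1) \<omega>"
  by (rule nth_equalityI) (auto simp: follows_def history_def simp del: upt_Suc)

context reflected_bins
begin

lemma X_pred_measurable [measurable]: "Measurable.pred M (\<lambda>\<omega>. P (X t \<omega>))"
  by (rule measurable_compose[OF X_measurable]) simp

lemma AE_total: "AE \<omega> in M. \<forall>t. t \<le> fst (X t \<omega>) + snd (X t \<omega>)"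
  using AE_moves
proof eventually_elim
  case (elim \<omega>)
  show ?case
  proof
    fix t show "t \<le> fst (X t \<omega>) + snd (X t \<omega>)"
    proof (induction t)
      case (Suc t)
      then show ?case using elim[rule_format, of t] by auto
    qed simp
  qed
qed

lemma AE_fst_at_top: "AE \<omega> in M. filterlim (\<lambda>t. fst (X t \<omega>)) at_top sequentially"
  using AE_total AE_domain
proof eventually_elim
  case (elim \<omega>)
  show ?case unfolding filterlim_at_top
  proof
    fix m :: nat
    obtain n :: nat where n: "real m + real m powr (1 / b) < real n" using reals_Archimedean2 by blast
    show "eventually (\<lambda>t. m \<le> fst (X t \<omega>)) sequentially" using eventually_ge_at_top[of n]
    proof eventually_elim
      case (elim t)
      obtain x y where xy: "X t \<omega> = (x, y)" by (cases "X t \<omega>")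
      show ?case
      proof (rule ccontr)
        assume "\<not> m \<le> fst (X t \<omega>)"
        then have x: "real x \<le> real m" using xy by simp
        have "real y powr b \<le> real m" using \<open>\<forall>t. X t \<omega> \<in> Q_sym a b\<close>[rule_format, of t] x xy by (simp add: Q_sym_def)
        then have "(real y powr b) powr (1 / b) \<le> real m powr (1 / b)" using b by (intro powr_mono2) auto
        then have "real y \<le> real m powr (1 / b)" using b by (simp add: powr_powr)
        moreover have "real n \<le> real x + real y"
          using \<open>\<forall>t. t \<le> fst (X t \<omega>) + snd (X t \<omega>)\<close>[rule_format, of t] elim xy by simp
        ultimately show False using n x by linarith
      qed
    qed
  qed
qed

lemma AE_notI_prob_le:
  assumes [measurable]: "Measurable.pred M P"
    and "\<And>e. 0 < e \<Longrightarrow> \<exists>Q. Measurable.pred M Q \<and> (\<forall>\<omega>\<in>space M. P \<omega> \<longrightarrow> Q \<omega>) \<and> prob {\<omega> \<in> space M. Q \<omega>} \<le> e"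
  shows "AE \<omega> in M. \<not> P \<omega>"
proof -
  have "prob {\<omega> \<in> space M. P \<omega>} \<le> 0"
  proof (rule field_le_epsilon)
    fix e :: real assume "0 < e"
    then obtain Q where [measurable]: "Measurable.pred M Q" and Q: "\<forall>\<omega>\<in>space M. P \<omega> \<longrightarrow> Q \<omega>"
      "prob {\<omega> \<in> space M. Q \<omega>} \<le> e" using assms(2) by blast
    have "prob {\<omega> \<in> space M. P \<omega>} \<le> prob {\<omega> \<in> space M. Q \<omega>}"
      using Q(1) by (intro finite_measure_mono) auto
    with Q(2) show "prob {\<omega> \<in> space M. P \<omega>} \<le> 0 + e" by simp
  qed
  then have "prob {\<omega> \<in> space M. P \<omega>} = 0" by (simp add: measure_le_0_iff)
  then show ?thesis by (subst (asm) prob_Collect_eq_0) auto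
qed

lemma AE_not_interior_forever: "AE \<omega> in M. \<exists>\<^sub>\<infinity>t. X t \<omega> \<notin> interior_set a b"
proof -
  have "AE \<omega> in M. \<forall>l. l \<noteq> [] \<longrightarrow> 8 \<le> fst (last l) + snd (last l) \<longrightarrow>
      \<not> (follows X l \<omega> \<and> (\<forall>m. X (length l - 1 + m) \<omega> \<in> interior_set a b))"
    unfolding AE_all_countable
  proof (intro allI)
    fix l :: "(nat \<times> nat) list"
    show "AE \<omega> in M. l \<noteq> [] \<longrightarrow> 8 \<le> fst (last l) + snd (last l) \<longrightarrow>
      \<not> (follows X l \<omega> \<and> (\<forall>m. X (length l - 1 + m) \<omega> \<in> interior_set a b))"
    proof (cases "l \<noteq> [] \<and> 8 \<le> fst (last l) + snd (last l)")
      case True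
      have "AE \<omega> in M. \<not> (follows X l \<omega> \<and> (\<forall>m. X (length l - 1 + m) \<omega> \<in> interior_set a b))"
      proof (rule AE_notI_prob_le)
        fix e :: real assume e: "0 < e"
        have "stay_forever a b \<beta> (last l) = 0" using stay_forever_eq_0[OF a(1) b(1) \<beta>] True by blast
        then have "(\<lambda>N. stay a b \<beta> N (last l)) \<longlonglongrightarrow> 0" using stay_tendsto[of a b \<beta> "last l"] by simp
        then have "eventually (\<lambda>N. stay a b \<beta> N (last l) < e) sequentially" using e by (rule order_tendstoD(2))
        then obtain N where N: "stay a b \<beta> N (last l) < e" by (auto simp: eventually_sequentially)
        have "prob {\<omega> \<in> space M. follows X l \<omega> \<and>
            stops_in (interior_set a b) (interior_set a b) N (\<lambda>i. X (length l - 1 + i) \<omega>)}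
          \<le> prob {\<omega> \<in> space M. follows X l \<omega>} * stay a b \<beta> N (last l)"
          using True by (intro prob_stops_in_le) auto
        also have "\<dots> \<le> 1 * stay a b \<beta> N (last l)" by (intro mult_right_mono stay_nonneg prob_le_1)
        finally have le: "prob {\<omega> \<in> space M. follows X l \<omega> \<and>
            stops_in (interior_set a b) (interior_set a b) N (\<lambda>i. X (length l - 1 + i) \<omega>)} \<le> e" using N by simp
        show "\<exists>Q. Measurable.pred M Q \<and> (\<forall>\<omega>\<in>space M. (follows X l \<omega> \<and> (\<forall>m. X (length l - 1 + m) \<omega> \<in> interior_set a b)) \<longrightarrow> Q \<omega>)
            \<and> prob {\<omega> \<in> space M. Q \<omega>} \<le> e"
          using le stops_in_stay[of _ "interior_set a b"]
          by (intro exI[of _ "\<lambda>\<omega>. follows X l \<omega> \<and> stops_in (interior_set a b) (interior_set a b) N (\<lambda>i. X (length l - 1 + i) \<omega>)"]) auto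
      qed measurable
      then show ?thesis by simp
    qed auto
  qed
  then show ?thesis using AE_total
  proof eventually_elim
    case (elim \<omega>)
    show ?case unfolding INFM_nat_le
    proof (rule ccontr)
      assume "\<not> (\<forall>m. \<exists>n\<ge>m. X n \<omega> \<notin> interior_set a b)"
      then obtain m where m: "\<forall>n\<ge>m. X n \<omega> \<in> interior_set a b" by auto
      (* After time 8 the sum of the coordinates is at least 8. *)
      define n where "n = max m 8"
      have "8 \<le> fst (X n \<omega>) + snd (X n \<omega>)" using elim(2)[rule_format, of n] by (simp add: n_def)
      then show False using elim(1)[rule_format, of "history X n \<omega>"] m
        by (auto simp: history_simps n_def)
    qed
  qed
qed

text \<open>
  The strong Markov property at the first visit to \<open>U\<close>. The paths that end with their first visit to \<open>U\<close> are
  countably many lists, none of which begins with another one, so the events of following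
  them are disjoint and their probabilities add up to at most \<open>1\<close>.
\<close>

lemma prob_after_hitting_le:
  assumes SR: "S \<inter> R = {}" and e: "\<And>u N. u \<in> U \<Longrightarrow> stop_prob a b \<beta> S R N u \<le> e" and e0: "0 \<le> e"
  shows "prob {\<omega> \<in> space M. \<exists>n. X n \<omega> \<in> U \<and> (\<forall>i<n. X i \<omega> \<notin> U) \<and> (\<exists>N. stops_in S R N (\<lambda>i. X (n + i) \<omega>))} \<le> e"
proof -
  (* The paths that end with their first visit to U. *)
  define F where "F = {l :: (nat \<times> nat) list. l \<noteq> [] \<and> last l \<in> U \<and> (\<forall>i<length l - 1. l ! i \<notin> U)}"
  define C where "C = (\<lambda>l. {\<omega> \<in> space M. follows X l \<omega>})"
  define A where "A = (\<lambda>l. {\<omega> \<in> space M. follows X l \<omega> \<and> (\<exists>N. stops_in S R N (\<lambda>i. X (length l - 1 + i) \<omega>))})"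
  have [measurable]: "C l \<in> sets M" "A l \<in> sets M" for l unfolding A_def C_def by measurable
  have disj: "disjoint_family_on C F"
  proof (unfold disjoint_family_on_def, intro ballI impI equals0I)
    fix l l' \<omega> assume l: "l \<in> F" "l' \<in> F" "l \<noteq> l'" "\<omega> \<in> C l \<inter> C l'"
    have "follows X l \<omega>" "follows X l' \<omega>" "l \<noteq> []" "l' \<noteq> []" using l by (auto simp: C_def F_def)
    note eq = follows_eq_history[OF this(1,3)] follows_eq_history[OF this(2,4)]
    have not_less: "\<not> length l - 1 < length l' - 1"
      if "l = history X (length l - 1) \<omega>" "l' = history X (length l' - 1) \<omega>" "l \<in> F" "l' \<in> F" for l l'
    proof
      assume less: "length l - 1 < length l' - 1"
      then have "l' ! (length l - 1) = X (length l - 1) \<omega>"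
        by (subst that(2)) (auto simp: history_simps)
      moreover have "last l = X (length l - 1) \<omega>" by (subst that(1)) (simp add: history_simps)
      ultimately show False using that(3,4) less by (auto simp: F_def)
    qed
    have "length l - 1 = length l' - 1" using not_less[OF eq l(1,2)] not_less[OF eq(2,1) l(2,1)] by linarith
    then show False using eq l(3) by metis
  qed
  have disjA: "disjoint_family_on A F"
    by (rule disjoint_family_on_bisimulation[OF disj]) (auto simp: A_def C_def)
  have "{\<omega> \<in> space M. \<exists>n. X n \<omega> \<in> U \<and> (\<forall>i<n. X i \<omega> \<notin> U) \<and> (\<exists>N. stops_in S R N (\<lambda>i. X (n + i) \<omega>))} \<subseteq> (\<Union>l\<in>F. A l)"
  proof
    fix \<omega> assume "\<omega> \<in> {\<omega> \<in> space M. \<exists>n. X n \<omega> \<in> U \<and> (\<forall>i<n. X i \<omega> \<notin> U) \<and> (\<exists>N. stops_in S R N (\<lambda>i. X (n + i) \<omega>))}"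
    then obtain n where n: "\<omega> \<in> space M" "X n \<omega> \<in> U" "\<forall>i<n. X i \<omega> \<notin> U" "\<exists>N. stops_in S R N (\<lambda>i. X (n + i) \<omega>)" by blast
    then have "history X n \<omega> \<in> F" "\<omega> \<in> A (history X n \<omega>)"
      by (auto simp: F_def A_def history_simps)
    then show "\<omega> \<in> (\<Union>l\<in>F. A l)" by blast
  qed
  then have "emeasure M {\<omega> \<in> space M. \<exists>n. X n \<omega> \<in> U \<and> (\<forall>i<n. X i \<omega> \<notin> U) \<and> (\<exists>N. stops_in S R N (\<lambda>i. X (n + i) \<omega>))}
      \<le> emeasure M (\<Union>l\<in>F. A l)"
    by (intro emeasure_mono sets.countable_UN') auto
  also have "\<dots> = (\<integral>\<^sup>+l. emeasure M (A l) \<partial>count_space F)"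
    using disjA by (intro emeasure_UN_countable) auto
  also have "\<dots> \<le> (\<integral>\<^sup>+l. ennreal e * emeasure M (C l) \<partial>count_space F)"
  proof (intro nn_integral_mono)
    fix l assume "l \<in> space (count_space F)"
    then have l: "l \<noteq> []" "last l \<in> U" by (auto simp: F_def)
    have "prob (A l) \<le> prob (C l) * e"
      unfolding A_def C_def by (rule prob_ever_stops_in_le[OF l(1) SR e[OF l(2)]])
    then show "emeasure M (A l) \<le> ennreal e * emeasure M (C l)"
      using e0 by (simp add: emeasure_eq_measure ennreal_mult''[symmetric] ennreal_leI mult.commute)
  qed
  also have "\<dots> = ennreal e * (\<integral>\<^sup>+l. emeasure M (C l) \<partial>count_space F)"
    by (intro nn_integral_cmult) simp
  also have "(\<integral>\<^sup>+l. emeasure M (C l) \<partial>count_space F) = emeasure M (\<Union>l\<in>F. C l)"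
    using disj by (intro emeasure_UN_countable[symmetric]) auto
  also have "ennreal e * emeasure M (\<Union>l\<in>F. C l) \<le> ennreal e * 1"
    by (intro mult_left_mono emeasure_le_1) auto
  finally show ?thesis using e0 by (simp add: emeasure_eq_measure)
qed

text \<open>
  After a reflection in a sufficiently far column, the probability of ever exceeding height \<open>k\<close> is at most
  \<open>e\<close>. If there are infinitely many reflections, then there is one in such a column, and exceeding height
  \<open>k\<close> infinitely often includes exceeding it after the first of these.
\<close>

lemma AE_height_bounded:
  assumes k: "1 < \<kappa> a \<beta> * real k"
  shows "AE \<omega> in M. (\<exists>\<^sub>\<infinity>t. at_lower a (X t \<omega>)) \<longrightarrow> (\<forall>\<^sub>\<infinity>t. snd (X t \<omega>) \<le> level a (fst (X t \<omega>)) + k)"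
proof -
  define S where "S = {(x, y). y \<le> level a x + k}"
  define good where "good = (\<lambda>\<omega>. (\<forall>t. level a (fst (X t \<omega>)) \<le> snd (X t \<omega>)) \<and> (\<forall>m. \<exists>n. \<forall>t\<ge>n. m \<le> fst (X t \<omega>)))"
  have good: "AE \<omega> in M. good \<omega>" using AE_domain AE_fst_at_top
  proof eventually_elim
    case (elim \<omega>)
    have "level a (fst (X t \<omega>)) \<le> snd (X t \<omega>)" for t
    proof -
      obtain x y where xy: "X t \<omega> = (x, y)" by (cases "X t \<omega>")
      have "1 \<le> x" "real x powr a \<le> real y" using elim(1)[rule_format, of t] xy by (auto simp: Q_sym_def)
      then have "real (level a x) < real y + 1"
        using level_bounds(1)[OF a(1), of x] powr_increment(3)[of "real x" a] a by simp
      then show ?thesis using xy by simp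
    qed
    then show ?case using elim(2) by (auto simp: good_def filterlim_at_top eventually_sequentially)
  qed
  define Bad where "Bad = (\<lambda>\<omega>. good \<omega> \<and> (\<forall>m. \<exists>t\<ge>m. at_lower a (X t \<omega>)) \<and> (\<forall>m. \<exists>t\<ge>m. X t \<omega> \<notin> S))"
  have [measurable]: "Measurable.pred M Bad" unfolding Bad_def good_def by measurable
  have "AE \<omega> in M. \<not> Bad \<omega>"
  proof (rule AE_notI_prob_le)
    fix e :: real assume e: "0 < e"
    obtain x1 where x1: "\<And>x N. x1 \<le> x \<Longrightarrow> stop_prob a b \<beta> S (- S) N (x, level a x) \<le> e"
      using reach_height_small[OF a b \<beta> k e] unfolding S_def eventually_sequentially by blast
    define U where "U = {(x, y). x1 \<le> x \<and> y = level a x}"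
    define Q where "Q = (\<lambda>\<omega>. \<exists>n. X n \<omega> \<in> U \<and> (\<forall>i<n. X i \<omega> \<notin> U) \<and> (\<exists>N. stops_in S (- S) N (\<lambda>i. X (n + i) \<omega>)))"
    have "prob {\<omega> \<in> space M. Q \<omega>} \<le> e"
      unfolding Q_def using x1 e by (intro prob_after_hitting_le) (auto simp: U_def)
    moreover have "Q \<omega>" if Bad: "Bad \<omega>" for \<omega>
    proof -
      have "\<forall>m. \<exists>n. \<forall>t\<ge>n. m \<le> fst (X t \<omega>)" using Bad by (simp add: Bad_def good_def)
      then obtain n where n: "\<forall>t\<ge>n. x1 \<le> fst (X t \<omega>)" by blast
      obtain t where t: "n \<le> t" "at_lower a (X t \<omega>)" using Bad by (auto simp: Bad_def)
      have "X t \<omega> \<in> U"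
      proof -
        obtain x y where xy: "X t \<omega> = (x, y)" by (cases "X t \<omega>")
        have "level a x \<le> y" using Bad xy by (auto simp: Bad_def good_def dest!: spec[of _ t])
        moreover have "y \<le> level a x" using t(2) xy at_lower_iff_level[OF a(1)] by simp
        ultimately show ?thesis using n t(1) xy by (auto simp: U_def dest!: spec[of _ t])
      qed
      then obtain n' where n': "X n' \<omega> \<in> U" "\<forall>i<n'. X i \<omega> \<notin> U"
        using exists_least_iff[of "\<lambda>n. X n \<omega> \<in> U"] by blast
      obtain t' where "n' \<le> t'" "X t' \<omega> \<notin> S" using Bad by (auto simp: Bad_def)
      then have "X (n' + (t' - n')) \<omega> \<notin> S" by simp
      then have "\<exists>N. stops_in S (- S) N (\<lambda>i. X (n' + i) \<omega>)" by (intro stops_inI) auto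
      with n' show ?thesis by (auto simp: Q_def)
    qed
    moreover have "Measurable.pred M Q" unfolding Q_def by measurable
    ultimately show "\<exists>Q. Measurable.pred M Q \<and> (\<forall>\<omega>\<in>space M. Bad \<omega> \<longrightarrow> Q \<omega>) \<and> prob {\<omega> \<in> space M. Q \<omega>} \<le> e"
      by blast
  qed measurable
  then show ?thesis using good
  proof eventually_elim
    case (elim \<omega>)
    show ?case
    proof
      assume "\<exists>\<^sub>\<infinity>t. at_lower a (X t \<omega>)"
      then have "\<not> (\<forall>m. \<exists>t\<ge>m. X t \<omega> \<notin> S)" using elim by (auto simp: Bad_def INFM_nat_le)
      then obtain m where "\<forall>t\<ge>m. X t \<omega> \<in> S" by auto
      then show "\<forall>\<^sub>\<infinity>t. snd (X t \<omega>) \<le> level a (fst (X t \<omega>)) + k"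
        unfolding MOST_nat_le by (intro exI[of _ m]) (auto simp: S_def split: prod.splits)
    qed
  qed
qed

text \<open>
  All columns and hence all levels are reached eventually, and the probability of passing through all
  levels without a visit to \<open>high\<close> is \<open>0\<close> after any given finite path. Paths that leave the
  neighbourhood of the lower boundary are covered, since they are in \<open>high\<close> all the more.
\<close>

lemma AE_high_infinitely_often:
  assumes k: "\<kappa> a \<beta> * (real k - 1) \<le> 1" "1 \<le> k" and \<epsilon>: "0 < \<epsilon>" "\<epsilon> < 1"
  shows "AE \<omega> in M. \<exists>\<^sub>\<infinity>t. X t \<omega> \<in> high a k \<epsilon>"
proof -
  define S where "S = (\<lambda>W. {(x, y). (x, y) \<notin> high a k \<epsilon> \<and> level a x < W})"
  define R where "R = (\<lambda>W. {(x, y). (x, y) \<notin> high a k \<epsilon> \<and> W \<le> level a x})"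
  obtain x0 where x0: "\<And>x y \<eta>. x0 \<le> x \<Longrightarrow> level a x \<le> y \<Longrightarrow> 0 < \<eta> \<Longrightarrow>
      \<exists>W. \<forall>N. stop_prob a b \<beta> (S W) (R W) N (x, y) \<le> \<eta>"
    using avoid_high_small[OF a b \<beta> \<epsilon> k] unfolding S_def R_def eventually_sequentially by meson
  define E where "E = (\<lambda>l \<omega>. follows X l \<omega> \<and> (\<forall>m. X (length l - 1 + m) \<omega> \<notin> high a k \<epsilon>) \<and>
      (\<forall>W. \<exists>m. W \<le> level a (fst (X (length l - 1 + m) \<omega>))))"
  have [measurable]: "Measurable.pred M (E l)" for l unfolding E_def by measurable
  have "AE \<omega> in M. \<forall>l. l \<noteq> [] \<longrightarrow> x0 \<le> fst (last l) \<longrightarrow> level a (fst (last l)) \<le> snd (last l) \<longrightarrow> \<not> E l \<omega>"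
    unfolding AE_all_countable
  proof (intro allI)
    fix l :: "(nat \<times> nat) list"
    show "AE \<omega> in M. l \<noteq> [] \<longrightarrow> x0 \<le> fst (last l) \<longrightarrow> level a (fst (last l)) \<le> snd (last l) \<longrightarrow> \<not> E l \<omega>"
    proof (cases "l \<noteq> [] \<and> x0 \<le> fst (last l) \<and> level a (fst (last l)) \<le> snd (last l)")
      case True
      have "AE \<omega> in M. \<not> E l \<omega>"
      proof (rule AE_notI_prob_le)
        fix e :: real assume e: "0 < e"
        obtain W where W: "\<And>N. stop_prob a b \<beta> (S W) (R W) N (last l) \<le> e"
          using x0[of "fst (last l)" "snd (last l)", OF _ _ e] True by auto
        define Q where "Q = (\<lambda>\<omega>. follows X l \<omega> \<and> (\<exists>N. stops_in (S W) (R W) N (\<lambda>i. X (length l - 1 + i) \<omega>)))"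
        have [measurable]: "Measurable.pred M Q" unfolding Q_def by measurable
        have "prob {\<omega> \<in> space M. Q \<omega>} \<le> prob {\<omega> \<in> space M. follows X l \<omega>} * e"
          unfolding Q_def using True W by (intro prob_ever_stops_in_le) (auto simp: S_def R_def)
        also have "\<dots> \<le> 1 * e" using e by (intro mult_right_mono prob_le_1) auto
        finally have "prob {\<omega> \<in> space M. Q \<omega>} \<le> e" by simp
        moreover have "Q \<omega>" if E: "E l \<omega>" for \<omega>
        proof -
          obtain m where m: "W \<le> level a (fst (X (length l - 1 + m) \<omega>))" using E by (auto simp: E_def)
          have "\<exists>N. stops_in (S W) (R W) N (\<lambda>i. X (length l - 1 + i) \<omega>)"
          proof (rule stops_inI)
            show "X (length l - 1 + m) \<omega> \<notin> S W" using m by (auto simp: S_def split: prod.splits)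
            show "\<forall>i\<le>m. X (length l - 1 + i) \<omega> \<in> S W \<union> R W"
            proof (intro allI impI)
              fix i
              have "X (length l - 1 + i) \<omega> \<notin> high a k \<epsilon>" using E by (simp add: E_def)
              then show "X (length l - 1 + i) \<omega> \<in> S W \<union> R W"
                by (cases "X (length l - 1 + i) \<omega>") (auto simp: S_def R_def)
            qed
          qed
          then show ?thesis using E by (simp add: Q_def E_def)
        qed
        ultimately show "\<exists>Q. Measurable.pred M Q \<and> (\<forall>\<omega>\<in>space M. E l \<omega> \<longrightarrow> Q \<omega>) \<and> prob {\<omega> \<in> space M. Q \<omega>} \<le> e"
          by (intro exI[of _ Q]) auto
      qed measurable
      then show ?thesis by simp
    qed auto
  qed
  then show ?thesis using AE_domain AE_fst_at_top
  proof eventually_elim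
    case (elim \<omega>)
    show ?case unfolding INFM_nat_le
    proof (rule ccontr)
      assume "\<not> (\<forall>m. \<exists>n\<ge>m. X n \<omega> \<in> high a k \<epsilon>)"
      then obtain m where m: "\<forall>n\<ge>m. X n \<omega> \<notin> high a k \<epsilon>" by auto
      obtain m' where m': "\<forall>n\<ge>m'. x0 \<le> fst (X n \<omega>)"
        using elim(3) by (auto simp: filterlim_at_top eventually_sequentially)
      define n where "n = max m m'"
      obtain x y where xy: "X n \<omega> = (x, y)" by (cases "X n \<omega>")
      have "1 \<le> x" "real x powr a \<le> real y" using elim(2)[rule_format, of n] xy by (auto simp: Q_sym_def)
      then have "real (level a x) < real y + 1"
        using level_bounds(1)[OF a(1), of x] powr_increment(3)[of "real x" a] a by simp
      then have "level a x \<le> y" by simp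
      moreover have "x0 \<le> x" using m' xy by (auto simp: n_def dest!: spec[of _ n])
      ultimately have "\<not> E (history X n \<omega>) \<omega>"
        using elim(1)[rule_format, of "history X n \<omega>"] xy by (simp add: history_simps)
      moreover have "\<exists>m. W \<le> level a (fst (X (n + m) \<omega>))" for W
      proof -
        have "filterlim (\<lambda>t. level a (fst (X t \<omega>))) at_top sequentially"
          using filterlim_compose[OF level_filterlim[OF a(1)] elim(3)] .
        then obtain t where "\<forall>s\<ge>t. W \<le> level a (fst (X s \<omega>))"
          by (auto simp: filterlim_at_top eventually_sequentially)
        then show ?thesis by (intro exI[of _ t]) simp
      qed
      ultimately show False using m by (auto simp: E_def history_simps n_def)
    qed
  qed
qed

end

text \<open>
  Up to \<open>(x + 1)\<^sup>a - x\<^sup>a\<close>, which tends to \<open>0\<close>, a bound \<open>k\<close> for the height is a bound for \<open>y - x\<^sup>a\<close>,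
  and at the times of reflection \<open>y - x\<^sup>a\<close> lies between \<open>0\<close> and this difference.
\<close>

lemma event_AI:
  assumes a: "0 < a" "a < 1"
    and top: "filterlim (\<lambda>t. fst (z t)) at_top sequentially"
    and dom: "\<And>t. real (fst (z t)) powr a \<le> real (snd (z t))"
    and low: "\<exists>\<^sub>\<infinity>t. at_lower a (z t)"
    and upper: "\<forall>\<^sub>\<infinity>t. snd (z t) \<le> level a (fst (z t)) + k"
    and high: "\<And>m::nat. 2 \<le> m \<Longrightarrow> \<exists>\<^sub>\<infinity>t. z t \<in> high a k (1 / real m)"
  shows "z \<in> event_A a (int k)"
proof -
  define D where "D = (\<lambda>t. real (snd (z t)) - real (fst (z t)) powr a)"
  define g where "g = (\<lambda>x::nat. (real x + 1) powr a - real x powr a)"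
  have "g \<longlonglongrightarrow> 0" unfolding g_def using a by real_asymp
  then have g: "(\<lambda>t. g (fst (z t))) \<longlonglongrightarrow> 0" using top by (rule filterlim_compose)
  have "limsup (\<lambda>t. ereal (D t)) \<le> ereal (real k)"
  proof -
    have "eventually (\<lambda>t. ereal (D t) \<le> ereal (real k + g (fst (z t)))) sequentially"
      using upper unfolding cofinite_eq_sequentially
    proof eventually_elim
      case (elim t)
      then have "real (snd (z t)) \<le> real (level a (fst (z t))) + real k" by linarith
      then show ?case using level_bounds(1)[OF a(1), of "fst (z t)"] by (simp add: D_def g_def)
    qed
    then have "limsup (\<lambda>t. ereal (D t)) \<le> limsup (\<lambda>t. ereal (real k + g (fst (z t))))" by (rule Limsup_mono)
    also have "(\<lambda>t. real k + g (fst (z t))) \<longlonglongrightarrow> real k + 0" by (intro tendsto_intros g)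
    then have "limsup (\<lambda>t. ereal (real k + g (fst (z t)))) = ereal (real k)"
      by (intro lim_imp_Limsup) auto
    finally show ?thesis .
  qed
  moreover have "ereal (real k) \<le> limsup (\<lambda>t. ereal (D t))"
  proof (rule ccontr)
    assume "\<not> ereal (real k) \<le> limsup (\<lambda>t. ereal (D t))"
    then obtain c :: real where c: "limsup (\<lambda>t. ereal (D t)) < ereal c" "ereal c < ereal (real k)"
      using ereal_dense2[of "limsup (\<lambda>t. ereal (D t))" "ereal (real k)"] by (auto simp: not_le)
    obtain m :: nat where m: "1 / (real k - c) < real m" using reals_Archimedean2 by blast
    define m' where "m' = max m 2"
    have "1 / (real k - c) < real m'" using m by (simp add: m'_def)
    then have mc: "c < real k - 1 / real m'" using c(2) by (simp add: m'_def field_simps)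
    have "eventually (\<lambda>t. ereal (D t) < ereal c) sequentially" using c(1) by (rule Limsup_lessD)
    then have "\<forall>\<^sub>\<infinity>t. D t < c" by (simp add: cofinite_eq_sequentially)
    moreover have "\<exists>\<^sub>\<infinity>t. z t \<in> high a k (1 / real m')" by (rule high) (simp add: m'_def)
    ultimately have "\<exists>\<^sub>\<infinity>t. z t \<in> high a k (1 / real m') \<and> D t < c" by (rule frequently_eventually_frequently[rotated])
    then obtain t where "z t \<in> high a k (1 / real m')" "D t < c" by (auto dest: INFM_EX)
    with mc show False by (auto simp: high_def D_def split: prod.splits)
  qed
  ultimately have sup: "limsup (\<lambda>t. ereal (D t)) = ereal (real k)" by (rule antisym)
  have "0 \<le> liminf (\<lambda>t. ereal (D t))"
    using dom by (intro Liminf_bounded always_eventually) (simp add: D_def)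
  moreover have "liminf (\<lambda>t. ereal (D t)) \<le> 0"
  proof (rule ccontr)
    assume "\<not> liminf (\<lambda>t. ereal (D t)) \<le> 0"
    then obtain c :: real where c: "0 < c" "ereal c < liminf (\<lambda>t. ereal (D t))"
      using ereal_dense2[of 0 "liminf (\<lambda>t. ereal (D t))"] by (auto simp: not_le)
    have "eventually (\<lambda>t. ereal c < ereal (D t)) sequentially" using c(2) by (rule less_LiminfD)
    moreover have "eventually (\<lambda>t. g (fst (z t)) < c) sequentially" using g c(1) by (rule order_tendstoD(2))
    ultimately have "\<forall>\<^sub>\<infinity>t. c < D t \<and> g (fst (z t)) < c"
      unfolding cofinite_eq_sequentially by eventually_elim simp
    with low have "\<exists>\<^sub>\<infinity>t. at_lower a (z t) \<and> (c < D t \<and> g (fst (z t)) < c)" by (rule frequently_eventually_frequently)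
    then obtain t where "at_lower a (z t)" "c < D t" "g (fst (z t)) < c" by (auto dest: INFM_EX)
    then show False by (auto simp: at_lower_def D_def g_def split: prod.splits)
  qed
  ultimately have "liminf (\<lambda>t. ereal (D t)) = 0" by (rule antisym[rotated])
  with sup show ?thesis by (simp add: event_A_def D_def)
qed

lemma (in reflected_bins) AE_event_A:
  assumes k: "\<kappa> a \<beta> * (real k - 1) \<le> 1" "1 < \<kappa> a \<beta> * real k"
  shows "AE \<omega> in M. (\<exists>\<^sub>\<infinity>t. at_lower a (X t \<omega>)) \<longrightarrow> (\<lambda>t. X t \<omega>) \<in> event_A a (int k)"
proof -
  have k1: "1 \<le> k" using k(2) by (cases k) auto
  have "AE \<omega> in M. \<forall>m::nat. 2 \<le> m \<longrightarrow> (\<exists>\<^sub>\<infinity>t. X t \<omega> \<in> high a k (1 / real m))"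
    unfolding AE_all_countable
  proof
    fix m :: nat
    show "AE \<omega> in M. 2 \<le> m \<longrightarrow> (\<exists>\<^sub>\<infinity>t. X t \<omega> \<in> high a k (1 / real m))"
      using AE_high_infinitely_often[OF k(1) k1, of "1 / real m"] by (cases "2 \<le> m") auto
  qed
  then show ?thesis using AE_height_bounded[OF k(2)] AE_domain AE_fst_at_top
  proof eventually_elim
    case (elim \<omega>)
    show ?case
    proof
      assume "\<exists>\<^sub>\<infinity>t. at_lower a (X t \<omega>)"
      then show "(\<lambda>t. X t \<omega>) \<in> event_A a (int k)"
        using elim by (intro event_AI a) (auto simp: Q_sym_def split: prod.splits)
    qed
  qed
qed

section \<open>From the model to the symmetric chain, and the theorem\<close>

lemma Q_sym_swap: "prod.swap u \<in> Q_sym b a \<longleftrightarrow> u \<in> Q_sym a b"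
  by (cases u) (auto simp: Q_sym_def at_upper_def)

lemma mean_step_swap:
  assumes "u \<in> Q_sym a b"
  shows "mean_step b a \<beta> f (prod.swap u) = mean_step a b \<beta> (\<lambda>v. f (prod.swap v)) u"
proof -
  obtain x y where u: "u = (x, y)" by (cases u)
  have "1 \<le> x" "1 \<le> y" using assms u by (auto simp: Q_sym_def)
  then have "0 < real x powr \<beta> + real y powr \<beta>" by (intro add_pos_pos) auto
  then have up: "up_prob \<beta> y x = 1 - up_prob \<beta> x y" by (simp add: up_prob_def field_simps)
  have "\<not> (at_lower a (x, y) \<and> at_upper b (x, y))" using assms u by (simp add: Q_sym_def)
  moreover have "at_lower b (y, x) = at_upper b (x, y)" "at_upper a (y, x) = at_lower a (x, y)"
    by (simp_all add: at_upper_def)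
  ultimately show ?thesis unfolding u by (auto simp: mean_step_def up)
qed

text \<open>
  At a state of both boundary types \<open>mean_step\<close> prefers the lower boundary and is not
  symmetric, but paths through such a state have probability \<open>0\<close>.
\<close>

lemma (in reflected_bins) reflected_bins_swap:
  "reflected_bins M (\<lambda>t \<omega>. prod.swap (X t \<omega>)) b a \<beta>"
proof (unfold_locales)
  show "(\<lambda>\<omega>. prod.swap (X t \<omega>)) \<in> measurable M (count_space UNIV)" for t
    by (rule measurable_compose[OF X_measurable]) simp
  show "AE \<omega> in M. \<forall>t. prod.swap (X t \<omega>) \<in> Q_sym b a"
    using AE_domain by (simp add: Q_sym_swap)
  show "AE \<omega> in M. \<forall>t. prod.swap (X (Suc t) \<omega>) = (fst (prod.swap (X t \<omega>)) + 1, snd (prod.swap (X t \<omega>))) \<or>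
      prod.swap (X (Suc t) \<omega>) = (fst (prod.swap (X t \<omega>)), snd (prod.swap (X t \<omega>)) + 1)"
    using AE_moves by eventually_elim (auto simp: prod_eq_iff)
next
  have fol: "follows (\<lambda>t \<omega>. prod.swap (X t \<omega>)) l = follows X (map prod.swap l)" for l
    by (auto simp: follows_def fun_eq_iff) (metis swap_swap)+
  fix l :: "(nat \<times> nat) list" and v
  assume l: "l \<noteq> []"
  define l' where "l' = map prod.swap l"
  have l': "l' \<noteq> []" "last l' = prod.swap (last l)" using l by (auto simp: l'_def last_map)
  show "prob {\<omega> \<in> space M. follows (\<lambda>t \<omega>. prod.swap (X t \<omega>)) (l @ [v]) \<omega>} =
      prob {\<omega> \<in> space M. follows (\<lambda>t \<omega>. prod.swap (X t \<omega>)) l \<omega>} * mean_step b a \<beta> (indicator {v}) (last l)"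
  proof (cases "last l' \<in> Q_sym a b")
    case True
    have "mean_step b a \<beta> (indicator {v}) (prod.swap (last l')) =
        mean_step a b \<beta> (\<lambda>u. indicator {v} (prod.swap u)) (last l')"
      by (rule mean_step_swap[OF True])
    also have "(\<lambda>u. indicator {v} (prod.swap u)) = (indicator {prod.swap v} :: nat \<times> nat \<Rightarrow> real)"
      by (auto simp: indicator_def fun_eq_iff prod_eq_iff)
    finally show ?thesis using prob_snoc[OF l'(1), of "prod.swap v"] l'(2) by (simp add: fol l'_def)
  next
    case False
    have "AE \<omega> in M. \<not> follows X l' \<omega>" using AE_domain
    proof eventually_elim
      case (elim \<omega>)
      show ?case
      proof
        assume "follows X l' \<omega>"
        then have "X (length l' - 1) \<omega> = last l'" using l'(1) by (simp add: follows_def last_conv_nth)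
        with elim[rule_format, of "length l' - 1"] False show False by simp
      qed
    qed
    then have 0: "prob {\<omega> \<in> space M. follows X l' \<omega>} = 0" by (subst prob_Collect_eq_0) auto
    moreover have "prob {\<omega> \<in> space M. follows X (l' @ [prod.swap v]) \<omega>} \<le> prob {\<omega> \<in> space M. follows X l' \<omega>}"
      by (intro finite_measure_mono) (auto simp: follows_snoc)
    ultimately have "prob {\<omega> \<in> space M. follows X (l' @ [prod.swap v]) \<omega>} = 0" by (simp add: measure_le_0_iff)
    with 0 show ?thesis by (simp add: fol l'_def)
  qed
qed (use a b \<beta> in auto)

lemma le_powr_iff_root_le:
  fixes p q g :: real
  assumes "0 \<le> p" "0 \<le> q" "0 < g"
  shows "p \<le> q powr g \<longleftrightarrow> p powr (1 / g) \<le> q"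
proof
  assume "p \<le> q powr g"
  then have "p powr (1 / g) \<le> (q powr g) powr (1 / g)" using assms by (intro powr_mono2) auto
  then show "p powr (1 / g) \<le> q" using assms by (simp add: powr_powr)
next
  assume "p powr (1 / g) \<le> q"
  then have "(p powr (1 / g)) powr g \<le> q powr g" using assms by (intro powr_mono2) auto
  then show "p \<le> q powr g" using assms by (simp add: powr_powr)
qed

lemma reflecting_iff:
  assumes "(x, y) \<in> Q_domain (\<lambda>x. x powr \<alpha>) (\<lambda>x. x powr \<gamma>)" and "1 < \<gamma>"
  shows "lower_reflecting (\<lambda>x. x powr \<alpha>) (x, y) \<longleftrightarrow> at_lower \<alpha> (x, y)"
    and "upper_reflecting (\<lambda>x. x powr \<gamma>) (x, y) \<longleftrightarrow> at_upper (1 / \<gamma>) (x, y)"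
    and "interior_state (\<lambda>x. x powr \<alpha>) (\<lambda>x. x powr \<gamma>) (x, y) \<longleftrightarrow> \<not> at_lower \<alpha> (x, y) \<and> \<not> at_upper (1 / \<gamma>) (x, y)"
proof -
  have "real y + 1 \<le> real x powr \<gamma> \<longleftrightarrow> (real y + 1) powr (1 / \<gamma>) \<le> real x"
    using assms by (intro le_powr_iff_root_le) auto
  then show "lower_reflecting (\<lambda>x. x powr \<alpha>) (x, y) \<longleftrightarrow> at_lower \<alpha> (x, y)"
    and "upper_reflecting (\<lambda>x. x powr \<gamma>) (x, y) \<longleftrightarrow> at_upper (1 / \<gamma>) (x, y)"
    and "interior_state (\<lambda>x. x powr \<alpha>) (\<lambda>x. x powr \<gamma>) (x, y) \<longleftrightarrow> \<not> at_lower \<alpha> (x, y) \<and> \<not> at_upper (1 / \<gamma>) (x, y)"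
    using assms by (auto simp: Q_domain_def lower_reflecting_def upper_reflecting_def interior_state_def
        at_lower_def at_upper_def)
qed

lemma pmf_bins_step:
  assumes dom: "u \<in> Q_domain (\<lambda>x. x powr \<alpha>) (\<lambda>x. x powr \<gamma>)" and "1 < \<gamma>"
  shows "pmf (bins_step (\<lambda>x. x powr \<alpha>) (\<lambda>x. x powr \<gamma>) \<beta> \<beta> u) v
       = mean_step \<alpha> (1 / \<gamma>) \<beta> (indicator {v}) u"
proof -
  obtain x y where u: "u = (x, y)" by (cases u)
  have dom': "(x, y) \<in> Q_domain (\<lambda>x. x powr \<alpha>) (\<lambda>x. x powr \<gamma>)" using dom u by simp
  note iff = reflecting_iff[OF dom' \<open>1 < \<gamma>\<close>]
  have pos: "0 < real x powr \<beta> + real y powr \<beta>"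
    using dom' by (intro add_pos_pos) (auto simp: Q_domain_def)
  show ?thesis
  proof (cases "at_lower \<alpha> (x, y) \<or> at_upper (1 / \<gamma>) (x, y)")
    case True
    then show ?thesis unfolding u by (auto simp: bins_step_def mean_step_def iff indicator_def)
  next
    case False
    define p where "p = real x powr \<beta> / (real x powr \<beta> + real y powr \<beta>)"
    have p: "0 \<le> p" "p \<le> 1" using pos by (auto simp: p_def)
    have up: "up_prob \<beta> x y = 1 - p" using pos by (simp add: up_prob_def p_def field_simps)
    let ?f = "\<lambda>b. if b then (x + 1, y) else (x, y + 1)"
    have step: "bins_step (\<lambda>x. x powr \<alpha>) (\<lambda>x. x powr \<gamma>) \<beta> \<beta> (x, y) = map_pmf ?f (bernoulli_pmf p)"
      using False by (simp add: bins_step_def iff p_def)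
    have inj: "inj ?f" by (auto simp: inj_def)
    have "pmf (map_pmf ?f (bernoulli_pmf p)) v = p * indicator {v} (x + 1, y) + (1 - p) * indicator {v} (x, y + 1)"
    proof (cases "v \<in> range ?f")
      case True
      then obtain b where b: "v = ?f b" by blast
      have "pmf (map_pmf ?f (bernoulli_pmf p)) v = pmf (bernoulli_pmf p) b"
        unfolding b by (rule pmf_map_inj'[OF inj])
      also have "\<dots> = (if b then p else 1 - p)" using p by simp
      finally show ?thesis by (auto simp: b indicator_def)
    next
      case out: False
      then have "v \<noteq> ?f True" "v \<noteq> ?f False" by blast+
      moreover have "pmf (map_pmf ?f (bernoulli_pmf p)) v = 0"
        using out by (intro pmf_map_outside) auto
      ultimately show ?thesis by (auto simp: indicator_def)
    qed
    then show ?thesis using False unfolding u step by (simp add: mean_step_def up)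
  qed
qed

text \<open>
  Almost surely every initial segment of the path has positive probability. By induction along the
  path all its states are then reachable, so they lie in the domain and are not of both
  boundary types.
\<close>

lemma balls_in_bins_reflected_bins:
  assumes "1 < \<beta>" "0 < \<alpha>" "\<alpha> < 1" "1 < \<gamma>"
    and bins: "balls_in_bins M \<zeta> (\<lambda>x. x powr \<alpha>) (\<lambda>x. x powr \<gamma>) \<beta> \<beta> s"
  shows "reflected_bins M \<zeta> \<alpha> (1 / \<gamma>) \<beta>"
proof -
  define K where "K = bins_step (\<lambda>x. x powr \<alpha>) (\<lambda>x. x powr \<gamma>) \<beta> \<beta>"
  have s: "s \<in> Q_domain (\<lambda>x. x powr \<alpha>) (\<lambda>x. x powr \<gamma>)"
    and wd: "\<And>r. (\<lambda>u v. v \<in> set_pmf (K u))\<^sup>*\<^sup>* s r \<Longrightarrow>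
        \<not> (lower_reflecting (\<lambda>x. x powr \<alpha>) r \<and> upper_reflecting (\<lambda>x. x powr \<gamma>) r)"
    and chain: "markov_chain_from M \<zeta> K s"
    using bins by (auto simp: balls_in_bins_def well_defined_from_def K_def)
  interpret prob_space M using chain by (simp add: markov_chain_from_def)
  have meas [measurable]: "\<zeta> t \<in> measurable M (count_space UNIV)" for t
    using chain by (simp add: markov_chain_from_def)
  have fol_meas [measurable]: "Measurable.pred M (follows \<zeta> l)" for l
    unfolding follows_def by measurable
  have start: "AE \<omega> in M. \<zeta> 0 \<omega> = s" using chain by (simp add: markov_chain_from_def)
  have trans: "prob {\<omega> \<in> space M. follows \<zeta> (l @ [v]) \<omega>} = prob {\<omega> \<in> space M. follows \<zeta> l \<omega>} * pmf (K (last l)) v"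
    if l: "l \<noteq> []" and pos: "0 < prob {\<omega> \<in> space M. follows \<zeta> l \<omega>}" for l v
  proof -
    define n where "n = length l - 1"
    have len: "length l = Suc n" using l by (simp add: n_def)
    have f: "follows \<zeta> l \<omega> \<longleftrightarrow> (\<forall>i\<le>n. \<zeta> i \<omega> = l ! i)" for \<omega>
      by (auto simp: follows_def len less_Suc_eq_le)
    have "cond_prob M (\<lambda>\<omega>. \<zeta> (Suc n) \<omega> = v) (\<lambda>\<omega>. \<forall>i\<le>n. \<zeta> i \<omega> = l ! i) = pmf (K (l ! n)) v"
      using chain pos unfolding markov_chain_from_def f by blast
    moreover have "l ! n = last l" using l by (simp add: n_def last_conv_nth)
    ultimately have "cond_prob M (\<lambda>\<omega>. \<zeta> (Suc n) \<omega> = v) (follows \<zeta> l) = pmf (K (last l)) v"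
      by (simp add: f[abs_def, symmetric] flip: f)
    then have "prob {\<omega> \<in> space M. \<zeta> (Suc n) \<omega> = v \<and> follows \<zeta> l \<omega>} = prob {\<omega> \<in> space M. follows \<zeta> l \<omega>} * pmf (K (last l)) v"
      using pos by (simp add: cond_prob_def field_simps)
    moreover have "{\<omega> \<in> space M. \<zeta> (Suc n) \<omega> = v \<and> follows \<zeta> l \<omega>} = {\<omega> \<in> space M. follows \<zeta> (l @ [v]) \<omega>}"
      by (auto simp: follows_snoc len)
    ultimately show ?thesis by simp
  qed
  have mono: "prob {\<omega> \<in> space M. follows \<zeta> (l @ [v]) \<omega>} \<le> prob {\<omega> \<in> space M. follows \<zeta> l \<omega>}" for l v
    by (intro finite_measure_mono) (auto simp: follows_snoc)
  have snoc_pos: "0 < prob {\<omega> \<in> space M. follows \<zeta> l \<omega>} \<and> v \<in> set_pmf (K (last l))"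
    if l: "l \<noteq> []" and pos: "0 < prob {\<omega> \<in> space M. follows \<zeta> (l @ [v]) \<omega>}" for l v
  proof -
    have p: "0 < prob {\<omega> \<in> space M. follows \<zeta> l \<omega>}" using mono[of l v] pos by linarith
    with trans[OF l p, of v] pos show ?thesis by (auto simp: set_pmf_iff)
  qed
  have domain_step: "(x', y') \<in> Q_domain (\<lambda>x. x powr \<alpha>) (\<lambda>x. x powr \<gamma>) \<and> ((x', y') = (x + 1, y) \<or> (x', y') = (x, y + 1))"
    if dom: "(x, y) \<in> Q_domain (\<lambda>x. x powr \<alpha>) (\<lambda>x. x powr \<gamma>)"
      and no: "\<not> (lower_reflecting (\<lambda>x. x powr \<alpha>) (x, y) \<and> upper_reflecting (\<lambda>x. x powr \<gamma>) (x, y))"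
      and step: "(x', y') \<in> set_pmf (K (x, y))" for x y x' y'
  proof -
    have mono: "real x powr \<gamma> \<le> (1 + real x) powr \<gamma>" using assms by (intro powr_mono2) auto
    have cases: "((x', y') = (x + 1, y) \<and> \<not> lower_reflecting (\<lambda>x. x powr \<alpha>) (x, y)) \<or>
                 ((x', y') = (x, y + 1) \<and> \<not> upper_reflecting (\<lambda>x. x powr \<gamma>) (x, y))"
      using step no reflecting_iff[OF dom \<open>1 < \<gamma>\<close>]
      by (auto simp: K_def bins_step_def split: if_splits)
    then show ?thesis
      using dom mono by (auto simp: Q_domain_def lower_reflecting_def upper_reflecting_def add.commute)
  qed
  have reach: "last l \<in> Q_domain (\<lambda>x. x powr \<alpha>) (\<lambda>x. x powr \<gamma>) \<and> (\<lambda>u v. v \<in> set_pmf (K u))\<^sup>*\<^sup>* s (last l)"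
    if "l \<noteq> []" "0 < prob {\<omega> \<in> space M. follows \<zeta> l \<omega>}" for l
    using that
  proof (induction l rule: rev_induct)
    case (snoc v l)
    show ?case
    proof (cases "l = []")
      case True
      have "v = s"
      proof (rule ccontr)
        assume neq: "v \<noteq> s"
        have "AE \<omega> in M. \<not> follows \<zeta> (l @ [v]) \<omega>"
          using start by eventually_elim (use neq in \<open>auto simp: True follows_def\<close>)
        then have "prob {\<omega> \<in> space M. follows \<zeta> (l @ [v]) \<omega>} = 0" by (subst prob_Collect_eq_0) auto
        with snoc.prems show False by simp
      qed
      with True s show ?thesis by simp
    next
      case False
      from snoc_pos[OF False snoc.prems(2)] snoc.IH[OF False]
      have IH: "last l \<in> Q_domain (\<lambda>x. x powr \<alpha>) (\<lambda>x. x powr \<gamma>)" "(\<lambda>u v. v \<in> set_pmf (K u))\<^sup>*\<^sup>* s (last l)"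
        and v: "v \<in> set_pmf (K (last l))" by auto
      have "v \<in> Q_domain (\<lambda>x. x powr \<alpha>) (\<lambda>x. x powr \<gamma>)"
        using domain_step[of "fst (last l)" "snd (last l)" "fst v" "snd v"] IH wd[OF IH(2)] v by simp
      then show ?thesis using IH(2) v by (auto intro: rtranclp.rtrancl_into_rtrancl)
    qed
  qed simp
  have good: "last l \<in> Q_sym \<alpha> (1 / \<gamma>)" if "l \<noteq> []" "0 < prob {\<omega> \<in> space M. follows \<zeta> l \<omega>}" for l
  proof -
    obtain x y where xy: "last l = (x, y)" by (cases "last l")
    have dom: "(x, y) \<in> Q_domain (\<lambda>x. x powr \<alpha>) (\<lambda>x. x powr \<gamma>)" using reach[OF that] xy by simp
    have "\<not> (lower_reflecting (\<lambda>x. x powr \<alpha>) (x, y) \<and> upper_reflecting (\<lambda>x. x powr \<gamma>) (x, y))"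
      using wd[of "last l"] reach[OF that] xy by simp
    then show ?thesis
      using dom le_powr_iff_root_le[of "real y" "real x" \<gamma>] assms unfolding xy reflecting_iff[OF dom \<open>1 < \<gamma>\<close>]
      by (auto simp: Q_sym_def Q_domain_def)
  qed
  have AE_pos: "AE \<omega> in M. \<forall>l. follows \<zeta> l \<omega> \<longrightarrow> 0 < prob {\<omega> \<in> space M. follows \<zeta> l \<omega>}"
    unfolding AE_all_countable
  proof
    fix l
    show "AE \<omega> in M. follows \<zeta> l \<omega> \<longrightarrow> 0 < prob {\<omega> \<in> space M. follows \<zeta> l \<omega>}"
    proof (cases "prob {\<omega> \<in> space M. follows \<zeta> l \<omega>} = 0")
      case True
      then have "AE \<omega> in M. \<not> follows \<zeta> l \<omega>" by (subst (asm) prob_Collect_eq_0) auto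
      then show ?thesis by eventually_elim simp
    next
      case False
      then show ?thesis using measure_nonneg[of M "{\<omega> \<in> space M. follows \<zeta> l \<omega>}"] by (simp add: less_le)
    qed
  qed
  show ?thesis
  proof (unfold_locales)
    show "AE \<omega> in M. \<forall>t. \<zeta> t \<omega> \<in> Q_sym \<alpha> (1 / \<gamma>)" using AE_pos
    proof eventually_elim
      case (elim \<omega>)
      show ?case
      proof
        fix t
        show "\<zeta> t \<omega> \<in> Q_sym \<alpha> (1 / \<gamma>)"
          using good[of "history \<zeta> t \<omega>"] elim by (simp add: history_simps)
      qed
    qed
    show "AE \<omega> in M. \<forall>t. \<zeta> (Suc t) \<omega> = (fst (\<zeta> t \<omega>) + 1, snd (\<zeta> t \<omega>)) \<or> \<zeta> (Suc t) \<omega> = (fst (\<zeta> t \<omega>), snd (\<zeta> t \<omega>) + 1)"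
      using AE_pos
    proof eventually_elim
      case (elim \<omega>)
      show ?case
      proof
        fix t
        have "history \<zeta> (Suc t) \<omega> = history \<zeta> t \<omega> @ [\<zeta> (Suc t) \<omega>]" by (simp add: history_def)
        then have pos: "0 < prob {\<omega>' \<in> space M. follows \<zeta> (history \<zeta> t \<omega> @ [\<zeta> (Suc t) \<omega>]) \<omega>'}"
          using elim history_simps(4)[of \<zeta> "Suc t" \<omega>] by metis
        have hp: "0 < prob {\<omega>' \<in> space M. follows \<zeta> (history \<zeta> t \<omega>) \<omega>'}"
          and v: "\<zeta> (Suc t) \<omega> \<in> set_pmf (K (\<zeta> t \<omega>))"
          using snoc_pos[OF history_simps(1) pos] by (simp_all add: history_simps)
        have r: "\<zeta> t \<omega> \<in> Q_domain (\<lambda>x. x powr \<alpha>) (\<lambda>x. x powr \<gamma>)" "(\<lambda>u v. v \<in> set_pmf (K u))\<^sup>*\<^sup>* s (\<zeta> t \<omega>)"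
          using reach[OF history_simps(1) hp] by (simp_all add: history_simps)
        show "\<zeta> (Suc t) \<omega> = (fst (\<zeta> t \<omega>) + 1, snd (\<zeta> t \<omega>)) \<or> \<zeta> (Suc t) \<omega> = (fst (\<zeta> t \<omega>), snd (\<zeta> t \<omega>) + 1)"
          using domain_step[of "fst (\<zeta> t \<omega>)" "snd (\<zeta> t \<omega>)" "fst (\<zeta> (Suc t) \<omega>)" "snd (\<zeta> (Suc t) \<omega>)"] r wd[OF r(2)] v
          by simp
      qed
    qed
    fix l :: "(nat \<times> nat) list" and v
    assume l: "l \<noteq> []"
    show "prob {\<omega> \<in> space M. follows \<zeta> (l @ [v]) \<omega>} =
        prob {\<omega> \<in> space M. follows \<zeta> l \<omega>} * mean_step \<alpha> (1 / \<gamma>) \<beta> (indicator {v}) (last l)"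
    proof (cases "prob {\<omega> \<in> space M. follows \<zeta> l \<omega>} = 0")
      case True
      then show ?thesis using mono[of l v] by (simp add: measure_le_0_iff)
    next
      case False
      then have pos: "0 < prob {\<omega> \<in> space M. follows \<zeta> l \<omega>}" by (simp add: zero_less_measure_iff)
      show ?thesis
        using trans[OF l pos, of v] pmf_bins_step[OF conjunct1[OF reach[OF l pos]] \<open>1 < \<gamma>\<close>, of \<beta> v]
        by (simp add: K_def)
    qed
  qed (use assms in auto)
qed

text \<open>
  Near the lower boundary \<open>y\<close> is at most \<open>x\<^sup>a\<close> plus a constant, near the upper one \<open>x\<close> is at most
  \<open>y\<close> plus a constant; both together bound \<open>x\<close>.
\<close>

lemma event_A_disjoint:
  assumes a: "0 < a" "a < 1" and g: "1 < g"
    and top: "filterlim (\<lambda>t. fst (z t)) at_top sequentially" and pos: "\<And>t. 1 \<le> snd (z t)"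
    and A: "z \<in> event_A a k" "z \<in> event_A_tilde g k'"
  shows False
proof -
  have "eventually (\<lambda>t. ereal (real (snd (z t)) - real (fst (z t)) powr a) < ereal (real_of_int k + 1)) sequentially"
    using A(1) by (intro Limsup_lessD) (simp add: event_A_def)
  moreover have "eventually (\<lambda>t. ereal (real (fst (z t)) - real (snd (z t)) powr (1 / g)) < ereal (real_of_int k' + 1)) sequentially"
    using A(2) by (intro Limsup_lessD) (simp add: event_A_tilde_def)
  moreover have "eventually (\<lambda>x::nat. real x powr a + (real_of_int k + real_of_int k' + 2) \<le> real x) sequentially"
    using a by real_asymp
  then have "eventually (\<lambda>t. real (fst (z t)) powr a + (real_of_int k + real_of_int k' + 2) \<le> real (fst (z t))) sequentially"
    using top by (rule eventually_compose_filterlim)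
  ultimately have "eventually (\<lambda>t. False) sequentially"
  proof eventually_elim
    case (elim t)
    have "real (snd (z t)) powr (1 / g) \<le> real (snd (z t)) powr 1"
      using pos[of t] g by (intro powr_mono) auto
    then show ?case using elim pos[of t] by simp
  qed
  then show False by simp
qed

lemma int_between_unique:
  fixes c :: real
  shows "(c < real_of_int k \<and> real_of_int k \<le> 1 + c) \<longleftrightarrow> k = \<lfloor>c\<rfloor> + 1"
  by linarith

theorem theorem2p4:
  fixes \<alpha> \<beta> \<gamma> :: real
    and s :: "nat \<times> nat"
    and M :: "'a measure"
    and \<zeta> :: "nat \<Rightarrow> 'a \<Rightarrow> nat \<times> nat"
  assumes "\<beta> > 1" and "0 < \<alpha>" and "\<alpha> < 1" and "1 < \<gamma>"
    and "balls_in_bins M \<zeta> (\<lambda>x. x powr \<alpha>) (\<lambda>x. x powr \<gamma>) \<beta> \<beta> s"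
  shows "\<exists>k1 k2 :: int.
     (\<forall>k :: int. (\<alpha> / ((\<beta> - 1) * (1 - \<alpha>)) < real_of_int k \<and>
                  real_of_int k \<le> 1 + \<alpha> / ((\<beta> - 1) * (1 - \<alpha>))) \<longleftrightarrow> k = k1) \<and>
     (\<forall>k :: int. (1 / ((\<beta> - 1) * (\<gamma> - 1)) < real_of_int k \<and>
                  real_of_int k \<le> 1 + 1 / ((\<beta> - 1) * (\<gamma> - 1))) \<longleftrightarrow> k = k2) \<and>
     measure M {\<omega> \<in> space M. (\<lambda>t. \<zeta> t \<omega>) \<in> event_A \<alpha> k1} +
     measure M {\<omega> \<in> space M. (\<lambda>t. \<zeta> t \<omega>) \<in> event_A_tilde \<gamma> k2} = 1"
proof -
  interpret reflected_bins M \<zeta> \<alpha> "1 / \<gamma>" \<beta>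
    using assms by (rule balls_in_bins_reflected_bins)
  interpret swapped: reflected_bins M "\<lambda>t \<omega>. prod.swap (\<zeta> t \<omega>)" "1 / \<gamma>" \<alpha> \<beta>
    by (rule reflected_bins_swap)
  have crit: "\<exists>k::nat. int k = \<lfloor>c\<rfloor> + 1 \<and> \<kappa> a' \<beta> * (real k - 1) \<le> 1 \<and> 1 < \<kappa> a' \<beta> * real k"
    if a': "0 < a'" "a' < 1" and c: "c = a' / ((\<beta> - 1) * (1 - a'))" for a' c
  proof -
    have c0: "0 < c" and \<kappa>c: "\<kappa> a' \<beta> = 1 / c" using a' assms(1) by (simp_all add: c \<kappa>_def)
    define k where "k = nat (\<lfloor>c\<rfloor> + 1)"
    have "0 \<le> \<lfloor>c\<rfloor>" using c0 by simp
    then have k: "int k = \<lfloor>c\<rfloor> + 1" by (simp add: k_def)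
    then have "real k = real_of_int \<lfloor>c\<rfloor> + 1" by linarith
    then have "real k - 1 \<le> c" "c < real k" by linarith+
    then show ?thesis using k c0 by (intro exI[of _ k]) (simp add: \<kappa>c field_simps)
  qed
  obtain k1 :: nat where k1: "int k1 = \<lfloor>\<alpha> / ((\<beta> - 1) * (1 - \<alpha>))\<rfloor> + 1"
    "\<kappa> \<alpha> \<beta> * (real k1 - 1) \<le> 1" "1 < \<kappa> \<alpha> \<beta> * real k1"
    using crit[OF a refl] by blast
  have "1 / ((\<beta> - 1) * (\<gamma> - 1)) = (1 / \<gamma>) / ((\<beta> - 1) * (1 - 1 / \<gamma>))"
    using assms by (simp add: field_simps)
  then obtain k2 :: nat where k2: "int k2 = \<lfloor>1 / ((\<beta> - 1) * (\<gamma> - 1))\<rfloor> + 1"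
    "\<kappa> (1 / \<gamma>) \<beta> * (real k2 - 1) \<le> 1" "1 < \<kappa> (1 / \<gamma>) \<beta> * real k2"
    using crit[OF b] by blast
  define A where "A = {\<omega> \<in> space M. (\<lambda>t. \<zeta> t \<omega>) \<in> event_A \<alpha> (int k1)}"
  define B where "B = {\<omega> \<in> space M. (\<lambda>t. \<zeta> t \<omega>) \<in> event_A_tilde \<gamma> (int k2)}"
  have [measurable]: "(\<lambda>\<omega>. ereal (f (\<zeta> t \<omega>))) \<in> borel_measurable M" for f :: "nat \<times> nat \<Rightarrow> real" and t
    by (rule measurable_compose[OF X_measurable]) simp
  have [measurable]: "A \<in> sets M" "B \<in> sets M"
    unfolding A_def B_def event_A_def event_A_tilde_def mem_Collect_eq by measurable
  have swap: "(\<lambda>t. prod.swap (z t)) \<in> event_A (1 / \<gamma>) k \<longleftrightarrow> z \<in> event_A_tilde \<gamma> k" for z k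
    by (simp add: event_A_def event_A_tilde_def)
  have "AE \<omega> in M. \<omega> \<in> A \<union> B"
    using AE_event_A[OF k1(2,3)] swapped.AE_event_A[OF k2(2,3)] AE_not_interior_forever AE_space
  proof eventually_elim
    case (elim \<omega>)
    have "\<exists>\<^sub>\<infinity>t. at_lower \<alpha> (\<zeta> t \<omega>) \<or> at_lower (1 / \<gamma>) (prod.swap (\<zeta> t \<omega>))"
      using elim(3) by (simp add: interior_set_def at_upper_def)
    then show ?case using elim(1,2,4) by (auto simp: frequently_disj_iff A_def B_def swap)
  qed
  then have "prob (A \<union> B) = 1" by (subst prob_eq_1) auto
  moreover have "AE \<omega> in M. \<omega> \<notin> A \<inter> B" using AE_domain AE_fst_at_top
  proof eventually_elim
    case (elim \<omega>)
    have "1 \<le> snd (\<zeta> t \<omega>)" for t using elim(1)[rule_format, of t] by (auto simp: Q_sym_def)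
    then show ?case using event_A_disjoint[OF a assms(4) elim(2)] by (auto simp: A_def B_def)
  qed
  then have "prob (A \<inter> B) = 0" by (subst prob_eq_0) auto
  ultimately have "prob A + prob B = 1"
    using finite_measure_Union'[of A B] finite_measure_Diff'[of B A] by (simp add: Int_commute)
  then show ?thesis unfolding A_def B_def
    using k1(1) k2(1) by (intro exI[of _ "int k1"] exI[of _ "int k2"]) (simp add: int_between_unique)
qed

end
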